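(* Suppose that an $n$-qubit state $|\psi_0\rangle$ is uniquely stabilized by a Clifford-stabilizer group with an admissible set of Clifford-stabilizer generators $G_1,\dots,G_n$, and that each protocol measurement is implemented according to the chosen factorization of the measured generator. Start from $|\psi_0\rangle$ with current generators $G_1,\dots,G_n$ and perform any sequence of protocol measurements under circuit-level Pauli errors. Then the Clifford-stabilizer group can be updated in a manner analogous to an ordinary Pauli-stabilizer group. That is, the following rules keep a list $G_1',\dots,G_n'$ of current generators that uniquely stabilizes the current state at every step. (i) Under a data error $E$, every current generator is replaced by $EG_j'E^\dagger$. (ii) For the effectively measured operator $\tilde M$ of any protocol measurement and every current generator $G_j'$, the operators $\tilde M$ and $G_j'$ either effectively commute or effectively anticommute on the current state. (iii) If $\tilde M$ effectively anticommutes with at least one current generator, then the outcome $(-1)^b$, $b\in\{0,1\}$, is uniformly random, and the generators are updated as follows: choose a pivot $G_p'$ that effectively anticommutes with $\tilde M$; replace every other generator $G_j'$ that effectively anticommutes with $\tilde M$ by $G_j'G_p'$; then replace $G_p'$ by $(-1)^b\tilde M$. (iv) Whenever a protocol measurement has a deterministic outcome, the group remains unchanged, and the measured operator is, up to the deterministic sign, a product of the current generators; that is, if the deterministic outcome is $(-1)^m$, then a product of current generators equals $(-1)^m\tilde M$.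
   Context: Basic notation. $\mathcal P_n=\{\pm1,\pm i\}\times\{I,X,Y,Z\}^{\otimes n}$ is the Pauli group; the Clifford group $\mathcal C^{(2)}$ is the set of $n$-qubit unitaries $U$ with $UPU^\dagger\in\mathcal P_n$ for all $P\in\mathcal P_n$. For unitaries, $[A,B]:=ABA^\dagger B^\dagger$. $A$ and $B$ effectively commute (resp. effectively anticommute) on $|\psi\rangle$ if $[A,B]|\psi\rangle=|\psi\rangle$ (resp. $[A,B]|\psi\rangle=-|\psi\rangle$). A Clifford-stabilizer group is a finite subgroup of $\mathcal C^{(2)}$ with nonzero common $+1$ eigenspace; a state is uniquely stabilized by it (or by a list of generators) if it spans that eigenspace. Factorizations. The group is given with $n$ Hermitian generators $G_1,\dots,G_n$ (the original generators), each a Pauli or non-Pauli Clifford operator, together with a fixed factorization $G=\prod_jU_j$ of each generator, where each $U_j$ is either a one-qubit Pauli operator (Pauli factor) or a one- or two-qubit non-Pauli Clifford operator (Clifford factor). $\mathcal L_{\rm P},\mathcal L_{\rm C}$ denote the sets of all Pauli and Clifford factors appearing in any original generator (as operators on specified qubits). Protocol measurements and noise. A protocol measurement is the measurement of one of the original generators $M=\prod_jU_j$. It is implemented, according to its factorization, by a sequence of controlled-$U_j$ operations controlled by ancilla qubits, each realized by a controlled gate possibly conjugated by non-Clifford gates on the data qubits. Circuit-level Pauli errors are Pauli errors at arbitrary locations of the circuit. Their effect is: (a) data errors occurring between protocol measurements, which are products of single-qubit Pauli operators and Clifford errors, each Clifford error (from a hook error) being equal to a Clifford factor in $\mathcal L_{\rm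 C}$ with the same support; (b) replacement of the measured operator by an effectively measured operator $\tilde M=\prod_jD_j^{t_j}U_j$, $t_j\in\{0,1\}$, where $D_j$ is a Pauli dressing of $U_j$; (c) flips of the recorded readout. Here a Pauli dressing of $U_j$ is the operator (a Pauli operator times a phase in $\{\pm1,\pm i\}$) by which the controlled factor $U_j$ gets multiplied when errors are propagated through the controlled-$U_j$: either $E^\dagger U_jEU_j^\dagger$ for a product $E$ of data errors, or, for a non-Hermitian Clifford factor $U_j=C$, the operator $(C^\dagger)^2$ produced by an ancilla error. If no such error occurs, $\tilde M=M$. Dressings. For a single-qubit Pauli error $E_{\rm P}$ and $C\in\mathcal L_{\rm C}$, put $D_C(E_{\rm P}):=E_{\rm P}CE_{\rm P}^\dagger C^\dagger$. $\mathcal D$ denotes the set of possible Pauli dressings: the $D_C(E_{\rm P})$ and the operators $[E_{\rm C},P]$ for $P\in\mathcal L_{\rm P}$ and Clifford errors $E_{\rm C}\in\mathcal L_{\rm C}$. $\mathcal B_{\rm gc}$ is the Pauli subgroup generated by the Pauli operators appearing in group commutators $[G_i,G_j]$ of original generators. Primary-support exactness. Let $\mathcal B_{\rm init}\supseteq\mathcal B_{\rm gc}$ be a subgroup of Pauli operators in the original group whose elements commute with all possible Pauli dressings and remain stabilizers, up to sign, throughout the protocol. The primary generators are a maximal subset of the original generators such that no product of distinct members belongs to $\mathcal B_{\rm init}$; the $n$ original generators are chosen to consist of the primary generators and independent elements of $\mathcal B_{\rm init}$. For each qubit $q$, $Q_q\in\{X_q,Y_q,Z_q\}$ is the common Pauli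 axis of the nontrivial dressings in $\mathcal D$ acting on $q$, and for $c\in\mathbb F_2^n$, $Q(c):=\prod_{q:c_q=1}Q_q$ (a dressing-axis Pauli). The primary part of an operator is the collection of operators appearing in the primary generators, excluding the Pauli operators of dressing axes; a product of generators has no primary part (is zero-primary) if the primary parts cancel and only dressing-axis Pauli operators remain, i.e. the product is a dressing-axis Pauli up to a phase. $\mathcal B$ is the Pauli subgroup generated by all zero-primary products of the generators. The dressing-anticommutation support $v_j\in\mathbb F_2^n$ of a generator $G_j$ is defined by $Q(c)G_j=(-1)^{c\cdot v_j}G_jQ(c)$ for all $c$. Generators $G_1,\dots,G_n$ satisfy primary-support exactness if for every $m\in\mathbb F_2^n$: $\sum_jm_jv_j=0$ if and only if $\prod_jG_j^{m_j}$ has no primary part (equivalently, is a Pauli operator in $\mathcal B$). Admissible set. The Hermitian generators $G_1,\dots,G_n$ with their factorizations form an admissible set of Clifford-stabilizer generators if: (1) their common $+1$ eigenspace is one-dimensional; (2) for every Clifford factor $C$ and single-qubit Pauli error $E_{\rm P}$, $D_C(E_{\rm P})$ has weight at most one, and all such dressings mutually commute; (3) the generators satisfy primary-support exactness; (4) for each generator, every possible effectively measured operator is Hermitian (for this it suffices that $\lambda_i\prod_js_{i,j}=1$ for every $i$ and every possible dressing $D_i$ of $U_i$, where $D_i^2=\lambda_iI$ and $D_iU_j=s_{i,j}U_jD_i$). *)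

theory Defs
  imports "HOL-Analysis.Analysis" "HOL-Library.Z2" "HOL-Algebra.Generated_Groups"
begin

text \<open>
  Qubits are the elements of a finite type \<open>'n\<close>, so the number of qubits is \<open>CARD('n)\<close>.
  Computational basis states are functions \<open>'n \<Rightarrow> bool\<close>, and \<open>\<bbbF>\<^sub>2\<^sup>n\<close> is \<open>bit ^ 'n\<close>.  The scalar multiple
  of an operator \<open>A\<close> by \<open>k\<close> is written \<open>mat k ** A\<close>.
\<close>

type_synonym 'n state = "complex ^ ('n \<Rightarrow> bool)"
type_synonym 'n oper = "complex ^ ('n \<Rightarrow> bool) ^ ('n \<Rightarrow> bool)"

section \<open>Operators\<close>

definition dagger :: "('n::finite) oper \<Rightarrow> 'n oper"
  where "dagger A = (\<chi> r c. cnj (A $ c $ r))"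

definition is_unitary :: "('n::finite) oper \<Rightarrow> bool"
  where "is_unitary U \<longleftrightarrow> U ** dagger U = mat 1 \<and> dagger U ** U = mat 1"

definition is_hermitian :: "('n::finite) oper \<Rightarrow> bool"
  where "is_hermitian A \<longleftrightarrow> dagger A = A"

definition unitary_group :: "('n::finite) oper monoid"
  where "unitary_group = \<lparr>carrier = {U. is_unitary U}, mult = (**), one = mat 1\<rparr>"

definition commutator :: "('n::finite) oper \<Rightarrow> 'n oper \<Rightarrow> 'n oper"
  where "commutator A B = A ** B ** dagger A ** dagger B"

definition op_prod :: "('n::finite) oper list \<Rightarrow> 'n oper"
  where "op_prod As = foldr (**) As (mat 1)"

text \<open>The sign \<open>(-1)\<^sup>b\<close>.\<close>

definition pm_sign :: "bit \<Rightarrow> complex"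
  where "pm_sign b = (if b = 0 then 1 else - 1)"

text \<open>\<open>U\<close> has the form \<open>u \<otimes> I\<close> with \<open>u\<close> acting on the qubits in \<open>S\<close>.  The argument
  \<open>\<lambda>q. q \<in> S \<and> r q\<close> of \<open>u\<close> is the restriction of the basis state \<open>r\<close> to \<open>S\<close>.\<close>

definition acts_on :: "'n set \<Rightarrow> ('n::finite) oper \<Rightarrow> bool"
  where "acts_on S U \<longleftrightarrow>
    (\<exists>u :: ('n \<Rightarrow> bool) \<Rightarrow> ('n \<Rightarrow> bool) \<Rightarrow> complex. \<forall>r c. U $ r $ c =
      (if \<forall>q. q \<notin> S \<longrightarrow> r q = c q then u (\<lambda>q. q \<in> S \<and> r q) (\<lambda>q. q \<in> S \<and> c q) else 0))"

section \<open>Pauli and Clifford groups\<close>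

datatype pauli = PI | PX | PY | PZ

text \<open>Entry of the \<open>2 \<times> 2\<close> Pauli matrix in row \<open>r\<close> and column \<open>c\<close>, where \<open>False\<close> is \<open>|0\<rangle>\<close> and
  \<open>True\<close> is \<open>|1\<rangle>\<close>.\<close>

fun pauli_entry :: "pauli \<Rightarrow> bool \<Rightarrow> bool \<Rightarrow> complex" where
  "pauli_entry PI r c = (if r = c then 1 else 0)"
| "pauli_entry PX r c = (if r = c then 0 else 1)"
| "pauli_entry PY r c = (if r = c then 0 else if r then \<i> else - \<i>)"
| "pauli_entry PZ r c = (if r = c then (if r then - 1 else 1) else 0)"

definition pauli_op :: "('n \<Rightarrow> pauli) \<Rightarrow> ('n::finite) oper"
  where "pauli_op p = (\<chi> r c. \<Prod>q\<in>UNIV. pauli_entry (p q) (r q) (c q))"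

definition phases :: "complex set"
  where "phases = {1, - 1, \<i>, - \<i>}"

definition pauli_group :: "('n::finite) oper set"
  where "pauli_group = {mat k ** pauli_op p | k p. k \<in> phases}"

definition weight_le_one :: "('n::finite) oper \<Rightarrow> bool"
  where "weight_le_one A \<longleftrightarrow>
    (\<exists>k\<in>phases. \<exists>p. A = mat k ** pauli_op p \<and> card {q. p q \<noteq> PI} \<le> 1)"

definition pauli_on :: "'n \<Rightarrow> pauli \<Rightarrow> ('n::finite) oper"
  where "pauli_on q x = pauli_op ((\<lambda>_. PI)(q := x))"

definition single_paulis :: "('n::finite) oper set"
  where "single_paulis = {pauli_on q x | q x. x \<noteq> PI}"

definition clifford_group :: "('n::finite) oper set"
  where "clifford_group =
    {U. is_unitary U \<and> (\<forall>P\<in>pauli_group. U ** P ** dagger U \<in> pauli_group)}"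

section \<open>Clifford-stabilizer groups\<close>

definition common_eigenspace :: "('n::finite) oper set \<Rightarrow> 'n state set"
  where "common_eigenspace S = {\<phi>. \<forall>g\<in>S. g *v \<phi> = \<phi>}"

definition clifford_stabilizer_group :: "('n::finite) oper set \<Rightarrow> bool"
  where "clifford_stabilizer_group H \<longleftrightarrow>
    subgroup H unitary_group \<and> finite H \<and> H \<subseteq> clifford_group \<and> common_eigenspace H \<noteq> {0}"

definition uniquely_stabilizes :: "('n::finite) oper set \<Rightarrow> 'n state \<Rightarrow> bool"
  where "uniquely_stabilizes S \<psi> \<longleftrightarrow> \<psi> \<noteq> 0 \<and> common_eigenspace S = vec.span {\<psi>}"

definition eff_commute :: "('n::finite) state \<Rightarrow> 'n oper \<Rightarrow> 'n oper \<Rightarrow> bool"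
  where "eff_commute \<psi> A B \<longleftrightarrow> commutator A B *v \<psi> = \<psi>"

definition eff_anticommute :: "('n::finite) state \<Rightarrow> 'n oper \<Rightarrow> 'n oper \<Rightarrow> bool"
  where "eff_anticommute \<psi> A B \<longleftrightarrow> commutator A B *v \<psi> = - \<psi>"

text \<open>The ordered product \<open>\<Prod>\<^sub>j G\<^sub>j\<^bsup>m\<^sub>j\<^esup>\<close>; the generators need not commute.\<close>

definition gen_power :: "('n::finite) oper list \<Rightarrow> (nat \<Rightarrow> bit) \<Rightarrow> 'n oper"
  where "gen_power Gs m = op_prod (map (\<lambda>j. if m j = 1 then Gs ! j else mat 1) [0..<length Gs])"

section \<open>Factorizations, errors and dressings\<close>

text \<open>A factorization \<open>F\<close> lists, for each original generator, its factors as \<open>n\<close>-qubit operators.\<close>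

definition generators :: "('n::finite) oper list list \<Rightarrow> 'n oper list"
  where "generators F = map op_prod F"

definition pauli_factor :: "('n::finite) oper \<Rightarrow> bool"
  where "pauli_factor U \<longleftrightarrow> (\<exists>k\<in>phases. \<exists>P\<in>single_paulis. U = mat k ** P)"

definition clifford_factor :: "('n::finite) oper \<Rightarrow> bool"
  where "clifford_factor U \<longleftrightarrow>
    U \<in> clifford_group \<and> U \<notin> pauli_group \<and> (\<exists>S. card S \<in> {1, 2} \<and> acts_on S U)"

definition pauli_factors :: "('n::finite) oper list list \<Rightarrow> 'n oper set"
  where "pauli_factors F = {U \<in> \<Union>(set ` set F). pauli_factor U}"

definition clifford_factors :: "('n::finite) oper list list \<Rightarrow> 'n oper set"
  where "clifford_factors F = {U \<in> \<Union>(set ` set F). clifford_factor U}"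

definition data_errors :: "('n::finite) oper list list \<Rightarrow> 'n oper set"
  where "data_errors F = {op_prod Es | Es. set Es \<subseteq> single_paulis \<union> clifford_factors F}"

text \<open>\<open>D\<^sub>C(E) = E C E\<^sup>\<dagger> C\<^sup>\<dagger>\<close>\<close>

definition dressing_of :: "('n::finite) oper \<Rightarrow> 'n oper \<Rightarrow> 'n oper"
  where "dressing_of C E = E ** C ** dagger E ** dagger C"

definition clifford_dressings :: "('n::finite) oper list list \<Rightarrow> 'n oper set"
  where "clifford_dressings F = {dressing_of C E | C E. C \<in> clifford_factors F \<and> E \<in> single_paulis}"

definition possible_dressings :: "('n::finite) oper list list \<Rightarrow> 'n oper set"
  where "possible_dressings F = clifford_dressings F \<union>
    {commutator C P | C P. C \<in> clifford_factors F \<and> P \<in> pauli_factors F}"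

text \<open>The operators by which a controlled factor \<open>U\<close> can get multiplied: the first set comes from
  data errors propagated through it, the second from an ancilla error at a non-Hermitian Clifford
  factor.  Membership in the Pauli group is not imposed, so no error is left out.\<close>

definition factor_dressings :: "('n::finite) oper list list \<Rightarrow> 'n oper \<Rightarrow> 'n oper set"
  where "factor_dressings F U =
    {dagger E ** U ** E ** dagger U | E. E \<in> data_errors F} \<union>
    (if U \<in> clifford_factors F \<and> \<not> is_hermitian U then {dagger U ** dagger U} else {})"

text \<open>The operators \<open>\<Prod>\<^sub>j D\<^sub>j\<^bsup>t\<^sub>j\<^esup> U\<^sub>j\<close> that can be measured instead of \<open>\<Prod>\<^sub>j U\<^sub>j\<close>.\<close>

definition effective_ops :: "('n::finite) oper list list \<Rightarrow> 'n oper list \<Rightarrow> 'n oper set"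
  where "effective_ops F Us =
    {op_prod (map (\<lambda>j. (if t j then D j else mat 1) ** Us ! j) [0..<length Us]) | D t.
       \<forall>j<length Us. D j \<in> factor_dressings F (Us ! j)}"

section \<open>Noisy protocol\<close>

text \<open>\<open>Measurement i M b r\<close>: the \<open>i\<close>-th original generator is measured, the effectively measured
  operator is \<open>M\<close>, its outcome is \<open>(-1)\<^sup>b\<close>, and the recorded readout bit is \<open>r\<close>.  A readout
  flip is the case \<open>r \<noteq> b\<close>; it concerns the record only, so \<open>r\<close> is unconstrained below.\<close>

datatype ('n::finite) event =
  Data_Error "'n oper"
| Measurement nat "'n oper" bit bit

definition project :: "('n::finite) oper \<Rightarrow> bit \<Rightarrow> 'n state \<Rightarrow> 'n state"
  where "project M b \<psi> = (mat (1 / 2) ** (mat 1 + mat (pm_sign b) ** M)) *v \<psi>"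

definition outcome_prob :: "('n::finite) state \<Rightarrow> 'n oper \<Rightarrow> bit \<Rightarrow> real"
  where "outcome_prob \<psi> M b = (norm (project M b \<psi>))\<^sup>2"

inductive state_step ::
  "('n::finite) oper list list \<Rightarrow> 'n state \<Rightarrow> 'n event \<Rightarrow> 'n state \<Rightarrow> bool" for F where
  data_error: "E \<in> data_errors F \<Longrightarrow> state_step F \<psi> (Data_Error E) (E *v \<psi>)"
| measurement: "i < length F \<Longrightarrow> M \<in> effective_ops F (F ! i) \<Longrightarrow> outcome_prob \<psi> M b \<noteq> 0 \<Longrightarrow>
    state_step F \<psi> (Measurement i M b r)
      ((1 / norm (project M b \<psi>)) *\<^sub>R project M b \<psi>)"

inductive reachable :: "('n::finite) oper list list \<Rightarrow> 'n state \<Rightarrow> 'n state \<Rightarrow> bool"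
  for F \<psi>0 where
  init: "reachable F \<psi>0 \<psi>0"
| step: "reachable F \<psi>0 \<psi> \<Longrightarrow> state_step F \<psi> ev \<psi>' \<Longrightarrow> reachable F \<psi>0 \<psi>'"

section \<open>Admissible sets of generators\<close>

definition commutator_paulis :: "('n::finite) oper list list \<Rightarrow> 'n oper set"
  where "commutator_paulis F = generate unitary_group
    ({commutator g h | g h. g \<in> set (generators F) \<and> h \<in> set (generators F)} \<inter> pauli_group)"

definition init_paulis :: "('n::finite) oper list list \<Rightarrow> 'n oper set \<Rightarrow> bool"
  where "init_paulis F B \<longleftrightarrow>
    subgroup B unitary_group \<and>
    commutator_paulis F \<subseteq> B \<and>
    B \<subseteq> pauli_group \<inter> generate unitary_group (set (generators F)) \<and>
    (\<forall>b\<in>B. \<forall>d\<in>possible_dressings F. b ** d = d ** b) \<and>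
    (\<forall>\<psi>0 \<psi>. norm \<psi>0 = 1 \<longrightarrow> uniquely_stabilizes (set (generators F)) \<psi>0 \<longrightarrow> reachable F \<psi>0 \<psi> \<longrightarrow>
       (\<forall>b\<in>B. b *v \<psi> = \<psi> \<or> b *v \<psi> = - \<psi>))"

definition no_product_in ::
  "('n::finite) oper list list \<Rightarrow> 'n oper set \<Rightarrow> nat set \<Rightarrow> bool"
  where "no_product_in F B J \<longleftrightarrow>
    (\<forall>js. js \<noteq> [] \<and> distinct js \<and> set js \<subseteq> J \<longrightarrow> op_prod (map ((!) (generators F)) js) \<notin> B)"

definition primary_indices :: "('n::finite) oper list list \<Rightarrow> 'n oper set \<Rightarrow> nat set \<Rightarrow> bool"
  where "primary_indices F B J \<longleftrightarrow>
    J \<subseteq> {..<length F} \<and> no_product_in F B J \<and>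
    (\<forall>J'. J \<subset> J' \<and> J' \<subseteq> {..<length F} \<longrightarrow> \<not> no_product_in F B J') \<and>
    (\<forall>j\<in>{..<length F} - J. generators F ! j \<in> B) \<and>
    no_product_in F {mat 1} ({..<length F} - J)"

text \<open>\<open>Q q\<close> is the axis shared by all dressings acting nontrivially on \<open>q\<close>.  On a qubit on which no
  dressing acts nontrivially any axis is allowed.\<close>

definition dressing_axes :: "('n::finite) oper list list \<Rightarrow> ('n \<Rightarrow> pauli) \<Rightarrow> bool"
  where "dressing_axes F Q \<longleftrightarrow>
    (\<forall>q. Q q \<noteq> PI) \<and>
    (\<forall>d\<in>possible_dressings F. \<forall>k\<in>phases. \<forall>p q. d = mat k ** pauli_op p \<and> p q \<noteq> PI \<longrightarrow> p q = Q q)"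

definition axis_pauli :: "('n \<Rightarrow> pauli) \<Rightarrow> bit ^ 'n \<Rightarrow> ('n::finite) oper"
  where "axis_pauli Q c = pauli_op (\<lambda>q. if c $ q = 1 then Q q else PI)"

definition anticommutation_support ::
  "('n \<Rightarrow> pauli) \<Rightarrow> ('n::finite) oper \<Rightarrow> bit ^ 'n \<Rightarrow> bool"
  where "anticommutation_support Q g v \<longleftrightarrow>
    (\<forall>c. axis_pauli Q c ** g = mat (pm_sign (\<Sum>q\<in>UNIV. c $ q * v $ q)) ** (g ** axis_pauli Q c))"

definition zero_primary :: "('n \<Rightarrow> pauli) \<Rightarrow> ('n::finite) oper \<Rightarrow> bool"
  where "zero_primary Q A \<longleftrightarrow> (\<exists>k\<in>phases. \<exists>c. A = mat k ** axis_pauli Q c)"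

definition primary_support_exact :: "('n::finite) oper list list \<Rightarrow> bool"
  where "primary_support_exact F \<longleftrightarrow>
    (\<exists>B J Q v. init_paulis F B \<and> primary_indices F B J \<and> dressing_axes F Q \<and>
      (\<forall>j<length F. anticommutation_support Q (generators F ! j) (v j)) \<and>
      (\<forall>m :: nat \<Rightarrow> bit.
         (\<Sum>j<length F. m j *s v j) = 0 \<longleftrightarrow> zero_primary Q (gen_power (generators F) m)))"

definition admissible :: "('n::finite) oper list list \<Rightarrow> bool"
  where "admissible F \<longleftrightarrow>
    length F = CARD('n) \<and>
    (\<forall>Us\<in>set F. (\<forall>U\<in>set Us. pauli_factor U \<or> clifford_factor U) \<and> is_hermitian (op_prod Us)) \<and>
    vec.dim (common_eigenspace (set (generators F))) = 1 \<and>
    (\<forall>d\<in>clifford_dressings F. weight_le_one d) \<and>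
    (\<forall>d\<in>clifford_dressings F. \<forall>d'\<in>clifford_dressings F. d ** d' = d' ** d) \<and>
    primary_support_exact F \<and>
    (\<forall>Us\<in>set F. \<forall>M\<in>effective_ops F Us. is_hermitian M)"

section \<open>Update of the current generators\<close>

inductive gen_update ::
  "('n::finite) state \<Rightarrow> 'n event \<Rightarrow> 'n oper list \<Rightarrow> 'n oper list \<Rightarrow> bool" where
  data_error: "gen_update \<psi> (Data_Error E) Gs (map (\<lambda>g. E ** g ** dagger E) Gs)"
| random: "p < length Gs \<Longrightarrow> eff_anticommute \<psi> M (Gs ! p) \<Longrightarrow>
    gen_update \<psi> (Measurement i M b r) Gs
      ((map (\<lambda>g. if eff_anticommute \<psi> M g then g ** Gs ! p else g) Gs)[p := mat (pm_sign b) ** M])"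
| deterministic: "outcome_prob \<psi> M b = 1 \<Longrightarrow> gen_update \<psi> (Measurement i M b r) Gs Gs"

text \<open>\<open>tracked F \<psi>0 \<psi> Gs\<close>: some run of the noisy protocol from \<open>\<psi>0\<close> leads to \<open>\<psi>\<close>, and the update
  rules, with some choice of pivots, turn the original generators into \<open>Gs\<close> along this run.\<close>

inductive tracked ::
  "('n::finite) oper list list \<Rightarrow> 'n state \<Rightarrow> 'n state \<Rightarrow> 'n oper list \<Rightarrow> bool" for F \<psi>0 where
  init: "tracked F \<psi>0 \<psi>0 (generators F)"
| step: "tracked F \<psi>0 \<psi> Gs \<Longrightarrow> state_step F \<psi> ev \<psi>' \<Longrightarrow> gen_update \<psi> ev Gs Gs' \<Longrightarrow>
    tracked F \<psi>0 \<psi>' Gs'"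

end

theory Submission
  imports Defs
begin

text \<open>
  Conjugation by a Clifford factor changes every Pauli operator by an axis Pauli only, and axis Paulis
  by signs only.  Hence products of single-qubit errors, Clifford factors and Pauli factors commute
  modulo axis Paulis, all dressings are axis Paulis, and every operator that can become a current
  generator or be effectively measured lies in the group \<open>T\<close> of products of an axis Pauli and
  original generators.  By primary-support exactness, an element of \<open>T\<close> that is not a scalar
  anticommutes with some Pauli operator and is therefore traceless.  Averaging over the stabilizer in
  \<open>T\<close> of a state shows that this stabilizer has \<open>2\<^sup>n\<close> elements as soon as it determines the state, so
  that any uniquely stabilizing list of operators in \<open>T\<close> generates all of it; this yields rule (iv).
  Commutators in \<open>T\<close> lie in \<open>\<plusminus>B\<close>, where \<open>B\<close> is generated by the non-primary generators and central in
  \<open>T\<close>.  Those generators change at most by a sign, so on the joint eigenspace of \<open>B\<close> the update works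
  as for commuting Pauli stabilizers.
\<close>

text \<open>Two groups of corrections take over. Modulo axis Paulis all errors and factors commute,
  so noise never leads out of \<open>T\<close>. Modulo signed elements of \<open>B\<close> the
  operators in \<open>T\<close> commute, and these elements act on the current state by signs.
  Linear independence is replaced by a trace: the projector onto a line has trace one, while the
  average of a finite group whose other elements are traceless has trace \<open>2^n\<close> divided
  by the order. The count also works in reverse for the original generators: their
  \<open>2^n\<close> exponent vectors give distinct stabilizers of \<open>\<psi>0\<close>, hence all
  of them, and so the non-primary generators produce all of \<open>B\<close>. This makes uniqueness
  survive a random outcome: a vector fixed by the updated list is fixed by the unchanged non-primary
  entries, hence by every suitably signed element of \<open>B\<close>, and on such vectors the old
  generators commute with each other and anticommute with the measured operator exactly.\<close>

section \<open>Scalar multiples, adjoints and unitaries\<close>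

text \<open>A separate name for \<open>mat k ** A\<close> lets simplification move scalars outward
  past products without reassociating them.\<close>

definition smul :: "complex \<Rightarrow> ('n::finite) oper \<Rightarrow> 'n oper"
  where "smul k A = mat k ** A"

lemma smul_nth: "smul k A $ r $ c = k * A $ r $ c"
proof -
  have "(\<Sum>j\<in>UNIV. (if r = j then k else 0) * A $ j $ c) = (\<Sum>j\<in>UNIV. if r = j then k * A $ j $ c else 0)"
    by (rule sum.cong) auto
  then show ?thesis
    by (simp add: smul_def matrix_matrix_mult_def mat_def)
qed

lemma smul_mult_left [simp]: "smul k A ** B = smul k (A ** B)"
  by (simp add: smul_def matrix_mul_assoc)

lemma smul_mult_right [simp]: "A ** smul k B = smul k (A ** B)"
  by (simp add: vec_eq_iff smul_nth matrix_matrix_mult_def sum_distrib_left mult_ac)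

lemma smul_smul [simp]: "smul a (smul b A) = smul (a * b) A"
  by (simp add: vec_eq_iff smul_nth)

lemma smul_1 [simp]: "smul 1 A = A"
  by (simp add: smul_def)

lemma smul_vec: "smul k A *v x = k *s (A *v x)"
  by (simp add: vec_eq_iff smul_nth matrix_vector_mult_def sum_distrib_left mult_ac)

lemma smul_cancel: "k \<noteq> 0 \<Longrightarrow> smul k A = smul k B \<longleftrightarrow> A = B"
  by (simp add: vec_eq_iff smul_nth)

lemma smul_right_cancel: "A \<noteq> 0 \<Longrightarrow> smul k A = smul l A \<longleftrightarrow> k = l"
  by (auto simp: vec_eq_iff smul_nth)

lemma mult_assoc_right: "(A ** B) ** (C :: ('n::finite) oper) = A ** (B ** C)"
  by (simp add: matrix_mul_assoc)

lemma dagger_mult [simp]: "dagger (A ** B) = dagger B ** dagger A"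
  by (simp add: dagger_def vec_eq_iff matrix_matrix_mult_def mult_ac)

lemma dagger_dagger [simp]: "dagger (dagger A) = A"
  by (simp add: dagger_def vec_eq_iff)

lemma dagger_smul [simp]: "dagger (smul k A) = smul (cnj k) (dagger A)"
  by (simp add: dagger_def vec_eq_iff smul_nth)

lemma dagger_mat_1 [simp]: "dagger (mat 1) = mat 1"
  by (simp add: dagger_def vec_eq_iff mat_def)

lemma is_unitary_mat_1 [simp]: "is_unitary (mat 1)"
  by (simp add: is_unitary_def)

lemma is_unitary_dagger [simp]: "is_unitary (dagger U) = is_unitary U"
  by (auto simp: is_unitary_def)

lemma unitary_cancel:
  assumes "is_unitary U"
  shows "U ** dagger U = mat 1" "dagger U ** U = mat 1"
    "U ** (dagger U ** A) = A" "dagger U ** (U ** A) = A"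
    "A ** U ** dagger U = A" "A ** dagger U ** U = A"
  using assms by (simp_all add: is_unitary_def matrix_mul_assoc)
    (simp_all add: matrix_mul_assoc [symmetric])

lemma is_unitary_mult: "is_unitary U \<Longrightarrow> is_unitary V \<Longrightarrow> is_unitary (U ** V)"
  unfolding is_unitary_def[of "U ** V"] by (simp add: matrix_mul_assoc unitary_cancel)

lemma unit_cnj: "norm (k::complex) = 1 \<Longrightarrow> k * cnj k = 1" "norm (k::complex) = 1 \<Longrightarrow> cnj k * k = 1"
  by (simp_all add: complex_norm_square [symmetric] mult.commute)

lemma is_unitary_smul: "norm k = 1 \<Longrightarrow> is_unitary U \<Longrightarrow> is_unitary (smul k U)"
  by (simp add: is_unitary_def unit_cnj)

lemma mat_1_neq_0: "(mat 1 :: ('n::finite) oper) \<noteq> 0"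
  by (simp add: vec_eq_iff mat_def)

lemma unitary_neq_0: "is_unitary U \<Longrightarrow> U \<noteq> 0"
  using mat_1_neq_0 by (auto simp: is_unitary_def)

lemma unitary_eq_cancel:
  assumes "is_unitary U"
  shows "U ** A = U ** B \<longleftrightarrow> A = B" "A ** U = B ** U \<longleftrightarrow> A = B"
  using assms by (metis unitary_cancel(4)) (metis assms unitary_cancel(5))

text \<open>Writing each squared modulus as \<open>cnj z * z\<close> and exchanging the sums brings
  in \<open>dagger U ** U\<close>.\<close>

lemma norm_unitary:
  assumes "is_unitary U"
  shows "norm (U *v x) = norm x"
proof -
  have sq: "complex_of_real ((norm y)\<^sup>2) = (\<Sum>i\<in>UNIV. cnj (y $ i) * y $ i)" for y :: "'a state"
  proof -
    have "(norm y)\<^sup>2 = (\<Sum>i\<in>UNIV. (norm (y $ i))\<^sup>2)"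
      by (simp add: norm_vec_def L2_set_def sum_nonneg)
    then show ?thesis
      by (simp add: complex_norm_square mult.commute flip: of_real_power)
  qed
  have "(\<Sum>i\<in>UNIV. cnj ((U *v x) $ i) * (U *v x) $ i)
    = (\<Sum>i\<in>UNIV. \<Sum>j\<in>UNIV. \<Sum>k\<in>UNIV. cnj (x $ j) * (cnj (U $ i $ j) * U $ i $ k * x $ k))"
    by (simp add: matrix_vector_mult_def sum_product mult_ac) (rule sum.cong[OF refl], rule sum.swap)
  also have "\<dots> = (\<Sum>j\<in>UNIV. \<Sum>k\<in>UNIV. \<Sum>i\<in>UNIV. cnj (x $ j) * (cnj (U $ i $ j) * U $ i $ k * x $ k))"
    by (subst sum.swap, rule sum.cong[OF refl], rule sum.swap)
  also have "\<dots> = (\<Sum>j\<in>UNIV. cnj (x $ j) * ((dagger U ** U) *v x) $ j)"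
    by (simp add: matrix_vector_mult_def matrix_matrix_mult_def dagger_def sum_distrib_left
        sum_distrib_right mult_ac)
  also have "\<dots> = (\<Sum>j\<in>UNIV. cnj (x $ j) * x $ j)"
    using assms by (simp add: is_unitary_def)
  finally have "complex_of_real ((norm (U *v x))\<^sup>2) = complex_of_real ((norm x)\<^sup>2)"
    by (simp only: sq)
  then have "(norm (U *v x))\<^sup>2 = (norm x)\<^sup>2"
    using of_real_eq_iff by blast
  then show ?thesis by simp
qed

section \<open>Pauli operators\<close>

text \<open>The product of Pauli matrices without its phase is addition in the Klein four-group;
  \<open>pauli_phase\<close> is the corresponding cocycle.\<close>

fun pauli_mult :: "pauli \<Rightarrow> pauli \<Rightarrow> pauli" where
  "pauli_mult PI y = y"
| "pauli_mult x PI = x"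
| "pauli_mult PX PY = PZ" | "pauli_mult PY PX = PZ"
| "pauli_mult PX PZ = PY" | "pauli_mult PZ PX = PY"
| "pauli_mult PY PZ = PX" | "pauli_mult PZ PY = PX"
| "pauli_mult PX PX = PI" | "pauli_mult PY PY = PI" | "pauli_mult PZ PZ = PI"

fun pauli_phase :: "pauli \<Rightarrow> pauli \<Rightarrow> complex" where
  "pauli_phase PX PY = \<i>" | "pauli_phase PY PX = - \<i>"
| "pauli_phase PX PZ = - \<i>" | "pauli_phase PZ PX = \<i>"
| "pauli_phase PY PZ = \<i>" | "pauli_phase PZ PY = - \<i>"
| "pauli_phase x y = 1"

definition pauli_sign :: "pauli \<Rightarrow> pauli \<Rightarrow> complex"
  where "pauli_sign x y = (if x = PI \<or> y = PI \<or> x = y then 1 else - 1)"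

lemma pauli_entry_mult:
  "(\<Sum>b\<in>UNIV. pauli_entry x r b * pauli_entry y b c) = pauli_phase x y * pauli_entry (pauli_mult x y) r c"
  by (cases x; cases y; cases r; cases c) (simp_all add: UNIV_bool)

lemma pauli_mult_commute: "pauli_mult x y = pauli_mult y x"
  by (cases x; cases y) simp_all

lemma pauli_mult_self [simp]: "pauli_mult x x = PI" "pauli_phase x x = 1" "pauli_mult x PI = x"
  by (cases x; simp)+

lemma pauli_phase_commute: "pauli_phase x y = pauli_sign x y * pauli_phase y x"
  by (cases x; cases y) (simp_all add: pauli_sign_def)

lemma pauli_op_mult:
  "pauli_op p ** pauli_op p' =
    smul (\<Prod>q\<in>UNIV. pauli_phase (p q) (p' q)) (pauli_op (\<lambda>q. pauli_mult (p q) (p' q)))"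
proof -
  \<comment> \<open>Distributivity: the sum over basis states of a product over qubits is the
    product of one-qubit sums, so matrix multiplication acts qubit by qubit.\<close>
  have "(\<Sum>b\<in>UNIV. \<Prod>q\<in>UNIV. pauli_entry (p q) (r q) (b q) * pauli_entry (p' q) (b q) (c q))
    = (\<Prod>q\<in>UNIV. \<Sum>b\<in>UNIV. pauli_entry (p q) (r q) b * pauli_entry (p' q) b (c q))" for r c :: "'a \<Rightarrow> bool"
    by (subst prod_sum_PiE) (auto simp: PiE_UNIV_domain)
  then show ?thesis
    by (simp add: vec_eq_iff smul_nth matrix_matrix_mult_def pauli_op_def prod.distrib [symmetric]
        pauli_entry_mult)
qed

lemma pauli_op_commute:
  "pauli_op p ** pauli_op p' = smul (\<Prod>q\<in>UNIV. pauli_sign (p q) (p' q)) (pauli_op p' ** pauli_op p)"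
  by (simp add: pauli_op_mult pauli_mult_commute[of "p _"] prod.distrib [symmetric] pauli_phase_commute[of "p _"])

lemma pauli_op_PI: "pauli_op (\<lambda>_. PI) = mat 1"
proof -
  have "(\<Prod>q\<in>UNIV. if r q = c q then 1 else 0) = (if r = c then 1 else (0::complex))"
    for r c :: "'a \<Rightarrow> bool"
    by (auto simp: fun_eq_iff prod_zero_iff)
  then show ?thesis
    by (simp add: vec_eq_iff pauli_op_def mat_def)
qed

lemma pauli_op_self [simp]: "pauli_op p ** pauli_op p = mat 1"
  by (simp add: pauli_op_mult pauli_op_PI)

lemma dagger_pauli_op [simp]: "dagger (pauli_op p) = pauli_op p"
proof -
  have "cnj (pauli_entry x r c) = pauli_entry x c r" for x r c
    by (cases x) auto
  then show ?thesis
    by (simp add: vec_eq_iff dagger_def pauli_op_def)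
qed

lemma unitary_pauli_op [simp]: "is_unitary (pauli_op p)"
  by (simp add: is_unitary_def)

definition signs :: "complex set"
  where "signs = {1, - 1}"

lemma signs_mult: "a \<in> signs \<Longrightarrow> b \<in> signs \<Longrightarrow> a * b \<in> signs"
  by (auto simp: signs_def)

lemma signs_prod: "(\<And>x. x \<in> A \<Longrightarrow> f x \<in> signs) \<Longrightarrow> prod f A \<in> signs"
  by (induction A rule: infinite_finite_induct) (auto simp: signs_mult, simp_all add: signs_def)

lemma sign_self_mult [simp]: "s \<in> signs \<Longrightarrow> s * s = 1" "s \<in> signs \<Longrightarrow> cnj s = s" "s \<in> signs \<Longrightarrow> norm s = 1"
    "s \<in> signs \<Longrightarrow> s * (s * x) = x"
  by (auto simp: signs_def)

lemma signs_1 [simp]: "1 \<in> signs" "-1 \<in> signs"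
  by (simp_all add: signs_def)

lemma pauli_sign_in [simp]: "pauli_sign x y \<in> signs"
  by (simp add: pauli_sign_def)

lemma phases_mult: "a \<in> phases \<Longrightarrow> b \<in> phases \<Longrightarrow> a * b \<in> phases"
  by (auto simp: phases_def)

lemma phases_prod: "(\<And>x. x \<in> A \<Longrightarrow> f x \<in> phases) \<Longrightarrow> prod f A \<in> phases"
  by (induction A rule: infinite_finite_induct) (auto simp: phases_mult, auto simp: phases_def)

lemma phases_norm: "a \<in> phases \<Longrightarrow> norm a = 1"
  by (auto simp: phases_def)

lemma signs_phases: "s \<in> signs \<Longrightarrow> s \<in> phases"
  by (auto simp: phases_def signs_def)

lemma pauli_phase_in: "pauli_phase x y \<in> phases"
  by (cases x; cases y) (simp_all add: phases_def)

lemma pauli_group_iff: "A \<in> pauli_group \<longleftrightarrow> (\<exists>k\<in>phases. \<exists>p. A = smul k (pauli_op p))"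
  by (auto simp: pauli_group_def smul_def)

lemma pauli_group_mult: "A \<in> pauli_group \<Longrightarrow> B \<in> pauli_group \<Longrightarrow> A ** B \<in> pauli_group"
  by (fastforce simp: pauli_group_iff pauli_op_mult intro: phases_mult phases_prod pauli_phase_in)

lemma pauli_group_commute:
  assumes "A \<in> pauli_group" "B \<in> pauli_group"
  shows "\<exists>s\<in>signs. A ** B = smul s (B ** A)"
proof -
  obtain k p l p' where *: "A = smul k (pauli_op p)" "B = smul l (pauli_op p')"
    using assms by (auto simp: pauli_group_iff)
  show ?thesis
    by (rule bexI[of _ "\<Prod>q\<in>UNIV. pauli_sign (p q) (p' q)"])
      (auto simp: * pauli_op_commute[of p p'] mult_ac intro: signs_prod)
qed

lemma pauli_op_in_group [simp]: "pauli_op p \<in> pauli_group"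
  unfolding pauli_group_iff by (rule bexI[of _ 1]) (auto simp: phases_def)

lemma pauli_group_smul: "k \<in> phases \<Longrightarrow> A \<in> pauli_group \<Longrightarrow> smul k A \<in> pauli_group"
  by (fastforce simp: pauli_group_iff intro: phases_mult)

lemma pauli_group_unitary: "A \<in> pauli_group \<Longrightarrow> is_unitary A"
  by (auto simp: pauli_group_iff intro: is_unitary_smul phases_norm)

lemma pauli_group_square: 
  assumes "A \<in> pauli_group" shows "\<exists>s\<in>signs. A ** A = smul s (mat 1)"
  using assms by (fastforce simp: pauli_group_iff phases_def signs_def)

lemma single_pauli_simps:
  assumes "P \<in> single_paulis"
  shows "P \<in> pauli_group" "dagger P = P" "P ** P = mat 1" "is_unitary P"
  using assms by (auto simp: single_paulis_def pauli_on_def)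

lemma pauli_on_PI: "pauli_on q PI = mat 1"
  by (simp add: pauli_on_def pauli_op_PI fun_upd_idem)

lemma pauli_on_mult: "\<exists>k\<in>phases. pauli_on q x ** pauli_on q y = smul k (pauli_on q (pauli_mult x y))"
proof -
  have "(\<lambda>q'. pauli_mult (((\<lambda>_. PI)(q := x)) q') (((\<lambda>_. PI)(q := y)) q')) = (\<lambda>_. PI)(q := pauli_mult x y)"
    by auto
  then show ?thesis
    unfolding pauli_on_def pauli_op_mult by (metis phases_prod pauli_phase_in)
qed

lemma pauli_on_entry: "pauli_on q x $ r $ c = (if \<forall>q'. q' \<noteq> q \<longrightarrow> r q' = c q' then pauli_entry x (r q) (c q) else 0)"
proof -
  have "pauli_on q x $ r $ c = pauli_entry x (r q) (c q) * (\<Prod>q'\<in>UNIV - {q}. pauli_entry PI (r q') (c q'))"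
    by (simp add: pauli_on_def pauli_op_def prod.remove[of UNIV q])
  also have "(\<Prod>q'\<in>UNIV - {q}. pauli_entry PI (r q') (c q')) = (if \<forall>q'. q' \<noteq> q \<longrightarrow> r q' = c q' then 1 else 0)"
    by (auto simp: prod_zero_iff)
  finally show ?thesis by (simp only: if_distrib[of "\<lambda>y. _ * y"] mult_1_right mult_zero_right)
qed

lemma eq_fun_upd_bool: "(\<forall>q'. q' \<noteq> q \<longrightarrow> r q' = c q') \<longleftrightarrow> c = r \<or> c = r(q := \<not> r q)" for r c :: "'a \<Rightarrow> bool"
  by (auto simp: fun_eq_iff)

text \<open>Commuting with the \<open>Z\<^sub>q\<close> forces an operator to be diagonal, and commuting with the \<open>X\<^sub>q\<close>
  forces its diagonal entries to agree.\<close>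

lemma scalar_if_commutes_XZ:
  fixes A :: "('n::finite) oper"
  assumes X: "\<And>q. A ** pauli_on q PX = pauli_on q PX ** A"
    and Z: "\<And>q. A ** pauli_on q PZ = pauli_on q PZ ** A"
  shows "\<exists>k. A = smul k (mat 1)"
proof -
  have Zent: "pauli_on q PZ $ r $ c = (if r = c then (if c q then - 1 else 1) else 0)" for q and r c :: "'n \<Rightarrow> bool"
    unfolding pauli_on_entry eq_fun_upd_bool by auto
  have Xent: "pauli_on q PX $ r $ c = (if c = r(q := \<not> r q) then 1 else 0)" for q and r c :: "'n \<Rightarrow> bool"
    unfolding pauli_on_entry eq_fun_upd_bool by (auto simp: fun_eq_iff)
  have Xent': "pauli_on q PX $ r $ c = (if r = c(q := \<not> c q) then 1 else 0)" for q and r c :: "'n \<Rightarrow> bool"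
    unfolding Xent by (auto simp: fun_eq_iff)
  have off: "A $ r $ c = 0" if "r \<noteq> c" for r c
  proof -
    from that obtain q where q: "r q \<noteq> c q" by auto
    have "(A ** pauli_on q PZ) $ r $ c = (pauli_on q PZ ** A) $ r $ c"
      by (simp add: Z)
    then have "A $ r $ c * (if c q then - 1 else 1) = (if r q then - 1 else 1) * A $ r $ c"
      by (simp add: matrix_matrix_mult_def Zent if_distrib[of "\<lambda>x. _ * x"] if_distrib[of "\<lambda>x. x * _"] cong: if_cong)
    with q show ?thesis by (auto split: if_splits)
  qed
  have flip: "A $ r $ r = A $ (r(q := \<not> r q)) $ (r(q := \<not> r q))" for r q
  proof -
    have "(A ** pauli_on q PX) $ r $ (r(q := \<not> r q)) = (pauli_on q PX ** A) $ r $ (r(q := \<not> r q))"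
      by (simp add: X)
    moreover have "(A ** pauli_on q PX) $ r $ (r(q := \<not> r q)) = A $ r $ r"
      by (simp add: matrix_matrix_mult_def Xent' if_distrib[of "\<lambda>x. _ * x"] cong: if_cong)
    moreover have "(pauli_on q PX ** A) $ r $ (r(q := \<not> r q)) = A $ (r(q := \<not> r q)) $ (r(q := \<not> r q))"
      by (simp add: matrix_matrix_mult_def Xent if_distrib[of "\<lambda>x. x * _"] cong: if_cong)
    ultimately show ?thesis by simp
  qed
  \<comment> \<open>Flipping the qubits that are one, one at a time, connects every basis state to
    the all-zero state.\<close>
  have diag: "A $ r $ r = A $ (\<lambda>_. False) $ (\<lambda>_. False)" if "{q. r q} = S" for r S
    using finite[of S] that
  proof (induction S arbitrary: r rule: finite_induct)
    case empty
    then have "r = (\<lambda>_. False)" by auto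
    then show ?case by simp
  next
    case (insert q S)
    have "{q'. (r(q := \<not> r q)) q'} = S" using insert by auto
    from insert.IH[OF this] flip[of r q] show ?case by (simp only:)
  qed
  show ?thesis
  proof (rule exI[of _ "A $ (\<lambda>_. False) $ (\<lambda>_. False)"], unfold vec_eq_iff, intro allI)
    fix r c
    show "A $ r $ c = smul (A $ (\<lambda>_. False) $ (\<lambda>_. False)) (mat 1) $ r $ c"
    proof (cases "r = c")
      case True
      then show ?thesis by (simp only: diag[OF refl, of c] smul_nth mat_def vec_lambda_beta simp_thms if_True mult_1_right)
    qed (simp add: off smul_nth mat_def)
  qed
qed

text \<open>Two different Pauli matrices generate the third one up to a phase.\<close>

lemma commutes_third:
  fixes A :: "('n::finite) oper"
  assumes "x \<noteq> y" "x \<noteq> PI" "y \<noteq> PI" "A ** pauli_on q x = pauli_on q x ** A" "A ** pauli_on q y = pauli_on q y ** A"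
  shows "A ** pauli_on q z = pauli_on q z ** A"
proof -
  obtain k where k: "k \<in> phases" "pauli_on q x ** pauli_on q y = smul k (pauli_on q (pauli_mult x y))"
    using pauli_on_mult by blast
  have "A ** (pauli_on q x ** pauli_on q y) = (pauli_on q x ** pauli_on q y) ** A"
    by (metis assms(4,5) matrix_mul_assoc)
  then have *: "A ** pauli_on q (pauli_mult x y) = pauli_on q (pauli_mult x y) ** A"
    using k by (auto simp: smul_cancel phases_def)
  have "z = PI \<or> z = x \<or> z = y \<or> z = pauli_mult x y"
    using assms(1-3) by (cases x; cases y; cases z) auto
  with * assms show ?thesis by (auto simp: pauli_on_PI)
qed

text \<open>The two axes may depend on the qubit; this is applied to the dressing axis
  \<open>Q q\<close> and \<open>other_pauli (Q q)\<close>.\<close>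

lemma scalar_if_commutes_single:
  fixes A :: "('n::finite) oper"
  assumes "\<And>q. x q \<noteq> PI" "\<And>q. y q \<noteq> PI" "\<And>q. x q \<noteq> y q"
    and "\<And>q. A ** pauli_on q (x q) = pauli_on q (x q) ** A"
    and "\<And>q. A ** pauli_on q (y q) = pauli_on q (y q) ** A"
  shows "\<exists>k. A = smul k (mat 1)"
  by (rule scalar_if_commutes_XZ; rule commutes_third[of "x _" "y _"]) (use assms in auto)

text \<open>If \<open>b\<close> commutes with \<open>E C E\<^sup>\<dagger> C\<^sup>\<dagger>\<close>, then \<open>C\<^sup>\<dagger> b C\<close> and \<open>b\<close> have the same commutation
  sign with \<open>E\<close>.\<close>

lemma sign_commute_if_commutes_dressings:
  fixes C b :: "('n::finite) oper"
  assumes C: "is_unitary C" and b: "b \<in> pauli_group"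
    and comm: "\<And>E. E \<in> single_paulis \<Longrightarrow> b ** dressing_of C E = dressing_of C E ** b"
  shows "\<exists>s\<in>signs. C ** b = smul s (b ** C)"
proof -
  note ub = pauli_group_unitary[OF b]
  \<comment> \<open>\<open>W\<close> compares \<open>dagger C ** b ** C\<close> with
    \<open>b\<close>. Both have the same sign with each single-qubit Pauli, so \<open>W\<close>
    commutes with all of them and is a scalar.\<close>
  define W where "W = dagger C ** b ** C ** dagger b"
  have W: "W ** E = E ** W" if E: "E \<in> single_paulis" for E
  proof -
    note e = single_pauli_simps[OF E]
    obtain s where s: "s \<in> signs" "b ** E = smul s (E ** b)"
      using pauli_group_commute[OF b e(1)] by blast
    have s': "dagger b ** E = smul s (E ** dagger b)"
    proof -
      have "dagger (b ** E) = smul s (dagger (E ** b))" using s by simp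
      then have "smul s (dagger (b ** E)) = dagger (E ** b)" using s by simp
      then show ?thesis by (simp add: e)
    qed
    have "E ** (b ** dressing_of C E ** C) = E ** (dressing_of C E ** b ** C)"
      using comm[OF E] by simp
    moreover have "E ** (b ** dressing_of C E ** C) = smul s (b ** C ** E)"
      using s(1)  by (simp add: dressing_of_def e matrix_mul_assoc unitary_cancel[OF C])
        (simp add: matrix_mul_assoc[symmetric] unitary_cancel[OF C] e,
         metis (no_types, lifting) matrix_mul_assoc s(2) e(3) matrix_mul_lid smul_mult_left smul_mult_right sign_self_mult(1) smul_smul smul_1)
    moreover have "E ** (dressing_of C E ** b ** C) = C ** E ** dagger C ** b ** C"
      by (simp add: dressing_of_def e matrix_mul_assoc)
    ultimately have *: "smul s (dagger C ** b ** C ** E) = E ** dagger C ** b ** C"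
      by (metis (no_types, lifting) C matrix_mul_assoc smul_mult_right unitary_cancel(4))
    have "W ** E = smul s (dagger C ** b ** C ** E ** dagger b)"
      unfolding W_def by (metis matrix_mul_assoc s' smul_mult_right)
    also have "\<dots> = E ** W"
      unfolding W_def by (metis "*" matrix_mul_assoc smul_mult_left)
    finally show ?thesis .
  qed
  have "\<exists>k. W = smul k (mat 1)"
    by (rule scalar_if_commutes_XZ; rule W) (auto simp: single_paulis_def)
  then obtain k where "W = smul k (mat 1)" by blast
  then have "dagger C ** b ** C = smul k b"
    unfolding W_def by (metis unitary_cancel(6) ub matrix_mul_lid smul_mult_left)
  then have bC: "b ** C = smul k (C ** b)"
    by (metis C matrix_mul_assoc smul_mult_right unitary_cancel(3))
  \<comment> \<open>The scalar \<open>k\<close> is a sign because \<open>b ** b\<close> is a scalar: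
    moving two copies of \<open>b\<close> past \<open>C\<close> multiplies by \<open>k * k\<close>
    and must change nothing.\<close>
  obtain t where t: "t \<in> signs" "b ** b = smul t (mat 1)"
    using pauli_group_square[OF b] by blast
  have "smul t C = b ** (b ** C)"
    by (simp add: matrix_mul_assoc t)
  also have "\<dots> = smul k (b ** C ** b)" by (simp add: bC matrix_mul_assoc)
  also have "\<dots> = smul (k * k * t) C" by (simp add: bC matrix_mul_assoc[symmetric] t mult_ac)
  finally have "k * k * t = t" using unitary_neq_0[OF C] by (simp add: smul_right_cancel)
  then have "k * k = 1" using t by (auto simp: signs_def)
  then have "k \<in> signs" by (simp add: signs_def square_eq_1_iff)
  with bC have "C ** b = smul k (b ** C)" by simp
  with \<open>k \<in> signs\<close> show ?thesis by blast
qed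

section \<open>Ordered products modulo a normal subgroup\<close>

lemma op_prod_simps [simp]: "op_prod [] = mat 1" "op_prod (A # As) = A ** op_prod As"
  by (simp_all add: op_prod_def)

text \<open>When \<open>A\<close> is a group this is equality of the cosets \<open>A x\<close> and
  \<open>A y\<close>; the correction is always collected on the left.\<close>

definition eqv :: "('n::finite) oper set \<Rightarrow> 'n oper \<Rightarrow> 'n oper \<Rightarrow> bool"
  where "eqv A x y \<longleftrightarrow> (\<exists>a\<in>A. x = a ** y)"

text \<open>One calculus for four pairs: all unitaries modulo \<open>{mat 1}\<close>,
  \<open>axis_preserving\<close> modulo \<open>axis_group\<close>, and \<open>B_centralizer\<close>
  modulo \<open>signed_B\<close> or modulo \<open>B_stabilizer \<psi>\<close>.\<close>

locale normal_pair =
  fixes K A :: "('n::finite) oper set"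
  assumes K_unitary: "x \<in> K \<Longrightarrow> is_unitary x"
    and K_mult: "x \<in> K \<Longrightarrow> y \<in> K \<Longrightarrow> x ** y \<in> K"
    and A_sub: "a \<in> A \<Longrightarrow> a \<in> K"
    and A_one: "mat 1 \<in> A"
    and A_mult: "a \<in> A \<Longrightarrow> b \<in> A \<Longrightarrow> a ** b \<in> A"
    and A_dagger: "a \<in> A \<Longrightarrow> dagger a \<in> A"
    and A_normal: "x \<in> K \<Longrightarrow> a \<in> A \<Longrightarrow> \<exists>a'\<in>A. x ** a = a' ** x"
begin

lemma K_one: "mat 1 \<in> K"
  using A_one A_sub by blast

lemma eqv_refl: "eqv A x x"
  unfolding eqv_def using A_one by (metis matrix_mul_lid)

lemma eqv_sym: assumes "eqv A x y" shows "eqv A y x"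
proof -
  obtain a where a: "a \<in> A" "x = a ** y" using assms by (auto simp: eqv_def)
  then have "y = dagger a ** x"
    using K_unitary[OF A_sub] by (simp add: unitary_cancel)
  with a A_dagger show ?thesis by (auto simp: eqv_def)
qed

lemma eqv_trans [trans]: "eqv A x y \<Longrightarrow> eqv A y z \<Longrightarrow> eqv A x z"
  unfolding eqv_def by (metis A_mult matrix_mul_assoc)

lemma eqv_mult:
  assumes "eqv A x y" "eqv A x' y'" "y \<in> K"
  shows "eqv A (x ** x') (y ** y')"
proof -
  obtain a b where a: "a \<in> A" "x = a ** y" "b \<in> A" "x' = b ** y'"
    using assms by (auto simp: eqv_def)
  obtain c where c: "c \<in> A" "y ** b = c ** y"
    using A_normal assms(3) a(3) by blast
  have "x ** x' = (a ** c) ** (y ** y')"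
    by (metis a(2,4) c(2) matrix_mul_assoc)
  then show ?thesis unfolding eqv_def using A_mult[OF a(1) c(1)] by blast
qed

lemma op_prod_K: "set xs \<subseteq> K \<Longrightarrow> op_prod xs \<in> K"
  by (induction xs) (auto simp: K_one K_mult)

lemma op_prod_eqv:
  "(\<And>i. i \<in> set xs \<Longrightarrow> eqv A (f i) (g i) \<and> g i \<in> K) \<Longrightarrow>
    eqv A (op_prod (map f xs)) (op_prod (map g xs))"
  by (induction xs) (auto simp: eqv_refl intro!: eqv_mult)

lemma op_prod_swap:
  "set xs \<subseteq> K \<Longrightarrow> y \<in> K \<Longrightarrow> (\<And>x. x \<in> set xs \<Longrightarrow> eqv A (x ** y) (y ** x)) \<Longrightarrow>
    eqv A (op_prod xs ** y) (y ** op_prod xs)"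
proof (induction xs)
  case Nil
  then show ?case by (simp add: eqv_refl)
next
  case (Cons x xs)
  have "eqv A (x ** (op_prod xs ** y)) (x ** (y ** op_prod xs))"
    by (rule eqv_mult[OF eqv_refl]) (use Cons in auto)
  also have "eqv A (x ** (y ** op_prod xs)) (y ** x ** op_prod xs)"
    unfolding matrix_mul_assoc by (rule eqv_mult[OF _ eqv_refl]) (use Cons in \<open>auto intro: K_mult\<close>)
  finally show ?case by (simp add: matrix_mul_assoc)
qed

lemma op_prod_swap_list:
  assumes "set xs \<subseteq> K" "set ys \<subseteq> K" "\<And>x y. x \<in> set xs \<Longrightarrow> y \<in> set ys \<Longrightarrow> eqv A (x ** y) (y ** x)"
  shows "eqv A (op_prod xs ** op_prod ys) (op_prod ys ** op_prod xs)"
  using assms by (intro op_prod_swap op_prod_K eqv_sym[OF op_prod_swap]) (auto intro: eqv_sym)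

lemma op_prod_mult:
  "(\<And>i. i \<in> set xs \<Longrightarrow> f i \<in> K \<and> g i \<in> K) \<Longrightarrow>
   (\<And>i j. i \<in> set xs \<Longrightarrow> j \<in> set xs \<Longrightarrow> eqv A (f i ** g j) (g j ** f i)) \<Longrightarrow>
   eqv A (op_prod (map f xs) ** op_prod (map g xs)) (op_prod (map (\<lambda>i. f i ** g i) xs))"
proof (induction xs)
  case Nil
  then show ?case by (simp add: eqv_refl)
next
  case (Cons i xs)
  let ?f = "op_prod (map f xs)" and ?g = "op_prod (map g xs)"
  have K: "f i \<in> K" "g i \<in> K" "?f \<in> K" using Cons.prems(1) by (auto intro!: op_prod_K)
  \<comment> \<open>To interleave the two products, \<open>g i\<close> has to travel left past all
    the remaining factors \<open>f j\<close>.\<close>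
  have "eqv A (?f ** g i) (g i ** ?f)"
    using Cons.prems by (intro op_prod_swap) auto
  then have "eqv A (f i ** (?f ** g i) ** ?g) (f i ** (g i ** ?f) ** ?g)"
    by (intro eqv_mult[OF eqv_mult[OF eqv_refl] eqv_refl] K_mult K)
  also have "eqv A (f i ** (g i ** ?f) ** ?g) ((f i ** g i) ** op_prod (map (\<lambda>i. f i ** g i) xs))"
    unfolding matrix_mul_assoc[symmetric] unfolding matrix_mul_assoc[of "f i" "g i"]
    using Cons by (intro eqv_mult eqv_refl K_mult K) auto
  finally show ?case by (simp add: matrix_mul_assoc)
qed

text \<open>Interleaving the products pairs equal generators, and a repeated one disappears through
  its square, so exponents add in \<open>bit\<close>. Only pairs that really occur must commute;
  thus a product whose right factor consists of central involutions can be treated with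
  \<open>A = {mat 1}\<close>.\<close>

lemma gen_power_mult:
  assumes K: "set gs \<subseteq> K"
    and comm: "\<And>i j. i < length gs \<Longrightarrow> j < length gs \<Longrightarrow> m i = 1 \<Longrightarrow> m' j = 1 \<Longrightarrow>
      eqv A (gs ! i ** gs ! j) (gs ! j ** gs ! i)"
    and sq: "\<And>i. i < length gs \<Longrightarrow> m i = 1 \<Longrightarrow> m' i = 1 \<Longrightarrow> gs ! i ** gs ! i \<in> A"
  shows "eqv A (gen_power gs m ** gen_power gs m') (gen_power gs (\<lambda>i. m i + m' i))"
proof -
  let ?p = "\<lambda>m i. if m i = (1 :: bit) then gs ! i else mat 1"
  have gK: "gs ! i \<in> K" if "i < length gs" for i using K that by auto
  have "eqv A (gen_power gs m ** gen_power gs m')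
      (op_prod (map (\<lambda>i. ?p m i ** ?p m' i) [0..<length gs]))"
    unfolding gen_power_def by (rule op_prod_mult) (auto simp: gK K_one comm eqv_refl)
  also have "eqv A \<dots> (gen_power gs (\<lambda>i. m i + m' i))"
    unfolding gen_power_def
  proof (rule op_prod_eqv, rule conjI)
    fix i assume "i \<in> set [0..<length gs]"
    then have i: "i < length gs" by simp
    show "eqv A (?p m i ** ?p m' i) (?p (\<lambda>i. m i + m' i) i)"
      using sq[OF i] by (cases "m i"; cases "m' i") (auto simp: eqv_refl, auto simp: eqv_def)
    show "?p (\<lambda>i. m i + m' i) i \<in> K" using gK[OF i] K_one by simp
  qed
  finally show ?thesis .
qed

end

lemma gen_power_zero [simp]: "gen_power gs (\<lambda>_. 0) = mat 1"
proof -
  have "op_prod (map (\<lambda>_. mat 1) xs) = mat 1" for xs :: "nat list" by (induction xs) auto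
  then show ?thesis by (simp add: gen_power_def)
qed

lemma gen_power_cong: "(\<And>i. i < length gs \<Longrightarrow> m i = m' i) \<Longrightarrow> gen_power gs m = gen_power gs m'"
  unfolding gen_power_def by (rule arg_cong[of _ _ op_prod]) auto

text \<open>Translates exponent vectors into lists of distinct indices, the form in which
  \<open>no_product_in\<close> speaks of products.\<close>

lemma gen_power_filter:
  "gen_power gs (\<lambda>i. if i \<in> X then 1 else 0) = op_prod (map ((!) gs) (filter (\<lambda>i. i \<in> X) [0..<length gs]))"
proof -
  have "op_prod (map (\<lambda>j. if (if j \<in> X then 1 else 0) = (1::bit) then gs ! j else mat 1) xs)
    = op_prod (map ((!) gs) (filter (\<lambda>i. i \<in> X) xs))" for xs
    by (induction xs) auto
  then show ?thesis by (simp add: gen_power_def)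
qed

lemma gen_power_single: "i < length gs \<Longrightarrow> gen_power gs (\<lambda>j. if j \<in> {i} then 1 else 0) = gs ! i"
  unfolding gen_power_filter
proof -
  assume "i < length gs"
  then have "filter (\<lambda>j. j \<in> {i}) [0..<length gs] = [i]"
    by (induction gs rule: rev_induct) (auto simp: filter_empty_conv less_Suc_eq)
  then show "op_prod (map ((!) gs) (filter (\<lambda>j. j \<in> {i}) [0..<length gs])) = gs ! i" by simp
qed

lemma unitary_pair: "normal_pair {U :: ('n::finite) oper. is_unitary U} {mat 1}"
  by unfold_locales (auto intro: is_unitary_mult)

lemma eqv_one [simp]: "eqv {mat 1} x y \<longleftrightarrow> x = y"
  by (simp add: eqv_def)

section \<open>Common eigenspaces\<close>

lemma group_unitary: "group unitary_group"
proof (rule groupI)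
  fix x :: "('n::finite) oper" assume "x \<in> carrier unitary_group"
  then show "\<exists>y\<in>carrier unitary_group. y \<otimes>\<^bsub>unitary_group\<^esub> x = \<one>\<^bsub>unitary_group\<^esub>"
    by (intro bexI[of _ "dagger x"]) (auto simp: unitary_group_def is_unitary_def)
qed (auto simp: unitary_group_def is_unitary_mult matrix_mul_assoc)

lemma unitary_group_simps [simp]:
  "carrier unitary_group = {U. is_unitary U}"
  "x \<otimes>\<^bsub>unitary_group\<^esub> y = x ** y" "\<one>\<^bsub>unitary_group\<^esub> = mat 1"
  by (simp_all add: unitary_group_def)

lemma inv_unitary_group: "is_unitary x \<Longrightarrow> inv\<^bsub>unitary_group\<^esub> x = dagger x"
  by (rule group.inv_equality[OF group_unitary]) (auto simp: unitary_cancel)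

text \<open>Inverses in the unitary group are adjoints, and \<open>generate\<close> introduces them
  for generators only.\<close>

lemma generate_induct_unitary:
  assumes "x \<in> generate unitary_group S" "\<And>s. s \<in> S \<Longrightarrow> is_unitary s"
    and one: "P (mat 1)" and gen: "\<And>s. s \<in> S \<Longrightarrow> P s"
    and mult: "\<And>x y. is_unitary x \<Longrightarrow> is_unitary y \<Longrightarrow> P x \<Longrightarrow> P y \<Longrightarrow> P (x ** y)"
    and dag: "\<And>s. s \<in> S \<Longrightarrow> P s \<Longrightarrow> P (dagger s)"
  shows "P x"
proof -
  have "is_unitary x \<and> P x"
    using assms(1)
  proof (induction rule: generate.induct)
    case one then show ?case using assms by simp
  next
    case (incl h) then show ?case using assms by simp
  next
    case (inv h) then show ?case using assms by (simp add: inv_unitary_group)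
  next
    case (eng h1 h2) then show ?case using mult by (simp add: is_unitary_mult)
  qed
  then show ?thesis ..
qed

lemma dagger_fix: "is_unitary U \<Longrightarrow> U *v \<phi> = \<phi> \<Longrightarrow> dagger U *v \<phi> = \<phi>"
  by (metis matrix_vector_mul_assoc matrix_vector_mul_lid unitary_cancel(2))

lemma mult_fix: "A *v \<phi> = \<phi> \<Longrightarrow> B *v \<phi> = \<phi> \<Longrightarrow> (A ** B) *v \<phi> = \<phi>"
  by (metis matrix_vector_mul_assoc)

lemma common_eigenspace_generate:
  assumes "\<And>s. s \<in> S \<Longrightarrow> is_unitary s"
  shows "common_eigenspace (generate unitary_group S) = common_eigenspace S"
proof (intro subset_antisym subsetI)
  fix \<phi> assume "\<phi> \<in> common_eigenspace (generate unitary_group S)"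
  then show "\<phi> \<in> common_eigenspace S" by (auto simp: common_eigenspace_def intro: generate.incl)
next
  fix \<phi> assume \<phi>: "\<phi> \<in> common_eigenspace S"
  have "g *v \<phi> = \<phi>" if "g \<in> generate unitary_group S" for g
    using that assms
    by (rule generate_induct_unitary)
      (use \<phi> assms in \<open>auto simp: common_eigenspace_def mult_fix dagger_fix\<close>)
  then show "\<phi> \<in> common_eigenspace (generate unitary_group S)" by (simp add: common_eigenspace_def)
qed

lemma mem_span_singleton: "\<phi> \<in> vec.span {\<psi>} \<longleftrightarrow> (\<exists>k. \<phi> = k *s \<psi>)"
  by (auto simp: vec.span_singleton)

lemma matrix_sum_mult_vec: "sum f S *v x = (\<Sum>t\<in>S. f t *v x)"
  by (induction S rule: infinite_finite_induct) (simp_all add: matrix_vector_mult_add_rdistrib)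

lemma matrix_vector_mult_sum_right: "A *v (\<Sum>i\<in>I. f i) = (\<Sum>i\<in>I. A *v (f i :: ('n::finite) state))"
  by (induction I rule: infinite_finite_induct) (simp_all add: matrix_vector_right_distrib)

lemma trace_sum: "trace (sum f S) = (\<Sum>t\<in>S. trace (f t :: ('n::finite) oper))"
  by (simp add: trace_def, rule sum.swap)

text \<open>The sum over the group is its order times the projector onto the common eigenspace, which
  has trace one.\<close>

lemma card_traceless_stabilizer:
  fixes S :: "('n::finite) oper set"
  assumes fin: "finite S" and one: "mat 1 \<in> S"
    and mult: "\<And>s t. s \<in> S \<Longrightarrow> t \<in> S \<Longrightarrow> s ** t \<in> S"
    and unit: "\<And>s. s \<in> S \<Longrightarrow> is_unitary s"
    and traceless: "\<And>s. s \<in> S \<Longrightarrow> s \<noteq> mat 1 \<Longrightarrow> trace s = 0"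
    and stab: "uniquely_stabilizes S \<psi>"
  shows "card S = 2 ^ CARD('n)"
proof -
  define Z where "Z = (\<Sum>t\<in>S. t)"
  have inva: "s *v (Z *v x) = Z *v x" if s: "s \<in> S" for s x
  proof -
    \<comment> \<open>Left multiplication by \<open>s\<close> permutes \<open>S\<close>, so
      \<open>s ** Z = Z\<close> and the range of \<open>Z\<close> consists of stabilized
      vectors.\<close>
    have inj: "inj_on ((**) s) S"
      using unitary_eq_cancel(1)[OF unit[OF s]] by (auto simp: inj_on_def)
    have im: "(**) s ` S = S"
      using endo_inj_surj[OF fin _ inj] mult[OF s] by blast
    have "s *v (Z *v x) = (\<Sum>t\<in>S. (s ** t) *v x)"
      by (simp add: Z_def matrix_sum_mult_vec matrix_vector_mul_assoc matrix_vector_mult_sum_right)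
    also have "\<dots> = (\<Sum>t\<in>(**) s ` S. t *v x)"
      by (simp add: sum.reindex[OF inj])
    finally show ?thesis by (simp add: im Z_def matrix_sum_mult_vec)
  qed
  have "\<exists>k. Z *v x = k *s \<psi>" for x
  proof -
    have "Z *v x \<in> common_eigenspace S" by (simp add: common_eigenspace_def inva)
    then show ?thesis using stab by (simp add: uniquely_stabilizes_def mem_span_singleton)
  qed
  then obtain k where k: "\<And>x. Z *v x = k x *s \<psi>" by metis
  \<comment> \<open>Every column of \<open>Z\<close> is a multiple of \<open>\<psi>\<close>. A
    matrix of this form sends \<open>\<psi>\<close> to \<open>trace Z\<close> times itself, whereas
    counting the stabilizing summands gives the factor \<open>card S\<close>.\<close>
  have ent: "Z $ r $ c = k (axis c 1) * \<psi> $ r" for r c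
  proof -
    have "(Z *v axis c 1) $ r = Z $ r $ c"
      by (simp add: matrix_vector_mult_def axis_def if_distrib[of "\<lambda>y. _ * y"] cong: if_cong)
    then show ?thesis by (simp add: k)
  qed
  have stable: "t *v \<psi> = \<psi>" if "t \<in> S" for t
  proof -
    have "\<psi> \<in> vec.span {\<psi>}" by (simp add: vec.span_base)
    then show ?thesis using stab that by (auto simp: uniquely_stabilizes_def common_eigenspace_def)
  qed
  have "(Z *v \<psi>) $ i = of_nat (card S) * \<psi> $ i" for i
    unfolding Z_def matrix_sum_mult_vec sum_component by (simp add: stable)
  then have "Z *v \<psi> = of_nat (card S) *s \<psi>"
    by (simp add: vec_eq_iff)
  moreover have "Z *v \<psi> = trace Z *s \<psi>"
    by (simp add: vec_eq_iff matrix_vector_mult_def ent trace_def sum_distrib_left sum_distrib_right mult_ac)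
  moreover have "\<psi> \<noteq> 0" using stab by (simp add: uniquely_stabilizes_def)
  ultimately have "trace Z = of_nat (card S)"
    by (metis vec.scale_right_imp_eq vector_mul_rcancel)
  \<comment> \<open>Only the identity contributes, and its trace is the number of computational
    basis states.\<close>
  moreover have "trace Z = (\<Sum>t\<in>S. if t = mat 1 then trace (mat 1 :: 'n oper) else 0)"
    unfolding Z_def trace_sum by (rule sum.cong) (auto simp: traceless)
  ultimately have "(of_nat (card S) :: complex) = of_nat CARD('n \<Rightarrow> bool)"
    using fin one by (simp add: trace_I)
  then have "card S = CARD('n \<Rightarrow> bool)" using of_nat_eq_iff by blast
  then show ?thesis by (simp add: card_fun)
qed

text \<open>Conjugation by \<open>P\<close> preserves the trace and sends \<open>A\<close> to its
  negative.\<close>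

lemma trace_anticommute:
  fixes A :: "('n::finite) oper"
  assumes "is_unitary P" "P ** A = smul (- 1) (A ** P)"
  shows "trace A = 0"
proof -
  have "trace A = trace (dagger P ** (P ** A))" by (simp add: unitary_cancel[OF assms(1)])
  also have "\<dots> = trace (smul (- 1) (dagger P ** (A ** P)))" by (simp add: assms(2))
  also have "\<dots> = - trace (dagger P ** (A ** P))"
    by (simp add: trace_def smul_nth sum_negf)
  also have "trace (dagger P ** (A ** P)) = trace ((A ** P) ** dagger P)" by (rule trace_mul_sym)
  also have "\<dots> = trace A" by (simp add: unitary_cancel[OF assms(1)])
  finally show ?thesis by simp
qed

text \<open>Applying both sides to the common fixed vector gives
  \<open>\<psi> = s *s \<psi>\<close>, which excludes \<open>-1\<close>.\<close>

lemma sign_commute_fix: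
  assumes "A ** B = smul s (B ** A)" "s \<in> signs" "A *v \<psi> = \<psi>" "B *v \<psi> = \<psi>" "\<psi> \<noteq> 0"
  shows "A ** B = B ** A"
proof -
  have "\<psi> = s *s \<psi>" 
    by (metis assms(1,3,4) mult_fix smul_vec)
  then have "s = 1"
    using assms(2,5) by (auto simp: signs_def vec_eq_iff)
  with assms(1) show ?thesis by simp
qed

definition sign_commute :: "('n::finite) oper \<Rightarrow> 'n oper \<Rightarrow> bool"
  where "sign_commute A B \<longleftrightarrow> (\<exists>s\<in>signs. A ** B = smul s (B ** A))"

lemma sign_commute_sym: "sign_commute A B \<Longrightarrow> sign_commute B A"
proof -
  assume "sign_commute A B"
  then obtain s where s: "s \<in> signs" "A ** B = smul s (B ** A)" by (auto simp: sign_commute_def)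
  then have "B ** A = smul s (A ** B)" by simp
  with s(1) show ?thesis by (auto simp: sign_commute_def)
qed

lemma sign_commute_if_commute: "A ** B = B ** A \<Longrightarrow> sign_commute A B"
  unfolding sign_commute_def by (rule bexI[of _ 1]) auto

lemma sign_commute_mult:
  assumes "sign_commute A C" "sign_commute B C"
  shows "sign_commute (A ** B) C"
proof -
  obtain s t where s: "s \<in> signs" "A ** C = smul s (C ** A)" and t: "t \<in> signs" "B ** C = smul t (C ** B)"
    using assms by (auto simp: sign_commute_def)
  have "A ** B ** C = A ** (B ** C)" by (simp add: matrix_mul_assoc)
  also have "\<dots> = smul t (A ** C ** B)" by (simp add: t matrix_mul_assoc)
  also have "\<dots> = smul (s * t) (C ** (A ** B))" by (simp add: s matrix_mul_assoc mult.commute)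
  finally show ?thesis using s(1) t(1) by (auto simp: sign_commute_def intro: signs_mult)
qed

lemma sign_commute_smul: "sign_commute A B \<Longrightarrow> sign_commute (smul k A) B"
  by (auto simp: sign_commute_def mult.commute)

lemma sign_commute_smul2: "sign_commute A B \<Longrightarrow> sign_commute A (smul k B)"
  by (auto simp: sign_commute_def mult.commute)

lemma pauli_group_sign_commute: "A \<in> pauli_group \<Longrightarrow> B \<in> pauli_group \<Longrightarrow> sign_commute A B"
  by (simp add: pauli_group_commute sign_commute_def)

text \<open>The two equal signs cancel in the quotient. This is how operators with the same action
  by conjugation are compared before scalars are detected.\<close>

lemma quotient_commutes:
  assumes "is_unitary Y" "X ** C = smul s (C ** X)" "Y ** C = smul s (C ** Y)" "s \<in> signs"
  shows "(X ** dagger Y) ** C = C ** (X ** dagger Y)"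
proof -
  have "dagger Y ** C = smul s (C ** dagger Y)"
  proof -
    have "dagger Y ** (Y ** C) ** dagger Y = smul s (dagger Y ** C ** Y ** dagger Y)"
      by (simp add: assms(3) matrix_mul_assoc)
    then have "C ** dagger Y = smul s (dagger Y ** C)"
      by (simp add: unitary_cancel[OF assms(1)])
    then show ?thesis using assms(4) by simp
  qed
  then have "(X ** dagger Y) ** C = smul s (X ** C ** dagger Y)"
    by (simp add: matrix_mul_assoc[symmetric])
  then show ?thesis using assms(4) by (simp add: assms(2) matrix_mul_assoc)
qed

section \<open>Axis Paulis\<close>

lemma axis_pauli_0 [simp]: "axis_pauli Q 0 = mat 1"
  by (simp add: axis_pauli_def pauli_op_PI)

text \<open>On each qubit both factors are the identity or the same matrix, so no phase
  arises.\<close>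

lemma axis_pauli_mult: "axis_pauli Q c ** axis_pauli Q c' = axis_pauli Q (c + c')"
proof -
  have 1: "pauli_phase (if x = 1 then p else PI) (if y = 1 then p else PI) = 1"
    "pauli_mult (if x = 1 then p else PI) (if y = 1 then p else PI) = (if x + y = 1 then p else PI)"
    for x y :: bit and p
    by (cases x; cases y; cases p; simp)+
  show ?thesis by (simp add: axis_pauli_def pauli_op_mult 1 del: add_bit_eq_xor)
qed

lemma axis_pauli_commute: "axis_pauli Q c ** axis_pauli Q c' = axis_pauli Q c' ** axis_pauli Q c"
  by (simp add: axis_pauli_mult add.commute)

lemma axis_pauli_simps [simp]:
  "axis_pauli Q c \<in> pauli_group" "is_unitary (axis_pauli Q c)" "dagger (axis_pauli Q c) = axis_pauli Q c"
  "axis_pauli Q c ** axis_pauli Q c = mat 1"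
  by (simp_all add: axis_pauli_def)

lemma axis_pauli_axis: "axis_pauli Q (axis q 1) = pauli_on q (Q q)"
  unfolding axis_pauli_def pauli_on_def
  by (rule arg_cong[of _ _ pauli_op]) (auto simp: axis_def fun_eq_iff)

text \<open>Some Pauli anticommuting with the given nontrivial one; its sign with an axis Pauli
  reads off one bit of the support.\<close>

fun other_pauli :: "pauli \<Rightarrow> pauli" where
  "other_pauli PX = PZ" | "other_pauli _ = PX"

lemma other_pauli: "x \<noteq> PI \<Longrightarrow> other_pauli x \<noteq> x" "other_pauli x \<noteq> PI"
  by (cases x; simp)+

lemma axis_pauli_other_commute:
  assumes "Q q \<noteq> PI"
  shows "axis_pauli Q c ** pauli_on q (other_pauli (Q q)) =
    smul (if c $ q = 1 then - 1 else 1) (pauli_on q (other_pauli (Q q)) ** axis_pauli Q c)"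
proof -
  have "(\<Prod>q'\<in>UNIV. pauli_sign (if c $ q' = 1 then Q q' else PI) (((\<lambda>_. PI)(q := other_pauli (Q q))) q'))
    = (\<Prod>q'\<in>UNIV. if q' = q then (if c $ q = 1 then - 1 else 1) else 1)"
    using other_pauli(1)[OF assms] other_pauli(2)[of "Q q"] assms by (intro prod.cong) (auto simp: pauli_sign_def)
  also have "\<dots> = (if c $ q = 1 then - 1 else 1)" by simp
  finally show ?thesis unfolding axis_pauli_def pauli_on_def by (subst pauli_op_commute) simp
qed

text \<open>The operator differs from a suitable axis Pauli by an operator that commutes with all
  single-qubit Paulis.\<close>

lemma axis_pauli_if_sign_commutes:
  fixes W :: "('n::finite) oper"
  assumes Q: "\<And>q. Q q \<noteq> PI" and W: "is_unitary W"
    and axc: "\<And>c. W ** axis_pauli Q c = axis_pauli Q c ** W"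
    and sgl: "\<And>P. P \<in> single_paulis \<Longrightarrow> \<exists>\<mu>. W ** P = smul \<mu> (P ** W)"
  shows "\<exists>k c. norm k = 1 \<and> W = smul k (axis_pauli Q c)"
proof -
  define R where "R q = pauli_on q (other_pauli (Q q))" for q
  have R: "R q \<in> single_paulis" for q using other_pauli(2) by (auto simp: R_def single_paulis_def)
  have sc: "\<exists>s\<in>signs. W ** R q = smul s (R q ** W)" for q
  proof -
    note e = single_pauli_simps[OF R[of q]]
    \<comment> \<open>Since \<open>R q\<close> squares to the identity, moving \<open>W\<close> past
      it twice shows that \<open>\<mu>\<close> squares to one.\<close>
    obtain \<mu> where \<mu>: "W ** R q = smul \<mu> (R q ** W)" using sgl[OF R] by blast
    have "W = W ** R q ** R q" by (simp add: matrix_mul_assoc[symmetric] e)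
    also have "\<dots> = smul (\<mu> * \<mu>) W"
      by (simp add: \<mu>) (simp add: matrix_mul_assoc[symmetric] \<mu>, simp add: matrix_mul_assoc e)
    finally have "\<mu> * \<mu> = 1" using smul_right_cancel[of W 1] unitary_neq_0[OF W] by (metis smul_1)
    then show ?thesis using \<mu> by (auto simp: signs_def square_eq_1_iff)
  qed
  then obtain s where s: "\<And>q. s q \<in> signs" "\<And>q. W ** R q = smul (s q) (R q ** W)" by metis
  \<comment> \<open>The bits mark the qubits with sign \<open>-1\<close>, so that the axis Pauli of
    \<open>c\<close> has the same signs as \<open>W\<close> with every \<open>R q\<close>.\<close>
  define c :: "bit ^ 'n" where "c = (\<chi> q. if s q = 1 then 0 else 1)"
  let ?X = "W ** dagger (axis_pauli Q c)"
  have "axis_pauli Q c ** R q = smul (s q) (R q ** axis_pauli Q c)" for q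
    using axis_pauli_other_commute[of Q q c] Q s(1)[of q] by (auto simp: R_def c_def signs_def)
  then have 1: "?X ** R q = R q ** ?X" for q
    by (intro quotient_commutes) (use s in auto)
  have 2: "?X ** pauli_on q (Q q) = pauli_on q (Q q) ** ?X" for q
    unfolding axis_pauli_axis[symmetric]
    by (rule quotient_commutes[of _ _ _ 1]) (auto simp: axc axis_pauli_commute)
  have "\<exists>k. ?X = smul k (mat 1)"
    by (rule scalar_if_commutes_single[of Q "\<lambda>q. other_pauli (Q q)"])
      (use Q other_pauli 1 2 in \<open>auto simp: R_def\<close>, metis other_pauli(1))
  then obtain k where k: "?X = smul k (mat 1)" by blast
  have eq: "W = smul k (axis_pauli Q c)"
  proof -
    have "W = ?X ** axis_pauli Q c" by (simp add: matrix_mul_assoc[symmetric])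
    then show ?thesis by (simp only: k smul_mult_left matrix_mul_lid)
  qed
  have "smul (k * cnj k) (mat 1) = (mat 1 :: 'n oper)"
    using W unfolding eq is_unitary_def by simp
  then have "smul (k * cnj k) (mat 1) = smul 1 (mat 1 :: 'n oper)" by simp
  then have "k * cnj k = 1" by (simp only: smul_right_cancel[OF mat_1_neq_0])
  then have "(norm k)\<^sup>2 = 1"
    by (metis complex_norm_square of_real_1 of_real_eq_iff of_real_power)
  then have "norm k = 1" by (simp add: power2_eq_1_iff) (smt (verit) norm_ge_zero)
  with eq show ?thesis by blast
qed

section \<open>Generators with exact primary supports\<close>

text \<open>Fixes the witnesses \<open>B\<close>, \<open>J\<close>, \<open>Q\<close> and
  \<open>v\<close> of \<open>primary_support_exact\<close> together with the initial state; none of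
  these four appears in the final statement.\<close>

locale exact_generators =
  fixes F :: "('n::finite) oper list list" and B J Q v and \<psi>0 :: "'n state"
  assumes init: "init_paulis F B"
    and primary: "primary_indices F B J"
    and axes: "dressing_axes F Q"
    and support: "\<And>j. j < length F \<Longrightarrow> anticommutation_support Q (generators F ! j) (v j)"
    and exact: "\<And>m :: nat \<Rightarrow> bit.
      (\<Sum>j<length F. m j *s v j) = 0 \<longleftrightarrow> zero_primary Q (gen_power (generators F) m)"
    and len: "length F = CARD('n)"
    and factors: "\<And>Us U. Us \<in> set F \<Longrightarrow> U \<in> set Us \<Longrightarrow> pauli_factor U \<or> clifford_factor U"
    and herm: "\<And>Us. Us \<in> set F \<Longrightarrow> is_hermitian (op_prod Us)"
    and stab0: "uniquely_stabilizes (set (generators F)) \<psi>0"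
    and norm0: "norm \<psi>0 = 1"
begin

abbreviation G where "G \<equiv> generators F"
abbreviation "ax \<equiv> axis_pauli Q"

lemma Q_neq_PI: "Q q \<noteq> PI"
  using axes by (simp add: dressing_axes_def)

lemma B_pauli: "b \<in> B \<Longrightarrow> b \<in> pauli_group"
  using init by (auto simp: init_paulis_def)

text \<open>Arbitrary phases of modulus one are allowed because the commutation argument identifies
  an operator only up to a scalar. Commutation with \<open>B\<close> is built in so that it passes
  to all of \<open>trackable\<close>.\<close>

definition axis_group :: "'n oper set"
  where "axis_group = {smul k (ax c) | k c. norm k = 1} \<inter> {a. \<forall>b\<in>B. a ** b = b ** a}"

text \<open>A common home, closed under products, for data errors, factors and generators. Testing
  single-qubit Paulis is enough, since an operator commuting with all of them is a scalar.\<close>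

definition axis_preserving :: "'n oper set"
  where "axis_preserving = {U. is_unitary U \<and> (\<forall>c. sign_commute U (ax c)) \<and> (\<forall>b\<in>B. sign_commute U b) \<and>
    (\<forall>P\<in>single_paulis. \<exists>a\<in>axis_group. U ** P = a ** P ** U)}"

lemma axis_groupE:
  assumes "a \<in> axis_group"
  obtains k c where "a = smul k (ax c)" "norm k = 1" "\<forall>b\<in>B. a ** b = b ** a"
  using assms unfolding axis_group_def by blast

lemma axis_group_unitary: "a \<in> axis_group \<Longrightarrow> is_unitary a"
  by (erule axis_groupE) (simp add: is_unitary_smul)

lemma axis_group_smul: assumes "a \<in> axis_group" "norm k = 1" shows "smul k a \<in> axis_group"
proof -
  obtain l c where a: "a = smul l (ax c)" "norm l = 1" "\<forall>b\<in>B. a ** b = b ** a"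
    using assms(1) by (rule axis_groupE)
  have "smul k a = smul (k * l) (ax c)" "norm (k * l) = 1" by (simp_all add: a assms(2) norm_mult)
  moreover have "\<forall>b\<in>B. smul k a ** b = b ** smul k a" using a(3) by simp
  ultimately show ?thesis unfolding axis_group_def by blast
qed

lemma axis_group_one: "mat 1 \<in> axis_group"
proof -
  have "mat 1 \<in> {smul k (ax c) | k c. norm k = 1}"
    by (rule CollectI, rule exI[of _ 1], rule exI[of _ 0]) simp
  then show ?thesis by (simp add: axis_group_def)
qed

lemma axis_group_mult: assumes "a \<in> axis_group" "a' \<in> axis_group" shows "a ** a' \<in> axis_group"
proof -
  obtain k c where a: "a = smul k (ax c)" "norm k = 1" "\<forall>b\<in>B. a ** b = b ** a"
    using assms(1) by (rule axis_groupE)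
  obtain k' c' where a': "a' = smul k' (ax c')" "norm k' = 1" "\<forall>b\<in>B. a' ** b = b ** a'"
    using assms(2) by (rule axis_groupE)
  have "a ** a' = smul (k * k') (ax (c + c'))"
    by (simp add: a(1) a'(1) axis_pauli_mult mult.commute)
  moreover have "norm (k * k') = 1" by (simp add: a a' norm_mult)
  moreover have "\<forall>b\<in>B. a ** a' ** b = b ** (a ** a')"
    by (metis a(3) a'(3) matrix_mul_assoc)
  ultimately show ?thesis unfolding axis_group_def by blast
qed

lemma axis_group_commute: "a \<in> axis_group \<Longrightarrow> a' \<in> axis_group \<Longrightarrow> a ** a' = a' ** a"
  by (elim axis_groupE) (simp add: axis_pauli_commute[of Q] mult.commute)

lemma axis_group_ax: "a \<in> axis_group \<Longrightarrow> a ** ax c = ax c ** a"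
  by (elim axis_groupE) (simp add: axis_pauli_commute[of Q])

lemma axis_group_dagger: assumes "a \<in> axis_group" shows "dagger a \<in> axis_group"
proof -
  obtain k c where a: "a = smul k (ax c)" "norm k = 1" using assms by (rule axis_groupE)
  have "dagger a = smul (cnj k * cnj k) a" by (simp add: a mult.assoc unit_cnj)
  with axis_group_smul[OF assms, of "cnj k * cnj k"] show ?thesis by (simp add: a norm_mult)
qed

lemma axis_preservingD:
  assumes "U \<in> axis_preserving"
  shows "is_unitary U" "sign_commute U (ax c)" "b \<in> B \<Longrightarrow> sign_commute U b"
    "P \<in> single_paulis \<Longrightarrow> \<exists>a\<in>axis_group. U ** P = a ** P ** U"
  using assms by (auto simp: axis_preserving_def)

lemma axis_preserving_axis_group:
  assumes "U \<in> axis_preserving" "a \<in> axis_group"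
  shows "sign_commute U a"
  using assms by (auto elim!: axis_groupE intro: sign_commute_smul2 axis_preservingD)

lemma axis_preserving_smul:
  assumes "U \<in> axis_preserving" "norm k = 1" shows "smul k U \<in> axis_preserving"
proof -
  have "\<exists>a\<in>axis_group. smul k U ** P = a ** P ** smul k U" if "P \<in> single_paulis" for P
    using axis_preservingD(4)[OF assms(1) that] by auto
  then show ?thesis
    using assms axis_preservingD[OF assms(1)] unfolding axis_preserving_def
    by (auto intro: is_unitary_smul sign_commute_smul)
qed

lemma axis_preserving_mult:
  assumes U: "U \<in> axis_preserving" and V: "V \<in> axis_preserving" shows "U ** V \<in> axis_preserving"
proof -
  have "\<exists>a\<in>axis_group. U ** V ** P = a ** P ** (U ** V)" if P: "P \<in> single_paulis" for P
  proof -
    obtain a where a: "a \<in> axis_group" "U ** P = a ** P ** U" using axis_preservingD(4)[OF U P] by blast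
    obtain b where b: "b \<in> axis_group" "V ** P = b ** P ** V" using axis_preservingD(4)[OF V P] by blast
    obtain s where s: "s \<in> signs" "U ** b = smul s (b ** U)"
      using axis_preserving_axis_group[OF U b(1)] by (auto simp: sign_commute_def)
    have "U ** V ** P = U ** (V ** P)" by (simp add: matrix_mul_assoc)
    also have "\<dots> = (U ** b) ** P ** V" by (simp add: b matrix_mul_assoc)
    also have "\<dots> = smul s (b ** (U ** P) ** V)" by (simp add: s matrix_mul_assoc)
    also have "\<dots> = smul s (b ** a) ** P ** (U ** V)" by (simp add: a matrix_mul_assoc)
    finally show ?thesis using axis_group_smul[OF axis_group_mult[OF b(1) a(1)]] s(1) by fastforce
  qed
  then show ?thesis
    using axis_preservingD[OF U] axis_preservingD[OF V] unfolding axis_preserving_def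
    by (auto intro: is_unitary_mult sign_commute_mult)
qed

lemma axis_group_preserving:
  assumes "a \<in> axis_group" shows "a \<in> axis_preserving"
proof -
  obtain k c where a: "a = smul k (ax c)" "norm k = 1" "\<forall>b\<in>B. a ** b = b ** a" using assms by (rule axis_groupE)
  have "\<exists>a'\<in>axis_group. a ** P = a' ** P ** a" if P: "P \<in> single_paulis" for P
  proof -
    obtain s where s: "s \<in> signs" "ax c ** P = smul s (P ** ax c)"
      using pauli_group_commute[OF axis_pauli_simps(1) single_pauli_simps(1)[OF P]] by blast
    show ?thesis
      by (rule bexI[of _ "smul s (mat 1)"])
        (use s axis_group_smul[OF axis_group_one] in \<open>auto simp: a mult.commute\<close>)
  qed
  then show ?thesis unfolding axis_preserving_def
    using axis_group_unitary[OF assms] axis_group_ax[OF assms] a(3)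
    by (auto intro: sign_commute_if_commute)
qed

sublocale N: normal_pair axis_preserving axis_group
proof unfold_locales
  fix U a assume "U \<in> axis_preserving" "a \<in> axis_group"
  then obtain s where "s \<in> signs" "U ** a = smul s (a ** U)"
    using axis_preserving_axis_group by (auto simp: sign_commute_def)
  then show "\<exists>a'\<in>axis_group. U ** a = a' ** U"
    using axis_group_smul[OF \<open>a \<in> axis_group\<close>, of s] by (intro bexI[of _ "smul s a"]) auto
qed (auto intro: axis_preservingD axis_preserving_mult axis_group_preserving axis_group_one axis_group_mult
    axis_group_dagger)

lemma in_axis_group:
  assumes "is_unitary W" "\<And>c. W ** ax c = ax c ** W" "\<And>b. b \<in> B \<Longrightarrow> W ** b = b ** W"
    and "\<And>P. P \<in> single_paulis \<Longrightarrow> \<exists>\<mu>. W ** P = smul \<mu> (P ** W)"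
  shows "W \<in> axis_group"
  using axis_pauli_if_sign_commutes[of Q W] Q_neq_PI assms by (auto simp: axis_group_def)

text \<open>The sign of a product is the product of the signs, whatever the order of the
  factors.\<close>

lemma same_signs:
  assumes "sign_commute U C" "sign_commute V C"
  shows "\<exists>s\<in>signs. U ** V ** C = smul s (C ** (U ** V)) \<and> V ** U ** C = smul s (C ** (V ** U))"
proof -
  obtain s t where s: "s \<in> signs" "U ** C = smul s (C ** U)" and t: "t \<in> signs" "V ** C = smul t (C ** V)"
    using assms by (auto simp: sign_commute_def)
  have "U ** V ** C = U ** (V ** C)" "V ** U ** C = V ** (U ** C)"
    by (simp_all add: matrix_mul_assoc)
  then have "U ** V ** C = smul t (U ** C ** V)" "V ** U ** C = smul s (V ** C ** U)"
    by (simp_all add: s t matrix_mul_assoc)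
  then have "U ** V ** C = smul (s * t) (C ** (U ** V))" "V ** U ** C = smul (s * t) (C ** (V ** U))"
    by (simp_all add: s t matrix_mul_assoc mult.commute)
  then show ?thesis using s(1) t(1) signs_mult by blast
qed

text \<open>Both \<open>U V\<close> and \<open>V U\<close> change a single-qubit Pauli by the same axis Pauli up to sign.\<close>

lemma commutator_axis_group:
  assumes U: "U \<in> axis_preserving" and V: "V \<in> axis_preserving"
  shows "eqv axis_group (U ** V) (V ** U)"
proof -
  note u = axis_preservingD[OF U] and v = axis_preservingD[OF V]
  define X Y where XY: "X = U ** V" "Y = V ** U"
  define W where "W = X ** dagger Y"
  have Y: "is_unitary Y" "is_unitary X" unfolding XY by (auto intro: is_unitary_mult u v)
  have comm: "W ** C = C ** W" if "sign_commute U C" "sign_commute V C" for C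
    using same_signs[OF that] quotient_commutes[OF Y(1), of X C] unfolding XY[symmetric] W_def by blast
  have W: "is_unitary W" unfolding W_def by (intro is_unitary_mult[OF Y(2)]) (simp only: is_unitary_dagger Y(1))
  have WX: "X = W ** Y" by (simp only: W_def unitary_cancel(6)[OF Y(1)])
  have "\<exists>\<mu>. W ** P = smul \<mu> (P ** W)" if P: "P \<in> single_paulis" for P
  proof -
    obtain a where a: "a \<in> axis_group" "U ** P = a ** P ** U" using u(4)[OF P] by blast
    obtain b where b: "b \<in> axis_group" "V ** P = b ** P ** V" using v(4)[OF P] by blast
    obtain s where s: "s \<in> signs" "U ** b = smul s (b ** U)"
      using axis_preserving_axis_group[OF U b(1)] by (auto simp: sign_commute_def)
    obtain t where t: "t \<in> signs" "V ** a = smul t (a ** V)"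
      using axis_preserving_axis_group[OF V a(1)] by (auto simp: sign_commute_def)
    let ?c = "a ** b"
    have c: "?c \<in> axis_group" by (rule axis_group_mult[OF a(1) b(1)])
    have "X ** P = U ** (V ** P)" by (simp add: XY matrix_mul_assoc)
    also have "\<dots> = (U ** b) ** P ** V" by (simp add: b matrix_mul_assoc)
    also have "\<dots> = smul s (b ** (U ** P) ** V)" by (simp add: s matrix_mul_assoc)
    also have "\<dots> = smul s (b ** a ** P ** X)" by (simp add: a XY matrix_mul_assoc)
    finally have XP: "X ** P = smul s (?c ** P ** X)" using axis_group_commute[OF a(1) b(1)] by simp
    have "Y ** P = V ** (U ** P)" by (simp add: XY matrix_mul_assoc)
    also have "\<dots> = (V ** a) ** P ** U" by (simp add: a matrix_mul_assoc)
    also have "\<dots> = smul t (a ** (V ** P) ** U)" by (simp add: t matrix_mul_assoc)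
    also have "\<dots> = smul t (a ** b ** P ** Y)" by (simp add: b XY matrix_mul_assoc)
    finally have YP: "Y ** P = smul t (?c ** P ** Y)" .
    \<comment> \<open>Both \<open>U\<close> and \<open>V\<close> commute with \<open>?c\<close> up
      to sign, so their group commutator \<open>W\<close> commutes with it exactly. This lets the
      common factor \<open>?c\<close> be cancelled when the two formulas are compared.\<close>
    have Wc: "W ** ?c = ?c ** W"
      using axis_preserving_axis_group[OF U c] axis_preserving_axis_group[OF V c] comm by blast
    have "smul t (?c ** (W ** P) ** Y) = W ** (smul t (?c ** P ** Y))"
      by (simp only: smul_mult_right matrix_mul_assoc Wc[unfolded matrix_mul_assoc])
    also have "\<dots> = W ** (Y ** P)" by (simp only: YP)
    also have "\<dots> = X ** P" by (simp only: WX matrix_mul_assoc)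
    also have "\<dots> = smul s (?c ** (P ** W) ** Y)"
      unfolding XP by (simp only: WX matrix_mul_assoc smul_mult_left smul_mult_right Wc[unfolded matrix_mul_assoc])
    finally have "smul t (?c ** (W ** P)) = smul s (?c ** (P ** W))"
      by (simp only: smul_mult_left[symmetric] unitary_eq_cancel(2)[OF Y(1)])
    then have "smul t (W ** P) = smul s (P ** W)"
      by (simp only: smul_mult_right[symmetric] unitary_eq_cancel(1)[OF axis_group_unitary[OF c]])
    then have "W ** P = smul (t * s) (P ** W)" using t(1) by (metis sign_self_mult(1) smul_1 smul_smul)
    then show ?thesis by blast
  qed
  then have "W \<in> axis_group" using W comm u v by (intro in_axis_group) auto
  then show ?thesis unfolding eqv_def XY[symmetric] using WX by blast
qed

text \<open>Squaring removes every commutation sign. On a single-qubit Pauli it inserts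
  \<open>a ** a\<close> up to sign, and the square of an axis Pauli is a scalar.\<close>

lemma square_axis_group:
  assumes U: "U \<in> axis_preserving" shows "U ** U \<in> axis_group"
proof (rule in_axis_group)
  note u = axis_preservingD[OF U]
  show "is_unitary (U ** U)" by (intro is_unitary_mult u)
  have sq: "U ** U ** C = C ** (U ** U)" if "sign_commute U C" for C
  proof -
    obtain s where s: "s \<in> signs" "U ** C = smul s (C ** U)" using \<open>sign_commute U C\<close> by (auto simp: sign_commute_def)
    have "U ** U ** C = U ** (U ** C)" by (simp add: matrix_mul_assoc)
    also have "\<dots> = smul s (U ** C ** U)" by (simp add: s matrix_mul_assoc)
    finally have "U ** U ** C = smul s (U ** C ** U)" .
    then show ?thesis using s(1) by (simp add: s(2) matrix_mul_assoc)
  qed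
  show "U ** U ** ax c = ax c ** (U ** U)" "b \<in> B \<Longrightarrow> U ** U ** b = b ** (U ** U)" for b c
    using sq u by blast+
  fix P :: "'n oper" assume P: "P \<in> single_paulis"
  obtain a where a: "a \<in> axis_group" "U ** P = a ** P ** U" using u(4)[OF P] by blast
  obtain s where s: "s \<in> signs" "U ** a = smul s (a ** U)"
    using axis_preserving_axis_group[OF U a(1)] by (auto simp: sign_commute_def)
  obtain k c where k: "a = smul k (ax c)" "norm k = 1" using a(1) by (rule axis_groupE)
  have "U ** U ** P = (U ** a) ** P ** U" by (simp add: matrix_mul_assoc[symmetric] a(2))
  also have "\<dots> = smul s (a ** (U ** P) ** U)" by (simp add: s matrix_mul_assoc)
  also have "\<dots> = smul s ((a ** a) ** P ** (U ** U))" by (simp add: a(2) matrix_mul_assoc)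
  also have "a ** a = smul (k * k) (mat 1)" by (simp add: k)
  finally have "U ** U ** P = smul (s * (k * k)) (P ** (U ** U))" by simp
  then show "\<exists>\<mu>. U ** U ** P = smul \<mu> (P ** (U ** U))" by blast
qed

end

lemma sign_commute_fix':
  "sign_commute A B \<Longrightarrow> A *v \<psi> = \<psi> \<Longrightarrow> B *v \<psi> = \<psi> \<Longrightarrow> \<psi> \<noteq> 0 \<Longrightarrow> A ** B = B ** A"
  unfolding sign_commute_def using sign_commute_fix by blast

context exact_generators
begin

text \<open>\<open>dressing_axes\<close> speaks only about dressings written as Pauli operators,
  hence the second assumption; commutation with \<open>B\<close> comes from
  \<open>init_paulis\<close>.\<close>

lemma dressing_in_axis_group:
  assumes d: "d \<in> possible_dressings F" "d \<in> pauli_group" shows "d \<in> axis_group"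
proof -
  obtain k p where k: "k \<in> phases" "d = smul k (pauli_op p)" using d(2) by (auto simp: pauli_group_iff)
  have "\<forall>q. p q \<noteq> PI \<longrightarrow> p q = Q q"
    using axes d(1) k unfolding dressing_axes_def smul_def by blast
  then have "pauli_op p = ax (\<chi> q. if p q = PI then 0 else 1)"
    unfolding axis_pauli_def by (intro arg_cong[of _ _ pauli_op]) auto
  moreover have "\<forall>b\<in>B. d ** b = b ** d"
    using init d(1) by (auto simp: init_paulis_def)
  ultimately show ?thesis
    using k phases_norm[OF k(1)] unfolding axis_group_def by auto
qed

lemma sign_scalar_axis_group: "s \<in> signs \<Longrightarrow> smul s (mat 1) \<in> axis_group"
  by (simp add: axis_group_smul axis_group_one)

lemma single_preserving:
  assumes P: "P \<in> single_paulis" shows "P \<in> axis_preserving"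
proof -
  note p = single_pauli_simps[OF P]
  have "\<exists>a\<in>axis_group. P ** R = a ** R ** P" if R: "R \<in> single_paulis" for R
  proof -
    obtain s where "s \<in> signs" "P ** R = smul s (R ** P)"
      using pauli_group_commute[OF p(1) single_pauli_simps(1)[OF R]] by blast
    then show ?thesis using sign_scalar_axis_group by (intro bexI[of _ "smul s (mat 1)"]) auto
  qed
  then show ?thesis
    unfolding axis_preserving_def using p B_pauli by (auto intro: pauli_group_sign_commute)
qed

lemma clifford_factor_preserving:
  assumes C: "C \<in> clifford_factors F" shows "C \<in> axis_preserving"
proof -
  have cl: "C \<in> clifford_group" using C by (auto simp: clifford_factors_def clifford_factor_def)
  then have uC: "is_unitary C" by (simp add: clifford_group_def)
  have D: "dressing_of C E \<in> axis_group" if E: "E \<in> single_paulis" for E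
  proof (rule dressing_in_axis_group)
    note e = single_pauli_simps[OF E]
    show "dressing_of C E \<in> possible_dressings F"
      using C E by (auto simp: possible_dressings_def clifford_dressings_def)
    have "C ** E ** dagger C \<in> pauli_group" using cl e(1) by (simp add: clifford_group_def)
    then have "E ** (C ** E ** dagger C) \<in> pauli_group" using e(1) by (rule pauli_group_mult[rotated])
    then show "dressing_of C E \<in> pauli_group"
      by (simp add: dressing_of_def e matrix_mul_assoc)
  qed
  \<comment> \<open>A Pauli commuting with \<open>axis_group\<close> commutes with all dressings of
    \<open>C\<close>; this covers axis Paulis and elements of \<open>B\<close> at once.\<close>
  have sc: "sign_commute C b"
    if "b \<in> pauli_group" "\<And>a. a \<in> axis_group \<Longrightarrow> b ** a = a ** b" for b
    unfolding sign_commute_def using sign_commute_if_commutes_dressings[OF uC that(1)] that(2) D by blast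
  have "\<exists>a\<in>axis_group. C ** P = a ** P ** C" if P: "P \<in> single_paulis" for P
  proof -
    note e = single_pauli_simps[OF P]
    obtain s where s: "s \<in> signs" "P ** dressing_of C P = smul s (dressing_of C P ** P)"
      using axis_preserving_axis_group[OF single_preserving[OF P] D[OF P]] by (auto simp: sign_commute_def)
    \<comment> \<open>Multiplying the dressing by \<open>P\<close> recovers the conjugate
      \<open>C ** P ** dagger C\<close>.\<close>
    have "P ** dressing_of C P ** C = (P ** P) ** (C ** P ** dagger C) ** C"
      by (simp only: dressing_of_def e(2) matrix_mul_assoc)
    also have "\<dots> = C ** P"
      by (simp add: e(3) unitary_cancel[OF uC])
    finally have "C ** P = smul s (dressing_of C P) ** P ** C" by (simp add: s)
    then show ?thesis using axis_group_smul[OF D[OF P], of s] sign_self_mult(3)[OF s(1)] by blast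
  qed
  moreover have "sign_commute C (ax c)" for c by (rule sc) (simp_all add: axis_group_ax)
  moreover have "sign_commute C b" if "b \<in> B" for b
    using that by (intro sc B_pauli) (auto elim!: axis_groupE)
  ultimately show ?thesis unfolding axis_preserving_def using uC by blast
qed

lemma factor_preserving:
  assumes "Us \<in> set F" "U \<in> set Us" shows "U \<in> axis_preserving"
proof (cases "clifford_factor U")
  case True
  then show ?thesis using assms by (intro clifford_factor_preserving) (auto simp: clifford_factors_def)
next
  case False
  then have "pauli_factor U" using factors[OF assms] by blast
  then show ?thesis
    using axis_preserving_smul[OF single_preserving phases_norm] by (auto simp: pauli_factor_def smul_def)
qed

lemma data_errors_preserving:
  assumes "E \<in> data_errors F" shows "E \<in> axis_preserving"
proof -
  obtain Es where Es: "E = op_prod Es" "set Es \<subseteq> single_paulis \<union> clifford_factors F"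
    using assms by (auto simp: data_errors_def)
  then have "set Es \<subseteq> axis_preserving" using single_preserving clifford_factor_preserving by blast
  with Es(1) show ?thesis by (simp add: N.op_prod_K)
qed

lemma length_G [simp]: "length G = length F"
  by (simp add: generators_def)

lemma G_nth: "i < length F \<Longrightarrow> G ! i = op_prod (F ! i)"
  by (simp add: generators_def)

lemma G_preserving: "set G \<subseteq> axis_preserving"
  using factor_preserving by (auto simp: generators_def intro!: N.op_prod_K)

lemma gen_power_preserving: "gen_power G m \<in> axis_preserving"
  unfolding gen_power_def using G_preserving nth_mem[of _ G] by (intro N.op_prod_K) (auto simp: N.K_one)

lemma G_unitary: "g \<in> set G \<Longrightarrow> is_unitary g"
  using G_preserving axis_preservingD(1) by blast

lemma hermitian_unitary_square: "is_unitary A \<Longrightarrow> is_hermitian A \<Longrightarrow> A ** A = mat 1"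
  by (metis is_hermitian_def is_unitary_def)

lemma G_square: "i < length F \<Longrightarrow> G ! i ** G ! i = mat 1"
proof (rule hermitian_unitary_square)
  assume i: "i < length F"
  then show "is_unitary (G ! i)" using nth_mem[of i G] by (intro G_unitary) simp
  show "is_hermitian (G ! i)" using i by (simp add: G_nth herm)
qed

text \<open>A dressing by a data error is a conjugated group commutator, and an ancilla dressing is
  the adjoint of a square; both kinds are already known to be axis Paulis up to a phase.\<close>

lemma factor_dressing_axis_group:
  assumes U: "U \<in> axis_preserving" and d: "d \<in> factor_dressings F U"
  shows "d \<in> axis_group"
proof -
  consider (E) E where "E \<in> data_errors F" "d = dagger E ** U ** E ** dagger U"
    | (A) "d = dagger (U ** U)"
    using d by (auto simp: factor_dressings_def split: if_splits)
  then show ?thesis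
  proof cases
    case E
    have EK: "E \<in> axis_preserving" using E(1) by (rule data_errors_preserving)
    obtain a where a: "a \<in> axis_group" "U ** E = a ** (E ** U)"
      using commutator_axis_group[OF U EK] by (auto simp: eqv_def)
    obtain s where s: "s \<in> signs" "a ** E = smul s (E ** a)"
      using sign_commute_sym[OF axis_preserving_axis_group[OF EK a(1)]] by (auto simp: sign_commute_def)
    have "d = dagger E ** (U ** E) ** dagger U" by (simp add: E(2) matrix_mul_assoc)
    also have "\<dots> = dagger E ** (a ** E)"
      by (simp add: a(2) matrix_mul_assoc unitary_cancel[OF axis_preservingD(1)[OF U]])
    also have "\<dots> = smul s a"
      by (simp add: s(2) unitary_cancel[OF axis_preservingD(1)[OF EK]])
    finally show ?thesis using axis_group_smul[OF a(1)] s(1) by simp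
  next
    case A
    then show ?thesis using axis_group_dagger[OF square_axis_group[OF U]] by simp
  qed
qed

text \<open>Each dressed factor is congruent to its factor, and normality allows all dressings to be
  collected to the left of the product.\<close>

lemma effective_op_eqv:
  assumes i: "i < length F" and M: "M \<in> effective_ops F (F ! i)"
  shows "eqv axis_group M (G ! i)"
proof -
  obtain D t where D: "M = op_prod (map (\<lambda>j. (if t j then D j else mat 1) ** F ! i ! j) [0..<length (F ! i)])"
    "\<And>j. j < length (F ! i) \<Longrightarrow> D j \<in> factor_dressings F (F ! i ! j)"
    using M unfolding effective_ops_def by blast
  have U: "F ! i ! j \<in> axis_preserving" if "j < length (F ! i)" for j
    using i that by (intro factor_preserving[of "F ! i"]) auto
  have "eqv axis_group M (op_prod (map ((!) (F ! i)) [0..<length (F ! i)]))"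
    unfolding D(1)
  proof (rule N.op_prod_eqv, rule conjI)
    fix j assume "j \<in> set [0..<length (F ! i)]"
    then have j: "j < length (F ! i)" by simp
    have "(if t j then D j else mat 1) \<in> axis_group"
      using factor_dressing_axis_group[OF U[OF j] D(2)[OF j]] axis_group_one by simp
    then show "eqv axis_group ((if t j then D j else mat 1) ** F ! i ! j) (F ! i ! j)"
      unfolding eqv_def by blast
    show "F ! i ! j \<in> axis_preserving" by (rule U[OF j])
  qed
  then show ?thesis by (simp add: map_nth G_nth i)
qed

text \<open>All operators that occur as current generators or as effectively measured operators.\<close>

definition trackable :: "'n oper set"
  where "trackable = {t. \<exists>m. eqv axis_group t (gen_power G m)}"

lemma trackableI: "eqv axis_group t (gen_power G m) \<Longrightarrow> t \<in> trackable"
  by (auto simp: trackable_def)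

lemma trackable_eqv: "t \<in> trackable \<Longrightarrow> eqv axis_group t' t \<Longrightarrow> t' \<in> trackable"
  unfolding trackable_def using N.eqv_trans by blast

lemma gen_power_G_mult_eqv: "eqv axis_group (gen_power G m ** gen_power G m') (gen_power G (\<lambda>i. m i + m' i))"
proof (rule N.gen_power_mult[OF G_preserving])
  show "eqv axis_group (G ! i ** G ! j) (G ! j ** G ! i)" if "i < length G" "j < length G" for i j
    using that G_preserving nth_mem by (intro commutator_axis_group) blast+
qed (simp add: G_square axis_group_one)

lemma trackable_preserving: "t \<in> trackable \<Longrightarrow> t \<in> axis_preserving"
  unfolding trackable_def eqv_def
  using axis_preserving_mult axis_group_preserving gen_power_preserving by auto

lemma trackable_unitary: "t \<in> trackable \<Longrightarrow> is_unitary t"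
  using trackable_preserving axis_preservingD(1) by blast

lemma trackable_one: "mat 1 \<in> trackable"
  by (rule trackableI[of _ "\<lambda>_. 0"]) (simp add: N.eqv_refl)

lemma trackable_mult:
  assumes "t \<in> trackable" "t' \<in> trackable" shows "t ** t' \<in> trackable"
proof -
  obtain m m' where "eqv axis_group t (gen_power G m)" "eqv axis_group t' (gen_power G m')"
    using assms by (auto simp: trackable_def)
  then have "eqv axis_group (t ** t') (gen_power G m ** gen_power G m')"
    by (rule N.eqv_mult[OF _ _ gen_power_preserving])
  then show ?thesis using N.eqv_trans[OF _ gen_power_G_mult_eqv] trackableI by blast
qed

lemma trackable_smul:
  assumes "t \<in> trackable" "norm k = 1" shows "smul k t \<in> trackable"
proof (rule trackable_eqv[OF assms(1)])
  show "eqv axis_group (smul k t) t"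
    unfolding eqv_def using axis_group_smul[OF axis_group_one assms(2)]
    by (intro bexI[of _ "smul k (mat 1)"]) auto
qed

text \<open>The adjoint differs from \<open>t\<close> by the adjoint of \<open>t ** t\<close>, which
  lies in \<open>axis_group\<close>.\<close>

lemma trackable_dagger:
  assumes "t \<in> trackable" shows "dagger t \<in> trackable"
proof (rule trackable_eqv[OF assms])
  note u = unitary_cancel[OF trackable_unitary[OF assms]]
  have "dagger t = dagger (t ** t) ** t"
    by (simp add: mult_assoc_right u)
  then show "eqv axis_group (dagger t) t"
    unfolding eqv_def using axis_group_dagger[OF square_axis_group[OF trackable_preserving[OF assms]]] by blast
qed

lemma trackable_G: "g \<in> set G \<Longrightarrow> g \<in> trackable"
proof -
  assume "g \<in> set G"
  then obtain i where "i < length G" "g = G ! i" by (metis in_set_conv_nth)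
  then show ?thesis
    using gen_power_single[of i G] N.eqv_refl by (intro trackableI[of _ "\<lambda>j. if j \<in> {i} then 1 else 0"]) simp
qed

lemma trackable_effective:
  "i < length F \<Longrightarrow> M \<in> effective_ops F (F ! i) \<Longrightarrow> M \<in> trackable"
  using trackable_eqv[OF trackable_G effective_op_eqv] nth_mem[of i G] by simp

text \<open>Conjugation multiplies \<open>t\<close> by its group commutator with \<open>E\<close>,
  so the coset of \<open>t\<close> is kept.\<close>

lemma trackable_conj:
  assumes "t \<in> trackable" "E \<in> axis_preserving" shows "E ** t ** dagger E \<in> trackable"
proof (rule trackable_eqv[OF assms(1)])
  obtain a where "a \<in> axis_group" "E ** t = a ** (t ** E)"
    using commutator_axis_group[OF assms(2) trackable_preserving[OF assms(1)]] by (auto simp: eqv_def)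
  moreover from this have "E ** t ** dagger E = a ** t"
    by (simp add: matrix_mul_assoc unitary_cancel[OF axis_preservingD(1)[OF assms(2)]])
  ultimately show "eqv axis_group (E ** t ** dagger E) t" by (auto simp: eqv_def)
qed

subsection \<open>The central Paulis\<close>

lemma psi0_neq_0: "\<psi>0 \<noteq> 0"
  using norm0 by auto

lemma G_fix: "g \<in> set G \<Longrightarrow> g *v \<psi>0 = \<psi>0"
  using stab0 vec.span_base[of \<psi>0 "{\<psi>0}"] by (auto simp: uniquely_stabilizes_def common_eigenspace_def)

lemma generate_fix:
  assumes "\<And>g. g \<in> S \<Longrightarrow> is_unitary g" "\<And>g. g \<in> S \<Longrightarrow> g *v \<psi> = \<psi>" "h \<in> generate unitary_group S"
  shows "h *v \<psi> = \<psi>"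
  using common_eigenspace_generate[of S] assms unfolding common_eigenspace_def by blast

lemma B_subgroup: "subgroup B unitary_group"
  using init by (simp add: init_paulis_def)

lemma B_closed: "mat 1 \<in> B" "b \<in> B \<Longrightarrow> b' \<in> B \<Longrightarrow> b ** b' \<in> B" "b \<in> B \<Longrightarrow> dagger b \<in> B"
proof -
  show "mat 1 \<in> B" using subgroup.one_closed[OF B_subgroup] by simp
  show "b \<in> B \<Longrightarrow> b' \<in> B \<Longrightarrow> b ** b' \<in> B" using subgroup.m_closed[OF B_subgroup] by simp
  show "b \<in> B \<Longrightarrow> dagger b \<in> B"
    using subgroup.m_inv_closed[OF B_subgroup] inv_unitary_group pauli_group_unitary[OF B_pauli] by metis
qed

lemma B_generate: "b \<in> B \<Longrightarrow> b \<in> generate unitary_group (set G)"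
  using init by (auto simp: init_paulis_def)

text \<open>Elements of \<open>B\<close> are words in the generators, which all fix
  \<open>\<psi>0\<close>. In the lemmas below this nonzero fixed vector turns commutation up to sign
  into exact commutation and squares into the identity.\<close>

lemma B_fix: "b \<in> B \<Longrightarrow> b *v \<psi>0 = \<psi>0"
  by (rule generate_fix[OF G_unitary G_fix B_generate])

lemma B_commute: "b \<in> B \<Longrightarrow> b' \<in> B \<Longrightarrow> b ** b' = b' ** b"
  by (intro sign_commute_fix'[OF _ B_fix B_fix psi0_neq_0] pauli_group_sign_commute B_pauli)

lemma B_square: assumes "b \<in> B" shows "b ** b = mat 1"
proof -
  obtain s where s: "s \<in> signs" "b ** b = smul s (mat 1)" using pauli_group_square[OF B_pauli[OF assms]] by blast
  have "s *s \<psi>0 = \<psi>0" using mult_fix[OF B_fix B_fix, OF assms assms] by (simp add: s smul_vec)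
  then have "s = 1" using s(1) psi0_neq_0 by (auto simp: signs_def vec_eq_iff)
  with s show ?thesis by simp
qed

lemma B_G_commute: "g \<in> set G \<Longrightarrow> b \<in> B \<Longrightarrow> g ** b = b ** g"
  using G_preserving by (intro sign_commute_fix'[OF _ G_fix B_fix psi0_neq_0] axis_preservingD(3)) auto

text \<open>Signs are added because axis parts and generator parts of trackable operators commute
  only up to sign, and because data errors may flip non-primary generators.\<close>

definition signed_B :: "'n oper set"
  where "signed_B = {smul s b | s b. s \<in> signs \<and> b \<in> B}"

text \<open>Exact commutation holds for all trackable operators, whereas data errors are only known
  to commute with \<open>B\<close> up to sign.\<close>

definition B_centralizer :: "'n oper set"
  where "B_centralizer = {U. is_unitary U \<and> (\<forall>b\<in>B. U ** b = b ** U)}"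

lemma B_in_signed: "b \<in> B \<Longrightarrow> b \<in> signed_B"
  unfolding signed_B_def using smul_1[of b] signs_1(1) by (metis (mono_tags, lifting) CollectI)

lemma signed_B_smul: "s \<in> signs \<Longrightarrow> x \<in> signed_B \<Longrightarrow> smul s x \<in> signed_B"
  unfolding signed_B_def using signs_mult by fastforce

lemma signed_B_centralizer: "x \<in> signed_B \<Longrightarrow> x \<in> B_centralizer"
  using is_unitary_smul[OF sign_self_mult(3) pauli_group_unitary[OF B_pauli]]
  by (auto simp: signed_B_def B_centralizer_def B_commute)

lemma centralizer_commute: "U \<in> B_centralizer \<Longrightarrow> x \<in> signed_B \<Longrightarrow> U ** x = x ** U"
  by (auto simp: signed_B_def B_centralizer_def)

lemma centralizer_pair:
  assumes "A \<subseteq> signed_B" "mat 1 \<in> A" "\<And>a b. a \<in> A \<Longrightarrow> b \<in> A \<Longrightarrow> a ** b \<in> A" "\<And>a. a \<in> A \<Longrightarrow> dagger a \<in> A"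
  shows "normal_pair B_centralizer A"
proof
  fix x y assume "x \<in> B_centralizer" "y \<in> B_centralizer"
  then show "x ** y \<in> B_centralizer"
    unfolding B_centralizer_def by (auto simp: is_unitary_mult) (metis matrix_mul_assoc)
next
  fix x a assume x: "x \<in> B_centralizer" "a \<in> A"
  then show "\<exists>a'\<in>A. x ** a = a' ** x" using assms(1) centralizer_commute by blast
qed (use assms signed_B_centralizer in \<open>auto simp: B_centralizer_def\<close>, (use assms signed_B_centralizer in \<open>unfold B_centralizer_def, blast\<close>)+)

sublocale C: normal_pair B_centralizer signed_B
proof (rule centralizer_pair[OF order_refl])
  show "mat 1 \<in> signed_B" by (rule B_in_signed[OF B_closed(1)])
  show "a ** b \<in> signed_B" if ab: "a \<in> signed_B" "b \<in> signed_B" for a b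
  proof -
    obtain s t x y where "a = smul s x" "b = smul t y" "s \<in> signs" "t \<in> signs" "x \<in> B" "y \<in> B"
      using ab unfolding signed_B_def by blast
    then show ?thesis by (simp add: signed_B_smul signs_mult B_in_signed B_closed)
  qed
  show "dagger a \<in> signed_B" if "a \<in> signed_B" for a
  proof -
    obtain s x where "a = smul s x" "s \<in> signs" "x \<in> B" using \<open>a \<in> signed_B\<close> by (auto simp: signed_B_def)
    then show ?thesis by (simp add: signed_B_smul B_in_signed B_closed)
  qed
qed

lemma G_centralizer: "set G \<subseteq> B_centralizer"
  using B_G_commute by (auto simp: B_centralizer_def G_unitary)

lemma gen_power_centralizer: "gen_power G m \<in> B_centralizer"
  unfolding gen_power_def using G_centralizer nth_mem[of _ G] by (intro C.op_prod_K) (auto simp: C.K_one)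

lemma gen_power_fix:
  assumes "\<And>i. i < length gs \<Longrightarrow> m i = 1 \<Longrightarrow> gs ! i *v \<phi> = \<phi>"
  shows "gen_power gs m *v \<phi> = \<phi>"
proof -
  have *: "(\<And>x. x \<in> set xs \<Longrightarrow> x *v \<phi> = \<phi>) \<Longrightarrow> op_prod xs *v \<phi> = \<phi>" for xs
    by (induction xs) (auto intro: mult_fix)
  show ?thesis
    unfolding gen_power_def by (rule *) (use assms in auto)
qed

text \<open>The commutator is an axis-group element fixing \<open>\<psi>0\<close>. Its square is a
  scalar, hence one, so its phase is a sign; it is thus a Pauli commutator of generators, and these
  belong to \<open>B\<close>.\<close>

lemma G_commutator_B:
  assumes g: "g \<in> set G" and h: "h \<in> set G" shows "eqv signed_B (g ** h) (h ** g)"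
proof -
  have K: "g \<in> axis_preserving" "h \<in> axis_preserving" using g h G_preserving by auto
  obtain a where a: "a \<in> axis_group" "g ** h = a ** (h ** g)"
    using commutator_axis_group[OF K] by (auto simp: eqv_def)
  have comm: "commutator g h = a"
    using unitary_cancel(5)[OF G_unitary[OF h]] unitary_cancel(5)[OF G_unitary[OF g]]
    by (simp add: commutator_def a(2) matrix_mul_assoc)
  have "a *v \<psi>0 = \<psi>0"
    unfolding comm[symmetric] commutator_def
    by (intro mult_fix G_fix dagger_fix G_unitary g h)
  obtain k c where k: "a = smul k (ax c)" using a(1) by (rule axis_groupE)
  have "smul (k * k) (mat 1) *v \<psi>0 = \<psi>0"
    using mult_fix[OF \<open>a *v \<psi>0 = \<psi>0\<close> \<open>a *v \<psi>0 = \<psi>0\<close>] by (simp add: k)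
  then have "k * k = 1" using psi0_neq_0 by (auto simp: smul_vec vec_eq_iff)
  then have "k \<in> phases" by (auto simp: phases_def square_eq_1_iff)
  then have "a \<in> pauli_group" by (simp add: k pauli_group_smul)
  then have "a \<in> commutator_paulis F"
    unfolding commutator_paulis_def using g h comm by (intro generate.incl) blast
  then have "a \<in> B" using init by (auto simp: init_paulis_def)
  with a(2) show ?thesis unfolding eqv_def using B_in_signed by blast
qed

lemma trackableE:
  assumes "t \<in> trackable"
  obtains a m where "a \<in> axis_group" "t = a ** gen_power G m"
  using assms by (auto simp: trackable_def eqv_def)

lemma trackable_centralizer: "t \<in> trackable \<Longrightarrow> t \<in> B_centralizer"
proof (erule trackableE)
  fix a m assume "a \<in> axis_group" "t = a ** gen_power G m"
  moreover from this have "a \<in> B_centralizer"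
    using axis_group_unitary by (auto simp: B_centralizer_def axis_group_def)
  ultimately show ?thesis using C.K_mult gen_power_centralizer by blast
qed

lemma gen_power_G_swap: "eqv signed_B (gen_power G m ** gen_power G m') (gen_power G m' ** gen_power G m)"
proof -
  have sub: "set (map (\<lambda>j. if m j = 1 then G ! j else mat 1) [0..<length G]) \<subseteq> insert (mat 1) (set G)"
    for m :: "nat \<Rightarrow> bit" by auto
  have swap: "eqv signed_B (x ** y) (y ** x)"
    if "x \<in> insert (mat 1) (set G)" "y \<in> insert (mat 1) (set G)" for x y
    using that G_commutator_B C.eqv_refl by auto
  have "insert (mat 1) (set G) \<subseteq> B_centralizer" using G_centralizer C.K_one by blast
  then show ?thesis
    unfolding gen_power_def using sub by (intro C.op_prod_swap_list swap) blast+
qed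

text \<open>Moving an axis part past a generator part costs a sign, and exchanging the two generator
  parts costs an element of \<open>signed_B\<close>; that element is central and can be pulled to
  the front.\<close>

lemma trackable_swap:
  assumes t: "t \<in> trackable" and t': "t' \<in> trackable" shows "eqv signed_B (t ** t') (t' ** t)"
proof -
  obtain a m where a: "a \<in> axis_group" "t = a ** gen_power G m" using t by (rule trackableE)
  obtain a' m' where a': "a' \<in> axis_group" "t' = a' ** gen_power G m'" using t' by (rule trackableE)
  let ?g = "gen_power G m" and ?g' = "gen_power G m'"
  obtain s where s: "s \<in> signs" "?g ** a' = smul s (a' ** ?g)"
    using axis_preserving_axis_group[OF gen_power_preserving a'(1)] unfolding sign_commute_def by blast
  obtain s' where s': "s' \<in> signs" "?g' ** a = smul s' (a ** ?g')"
    using axis_preserving_axis_group[OF gen_power_preserving a(1)] unfolding sign_commute_def by blast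
  obtain x where x: "x \<in> signed_B" "?g ** ?g' = x ** (?g' ** ?g)"
    using gen_power_G_swap unfolding eqv_def by blast
  have aB: "a ** a' \<in> B_centralizer"
    using axis_group_mult[OF a(1) a'(1)] axis_group_unitary by (auto simp: B_centralizer_def axis_group_def)
  have "t ** t' = a ** (?g ** a') ** ?g'" by (simp add: a a' matrix_mul_assoc)
  also have "\<dots> = smul s (a ** a' ** (?g ** ?g'))" by (simp add: s matrix_mul_assoc)
  also have "\<dots> = smul s ((a ** a' ** x) ** (?g' ** ?g))" by (simp add: x matrix_mul_assoc)
  also have "\<dots> = smul s (x ** (a ** a') ** (?g' ** ?g))" using centralizer_commute[OF aB x(1)] by simp
  finally have 1: "t ** t' = smul s (x ** (a ** a') ** (?g' ** ?g))" .
  have "t' ** t = a' ** (?g' ** a) ** ?g" by (simp add: a a' matrix_mul_assoc)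
  also have "\<dots> = smul s' (a' ** a ** (?g' ** ?g))" by (simp add: s' matrix_mul_assoc)
  also have "a' ** a = a ** a'" by (rule axis_group_commute[OF a'(1) a(1)])
  finally have 2: "t' ** t = smul s' (a ** a' ** (?g' ** ?g))" .
  have "t ** t' = smul (s * s') x ** (t' ** t)"
    using s'(1) by (simp add: 1 2 matrix_mul_assoc mult_ac)
  then show ?thesis unfolding eqv_def using signed_B_smul[OF signs_mult[OF s(1) s'(1)] x(1)] by blast
qed

text \<open>The scalar stays undetermined because the axis part has an arbitrary phase; in
  \<open>stabilizer_square\<close> a fixed vector determines it.\<close>

lemma trackable_square:
  assumes t: "t \<in> trackable" shows "\<exists>k. \<exists>x\<in>signed_B. t ** t = smul k x"
proof -
  obtain a m where a: "a \<in> axis_group" "t = a ** gen_power G m" using t by (rule trackableE)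
  let ?g = "gen_power G m"
  obtain s where s: "s \<in> signs" "?g ** a = smul s (a ** ?g)"
    using axis_preserving_axis_group[OF gen_power_preserving a(1)] unfolding sign_commute_def by blast
  obtain k c where k: "a = smul k (ax c)" using a(1) by (rule axis_groupE)
  have "eqv signed_B (?g ** ?g) (gen_power G (\<lambda>i. m i + m i))"
    using G_centralizer
  proof (rule C.gen_power_mult)
    show "eqv signed_B (G ! i ** G ! j) (G ! j ** G ! i)" if "i < length G" "j < length G" for i j
      using that by (intro G_commutator_B) auto
  qed (simp add: G_square C.A_one)
  moreover have "(\<lambda>i. m i + m i) = (\<lambda>_. 0)" by auto
  ultimately have "eqv signed_B (?g ** ?g) (mat 1)" by simp
  then have g: "?g ** ?g \<in> signed_B" by (simp add: eqv_def)
  have "t ** t = a ** (?g ** a) ** ?g" by (simp add: a matrix_mul_assoc)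
  also have "\<dots> = smul s (a ** a ** (?g ** ?g))" by (simp add: s matrix_mul_assoc)
  also have "a ** a = smul (k * k) (mat 1)" by (simp add: k)
  finally have "t ** t = smul (s * (k * k)) (?g ** ?g)" by simp
  with g show ?thesis by blast
qed

end

section \<open>Traces of trackable operators and the order of a stabilizer\<close>

lemma pm_sign_simps [simp]: "pm_sign 0 = 1" "pm_sign 1 = - 1" "pm_sign b \<in> signs"
  by (simp_all add: pm_sign_def)

lemma pm_sign_add: "pm_sign (a + b) = pm_sign a * pm_sign b"
  by (cases a; cases b) simp_all

lemma bit_vec_nonzero: "w \<noteq> 0 \<Longrightarrow> \<exists>q. w $ q = 1" for w :: "bit ^ 'n"
  by (auto simp: vec_eq_iff)

lemma finite_bit_vec: "finite (UNIV :: (bit ^ 'n::finite) set)"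
proof (rule finite_imageD)
  show "inj (\<lambda>c :: bit ^ 'n. {q. c $ q = 1})"
    by (auto simp: inj_def vec_eq_iff set_eq_iff) (metis bit_not_one_iff)
qed simp

text \<open>Exponent vectors given by index sets form a finite family that is easy to count, unlike
  functions on all natural numbers.\<close>

abbreviation indicator_bit :: "nat set \<Rightarrow> nat \<Rightarrow> bit"
  where "indicator_bit X \<equiv> \<lambda>i. if i \<in> X then 1 else 0"

lemma uniquely_stabilizesD:
  assumes "uniquely_stabilizes S \<psi>"
  shows "\<psi> \<noteq> 0" "s \<in> S \<Longrightarrow> s *v \<psi> = \<psi>" "(\<And>s. s \<in> S \<Longrightarrow> s *v \<phi> = \<phi>) \<Longrightarrow> \<exists>k. \<phi> = k *s \<psi>"
  using assms vec.span_base[of \<psi> "{\<psi>}"] mem_span_singleton[of \<phi> \<psi>]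
  by (auto simp: uniquely_stabilizes_def common_eigenspace_def)

lemma uniquely_stabilizesI:
  assumes "\<psi> \<noteq> 0" "\<And>s. s \<in> S \<Longrightarrow> s *v \<psi> = \<psi>"
    and "\<And>\<phi>. (\<And>s. s \<in> S \<Longrightarrow> s *v \<phi> = \<phi>) \<Longrightarrow> \<exists>k. \<phi> = k *s \<psi>"
  shows "uniquely_stabilizes S \<psi>"
proof -
  have "s *v (k *s \<psi>) = k *s \<psi>" if "s \<in> S" for s k
    by (simp add: assms(2)[OF that] vec.linear_scale[OF matrix_vector_mul_linear_gen])
  then show ?thesis
    using assms(1,3) by (auto simp: uniquely_stabilizes_def common_eigenspace_def vec.span_singleton image_iff)
qed

context exact_generators
begin

text \<open>Bit \<open>q\<close> of the sum counts, modulo two, the occurring generators that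
  anticommute with the axis Pauli on \<open>q\<close>.\<close>

lemma axis_anticommutes_gen_power:
  assumes "(\<Sum>j<length F. m j *s v j) $ q = 1"
  shows "ax (axis q 1) ** gen_power G m = smul (- 1) (gen_power G m ** ax (axis q 1))"
proof -
  let ?Q = "ax (axis q 1)"
  have G: "?Q ** G ! j = smul (pm_sign (v j $ q)) (G ! j ** ?Q)" if "j < length F" for j
  proof -
    have "(\<Sum>q'\<in>UNIV. (axis q 1 :: bit ^ 'n) $ q' * v j $ q') = (\<Sum>q'\<in>UNIV. if q' = q then v j $ q else 0)"
      by (rule sum.cong) (auto simp: axis_def)
    then show ?thesis
      using support[OF that] unfolding anticommutation_support_def smul_def by simp
  qed
  have *: "set xs \<subseteq> {..<length F} \<Longrightarrow>
    ?Q ** op_prod (map (\<lambda>j. if m j = 1 then G ! j else mat 1) xs) =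
    smul (pm_sign (\<Sum>j\<leftarrow>xs. m j * v j $ q)) (op_prod (map (\<lambda>j. if m j = 1 then G ! j else mat 1) xs) ** ?Q)"
    for xs
  proof (induction xs)
    case (Cons j xs)
    let ?g = "if m j = 1 then G ! j else mat 1" and ?p = "op_prod (map (\<lambda>j. if m j = 1 then G ! j else mat 1) xs)"
    have j: "?Q ** ?g = smul (pm_sign (m j * v j $ q)) (?g ** ?Q)"
      using G[of j] Cons.prems by (cases "m j") auto
    have "?Q ** (?g ** ?p) = (?Q ** ?g) ** ?p" by (simp add: matrix_mul_assoc)
    also have "\<dots> = smul (pm_sign (m j * v j $ q)) (?g ** (?Q ** ?p))"
      by (simp only: j smul_mult_left matrix_mul_assoc)
    also have "?Q ** ?p = smul (pm_sign (\<Sum>j\<leftarrow>xs. m j * v j $ q)) (?p ** ?Q)"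
      using Cons by simp
    finally show ?case
      by (simp only: pm_sign_add sum_list.Cons list.map op_prod_simps smul_mult_right smul_smul matrix_mul_assoc)
  qed simp
  have "(\<Sum>j\<leftarrow>[0..<length F]. m j * v j $ q) = (\<Sum>j<length F. m j *s v j) $ q"
    by (simp add: interv_sum_list_conv_sum_set_nat atLeast0LessThan)
  with *[of "[0..<length F]"] assms show ?thesis by (simp add: gen_power_def atLeast0LessThan)
qed

lemma axis_group_traceless: "a \<in> axis_group \<Longrightarrow> trace a = 0 \<or> (\<exists>k. a = smul k (mat 1))"
proof (erule axis_groupE)
  fix k c assume a: "a = smul k (ax c)"
  show ?thesis
  proof (cases "c = 0")
    case False
    then obtain q where q: "c $ q = 1" by (auto simp: vec_eq_iff)
    let ?R = "pauli_on q (other_pauli (Q q))"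
    have "ax c ** ?R = smul (- 1) (?R ** ax c)"
      using axis_pauli_other_commute[of Q q c] Q_neq_PI q by simp
    then have "?R ** a = smul (- 1) (a ** ?R)" by (simp add: a mult.commute)
    then show ?thesis using trace_anticommute[of ?R a] by (simp add: pauli_on_def)
  qed (use a in auto)
qed

lemma trackable_traceless:
  assumes t: "t \<in> trackable" shows "trace t = 0 \<or> (\<exists>k. t = smul k (mat 1))"
proof -
  obtain a m where a: "a \<in> axis_group" "t = a ** gen_power G m" using t by (rule trackableE)
  show ?thesis
  proof (cases "(\<Sum>j<length F. m j *s v j) = 0")
    case True
    then obtain k c where k: "k \<in> phases" "gen_power G m = smul k (ax c)"
      using exact[of m] by (auto simp: zero_primary_def smul_def)
    \<comment> \<open>The generator part centralizes \<open>B\<close>, hence so does the axis Pauli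
      equal to it up to a phase; this is needed for membership in \<open>axis_group\<close>.\<close>
    have "ax c ** b = b ** ax c" if "b \<in> B" for b
    proof -
      have "smul k (ax c ** b) = smul k (b ** ax c)"
        using gen_power_centralizer[of m] that unfolding B_centralizer_def k by auto
      then show ?thesis using k(1) by (auto simp: smul_cancel phases_def)
    qed
    then have "gen_power G m \<in> axis_group"
      using k phases_norm by (auto simp: axis_group_def)
    then show ?thesis using axis_group_traceless axis_group_mult a by simp
  next
    case False
    then obtain q where q: "(\<Sum>j<length F. m j *s v j) $ q = 1" using bit_vec_nonzero by blast
    have "ax (axis q 1) ** t = a ** (ax (axis q 1) ** gen_power G m)"
      using axis_group_ax[OF a(1), of "axis q 1"] by (simp add: a(2) matrix_mul_assoc)
    also have "\<dots> = smul (- 1) (t ** ax (axis q 1))"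
      by (simp add: axis_anticommutes_gen_power[OF q] a(2) matrix_mul_assoc)
    finally show ?thesis using trace_anticommute[OF axis_pauli_simps(2)] by blast
  qed
qed

text \<open>It depends on the state alone, so the group generated by any uniquely stabilizing list
  can be compared with it.\<close>

definition stabilizer :: "'n state \<Rightarrow> 'n oper set"
  where "stabilizer \<psi> = {t \<in> trackable. t *v \<psi> = \<psi>}"

text \<open>An axis vector and a set of generators determine a trackable operator up to a phase, and
  fixing a nonzero vector determines the phase.\<close>

lemma stabilizer_finite:
  assumes "\<psi> \<noteq> 0" shows "finite (stabilizer \<psi>)"
proof -
  let ?S = "\<lambda>(c, X). {t \<in> stabilizer \<psi>. \<exists>k. t = smul k (ax c ** gen_power G (indicator_bit X))}"
  have "finite (?S (c, X))" for c X
  proof (cases "?S (c, X) = {}")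
    case False
    then obtain t where t: "t \<in> ?S (c, X)" by blast
    have "?S (c, X) \<subseteq> {t}"
    proof
      fix u assume "u \<in> ?S (c, X)"
      then obtain k l where k: "t = smul k (ax c ** gen_power G (indicator_bit X))" "t *v \<psi> = \<psi>"
        "u = smul l (ax c ** gen_power G (indicator_bit X))" "u *v \<psi> = \<psi>"
        using t by (auto simp: stabilizer_def)
      define \<phi> where "\<phi> = (ax c ** gen_power G (indicator_bit X)) *v \<psi>"
      have "k *s \<phi> = \<psi>" "l *s \<phi> = \<psi>" using k by (simp_all add: smul_vec \<phi>_def)
      moreover from this assms have "\<phi> \<noteq> 0" by auto
      ultimately have "k = l" by (metis vec.scale_cancel_right)
      then show "u \<in> {t}" by (simp add: k)
    qed
    then show ?thesis by (meson finite.intros finite_subset)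
  next
    case True
    then show ?thesis by (simp only: finite.emptyI)
  qed
  moreover have "stabilizer \<psi> \<subseteq> (\<Union>p\<in>UNIV \<times> Pow {..<length F}. ?S p)"
  proof
    fix t assume t: "t \<in> stabilizer \<psi>"
    then obtain a m where a: "a \<in> axis_group" "t = a ** gen_power G m"
      by (auto simp: stabilizer_def elim: trackableE)
    obtain k c where k: "a = smul k (ax c)" using a(1) by (rule axis_groupE)
    let ?X = "{j \<in> {..<length F}. m j = 1}"
    have "gen_power G m = gen_power G (indicator_bit ?X)" by (rule gen_power_cong) auto
    then have "t = smul k (ax c ** gen_power G (indicator_bit ?X))" by (simp add: a k)
    with t show "t \<in> (\<Union>p\<in>UNIV \<times> Pow {..<length F}. ?S p)"
      by (intro UN_I[of "(c, ?X)"]) auto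
  qed
  ultimately show ?thesis
    using finite_bit_vec by (elim finite_subset) (auto intro!: finite_UN_I)
qed

lemma generate_stabilizer:
  assumes Gs: "set Gs \<subseteq> trackable" and stab: "uniquely_stabilizes (set Gs) \<psi>"
  shows "generate unitary_group (set Gs) = stabilizer \<psi>" "card (stabilizer \<psi>) = 2 ^ CARD('n)"
proof -
  let ?H = "generate unitary_group (set Gs)"
  note st = uniquely_stabilizesD[OF stab]
  have unit: "g \<in> set Gs \<Longrightarrow> is_unitary g" for g using Gs trackable_unitary by blast
  have HT: "h \<in> trackable" if "h \<in> ?H" for h
    using that unit
    by (rule generate_induct_unitary) (use Gs in \<open>auto intro: trackable_one trackable_mult trackable_dagger\<close>)
  have sub: "?H \<subseteq> stabilizer \<psi>"
    using HT generate_fix[OF unit st(2)] by (auto simp: stabilizer_def)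
  have fin: "finite (stabilizer \<psi>)" by (rule stabilizer_finite[OF st(1)])
  \<comment> \<open>Any product-closed set between the generated group and the full stabilizer has
    the same order. Taking both extremes forces them to coincide.\<close>
  have count: "card S = 2 ^ CARD('n)"
    if S: "?H \<subseteq> S" "S \<subseteq> stabilizer \<psi>" "\<And>s t. s \<in> S \<Longrightarrow> t \<in> S \<Longrightarrow> s ** t \<in> S" for S
  proof (rule card_traceless_stabilizer[where \<psi> = \<psi>])
    show "finite S" using fin S(2) finite_subset by blast
    show "mat 1 \<in> S" using S(1) generate.one[of unitary_group "set Gs"] by auto
    show "is_unitary s" if "s \<in> S" for s using that S(2) trackable_unitary by (auto simp: stabilizer_def)
    show "trace s = 0" if s: "s \<in> S" "s \<noteq> mat 1" for s
    proof (rule ccontr)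
      assume "trace s \<noteq> 0"
      then obtain k where k: "s = smul k (mat 1)"
        using trackable_traceless s(1) S(2) by (auto simp: stabilizer_def)
      moreover have "s *v \<psi> = \<psi>" using s(1) S(2) by (auto simp: stabilizer_def)
      ultimately have "k *s \<psi> = 1 *s \<psi>" by (simp add: smul_vec)
      then have "k = 1" using st(1) by (metis vec.scale_cancel_right)
      with k s(2) show False by simp
    qed
    show "uniquely_stabilizes S \<psi>"
    proof (rule uniquely_stabilizesI[OF st(1)])
      show "s *v \<psi> = \<psi>" if "s \<in> S" for s using that S(2) by (auto simp: stabilizer_def)
      show "\<exists>k. \<phi> = k *s \<psi>" if "\<And>s. s \<in> S \<Longrightarrow> s *v \<phi> = \<phi>" for \<phi>
        using that S(1) by (intro st(3)) (auto intro: generate.incl)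
    qed
  qed (rule S)
  show c: "card (stabilizer \<psi>) = 2 ^ CARD('n)"
    by (rule count[OF sub order_refl]) (auto simp: stabilizer_def trackable_mult mult_fix)
  have "card ?H = 2 ^ CARD('n)"
    by (rule count[OF order_refl sub]) (use generate.eng[of _ unitary_group "set Gs"] in simp)
  with c show "?H = stabilizer \<psi>" using card_subset_eq[OF fin sub] by simp
qed

section \<open>Independence of the generators and non-primary products\<close>

definition rest :: "nat set"
  where "rest = {..<length F} - J"

lemma G_rest_B: "j \<in> rest \<Longrightarrow> G ! j \<in> B"
  using primary by (auto simp: primary_indices_def rest_def)

text \<open>The non-primary generators are central involutions, so their exponents simply add up.\<close>

lemma gen_power_mult_rest:
  assumes Gs: "set Gs \<subseteq> trackable" "length Gs = length F"
    and r: "\<And>j. j \<in> rest \<Longrightarrow> Gs ! j \<in> signed_B"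
    and m': "\<And>i. i < length F \<Longrightarrow> m' i = 1 \<Longrightarrow> i \<in> rest"
  shows "gen_power Gs m ** gen_power Gs m' = gen_power Gs (\<lambda>i. m i + m' i)"
proof -
  have "eqv {mat 1} (gen_power Gs m ** gen_power Gs m') (gen_power Gs (\<lambda>i. m i + m' i))"
  proof (rule normal_pair.gen_power_mult[OF unitary_pair])
    show "set Gs \<subseteq> {U. is_unitary U}" using Gs trackable_unitary by blast
    fix i assume i: "i < length Gs"
    show "eqv {mat 1} (Gs ! i ** Gs ! j) (Gs ! j ** Gs ! i)" if "j < length Gs" "m' j = 1" for j
      using i Gs that by (auto intro!: centralizer_commute trackable_centralizer r m')
    show "Gs ! i ** Gs ! i \<in> {mat 1}" if "m' i = 1"
      using r[OF m'[OF _ that]] i Gs(2) by (auto simp: signed_B_def B_square)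
  qed
  then show ?thesis by simp
qed

lemma G_trackable: "set G \<subseteq> trackable"
  using trackable_G by blast

lemma gen_power_rest_B: "X \<subseteq> rest \<Longrightarrow> gen_power G (indicator_bit X) \<in> B"
proof -
  assume X: "X \<subseteq> rest"
  have *: "set xs \<subseteq> rest \<Longrightarrow> op_prod (map ((!) G) xs) \<in> B" for xs
    by (induction xs) (auto intro: B_closed G_rest_B)
  show ?thesis unfolding gen_power_filter by (rule *) (use X in auto)
qed

lemma gen_power_split:
  assumes "X \<subseteq> {..<length F}"
  shows "gen_power G (indicator_bit X) =
    gen_power G (indicator_bit (X \<inter> J)) ** gen_power G (indicator_bit (X \<inter> rest))"
proof -
  have "gen_power G (indicator_bit X) =
    gen_power G (\<lambda>i. indicator_bit (X \<inter> J) i + indicator_bit (X \<inter> rest) i)"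
    using assms by (intro gen_power_cong) (auto simp: rest_def)
  also have "\<dots> = gen_power G (indicator_bit (X \<inter> J)) ** gen_power G (indicator_bit (X \<inter> rest))"
    using G_trackable G_rest_B B_in_signed by (intro gen_power_mult_rest[symmetric]) (auto split: if_splits)
  finally show ?thesis .
qed

text \<open>Dividing out the non-primary part leaves a product of distinct primary generators in
  \<open>B\<close>, which \<open>no_product_in\<close> permits only for the empty product.\<close>

lemma primary_trivial:
  assumes X: "X \<subseteq> {..<length F}" and B: "gen_power G (indicator_bit X) \<in> B"
  shows "X \<subseteq> rest"
proof -
  have r: "gen_power G (indicator_bit (X \<inter> rest)) \<in> B" by (rule gen_power_rest_B) simp
  have "gen_power G (indicator_bit (X \<inter> J)) =
    gen_power G (indicator_bit X) ** dagger (gen_power G (indicator_bit (X \<inter> rest)))"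
    using gen_power_split[OF X] unitary_cancel(5)[OF pauli_group_unitary[OF B_pauli[OF r]]] by simp
  then have "gen_power G (indicator_bit (X \<inter> J)) \<in> B" using B r B_closed by simp
  then have "op_prod (map ((!) G) (filter (\<lambda>i. i \<in> X \<inter> J) [0..<length G])) \<in> B"
    by (simp only: gen_power_filter)
  moreover have "no_product_in F B J" using primary by (simp add: primary_indices_def)
  ultimately have "filter (\<lambda>i. i \<in> X \<inter> J) [0..<length G] = []"
    unfolding no_product_in_def by fastforce
  then show ?thesis using X by (auto simp: filter_empty_conv rest_def)
qed

text \<open>The product over the symmetric difference \<open>Z\<close> lies in
  \<open>signed_B\<close>, and the fixed vector \<open>\<psi>0\<close> removes the sign. Then
  \<open>Z\<close> is non-primary, and the independence of the non-primary generators makes it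
  empty.\<close>

lemma gen_power_injective: "inj_on (\<lambda>X. gen_power G (indicator_bit X)) (Pow {..<length F})"
proof (rule inj_onI)
  fix X Y assume XY: "X \<in> Pow {..<length F}" "Y \<in> Pow {..<length F}"
    and eq: "gen_power G (indicator_bit X) = gen_power G (indicator_bit Y)"
  define Z where "Z = (X - Y) \<union> (Y - X)"
  have mult: "eqv signed_B (gen_power G m ** gen_power G m') (gen_power G (\<lambda>i. m i + m' i))" for m m'
    using G_centralizer by (rule C.gen_power_mult) (simp_all add: G_commutator_B G_square C.A_one)
  have Zadd: "(\<lambda>i. indicator_bit X i + indicator_bit Y i) = indicator_bit Z"
    by (auto simp: Z_def)
  have Xadd: "(\<lambda>i. indicator_bit X i + indicator_bit X i) = (\<lambda>_. 0)" by auto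
  \<comment> \<open>By \<open>eq\<close> the same square has two readings, with exponents
    \<open>X + Y = Z\<close> and \<open>X + X = 0\<close>.\<close>
  have "eqv signed_B (gen_power G (indicator_bit X) ** gen_power G (indicator_bit X)) (gen_power G (indicator_bit Z))"
    using mult[of "indicator_bit X" "indicator_bit Y"] unfolding Zadd eq[symmetric] .
  from C.eqv_trans[OF C.eqv_sym[OF this] mult[of "indicator_bit X" "indicator_bit X", unfolded Xadd]]
  have "gen_power G (indicator_bit Z) \<in> signed_B" by (simp add: eqv_def)
  then obtain s b where s: "s \<in> signs" "b \<in> B" "gen_power G (indicator_bit Z) = smul s b"
    by (auto simp: signed_B_def)
  have "gen_power G (indicator_bit Z) *v \<psi>0 = \<psi>0"
    by (rule gen_power_fix) (auto intro: G_fix)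
  then have "s = 1" using s B_fix[OF s(2)] psi0_neq_0 by (auto simp: smul_vec vec_eq_iff)
  with s have "gen_power G (indicator_bit Z) \<in> B" by simp
  moreover have Zn: "Z \<subseteq> {..<length F}" using XY by (auto simp: Z_def)
  ultimately have Zr: "Z \<subseteq> rest" by (rule primary_trivial[rotated])
  have "gen_power G (indicator_bit X) ** gen_power G (indicator_bit Z) =
    gen_power G (\<lambda>i. indicator_bit X i + indicator_bit Z i)"
    using G_trackable G_rest_B B_in_signed Zr by (intro gen_power_mult_rest) (auto split: if_splits)
  also have "(\<lambda>i. indicator_bit X i + indicator_bit Z i) = indicator_bit Y"
    by (auto simp: Z_def)
  finally have "gen_power G (indicator_bit X) ** gen_power G (indicator_bit Z) = gen_power G (indicator_bit X) ** mat 1"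
    by (simp add: eq)
  then have "gen_power G (indicator_bit Z) = mat 1"
    using unitary_eq_cancel(1)[OF axis_preservingD(1)[OF gen_power_preserving]] by blast
  then have "op_prod (map ((!) G) (filter (\<lambda>i. i \<in> Z) [0..<length G])) = mat 1"
    by (simp only: gen_power_filter)
  moreover have "no_product_in F {mat 1} rest" using primary by (simp add: primary_indices_def rest_def)
  ultimately have "filter (\<lambda>i. i \<in> Z) [0..<length G] = []"
    using Zr unfolding no_product_in_def by fastforce
  then have "Z = {}" using Zn by (auto simp: filter_empty_conv)
  then show "X = Y" by (auto simp: Z_def)
qed

text \<open>There are \<open>2\<^sup>n\<close> exponent vectors and \<open>2\<^sup>n\<close> stabilizers of \<open>\<psi>0\<close>, so every element of \<open>B\<close> is a
  product of generators, and these are non-primary.\<close>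

lemma B_product_of_rest:
  assumes b: "b \<in> B" shows "\<exists>X\<subseteq>rest. b = gen_power G (indicator_bit X)"
proof -
  let ?f = "\<lambda>X. gen_power G (indicator_bit X)"
  note gs = generate_stabilizer[OF G_trackable stab0]
  have "?f ` Pow {..<length F} \<subseteq> stabilizer \<psi>0"
  proof
    fix t assume "t \<in> ?f ` Pow {..<length F}"
    then obtain X where X: "t = ?f X" by blast
    have "t *v \<psi>0 = \<psi>0" unfolding X by (rule gen_power_fix) (auto intro: G_fix)
    then show "t \<in> stabilizer \<psi>0" using X N.eqv_refl trackableI by (auto simp: stabilizer_def)
  qed
  moreover have "card (?f ` Pow {..<length F}) = 2 ^ CARD('n)"
    unfolding card_image[OF gen_power_injective] by (simp add: card_Pow len)
  ultimately have "?f ` Pow {..<length F} = stabilizer \<psi>0"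
    using card_subset_eq[OF stabilizer_finite[OF psi0_neq_0]] gs(2) by metis
  then obtain X where "X \<subseteq> {..<length F}" "b = ?f X"
    using B_generate[OF b] gs(1) by blast
  then show ?thesis using primary_trivial b by blast
qed

end

section \<open>Projections and outcome probabilities\<close>

lemma vec_scale: "A *v (k *s x) = k *s (A *v x)" for A :: "('n::finite) oper"
  by (rule vec.linear_scale[OF matrix_vector_mul_linear_gen])

lemma vec_minus: "A *v (- x) = - (A *v x)" for A :: "('n::finite) oper"
  by (simp add: vec_eq_iff matrix_vector_mult_def sum_negf)

lemma op_prod_signs:
  assumes "\<And>j. j \<in> set xs \<Longrightarrow> \<exists>s\<in>signs. f j = smul s (g j)"
  shows "\<exists>s\<in>signs. op_prod (map f xs) = smul s (op_prod (map g xs))"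
  using assms
proof (induction xs)
  case Nil
  show ?case by (rule bexI[of _ 1]) simp_all
next
  case (Cons j xs)
  obtain s where s: "s \<in> signs" "f j = smul s (g j)" using Cons.prems by auto
  obtain s' where s': "s' \<in> signs" "op_prod (map f xs) = smul s' (op_prod (map g xs))"
    using Cons by auto
  show ?case
    by (rule bexI[of _ "s' * s"]) (simp_all add: s s' signs_mult)
qed

lemma project_eq: "project M b \<psi> = (1 / 2) *s (\<psi> + pm_sign b *s (M *v \<psi>))"
proof -
  have "(mat 1 + mat (pm_sign b) ** M) *v \<psi> = \<psi> + pm_sign b *s (M *v \<psi>)"
    unfolding smul_def[symmetric] by (simp add: matrix_vector_mult_add_rdistrib smul_vec)
  then show ?thesis
    by (simp add: project_def smul_def[symmetric] smul_vec)
qed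

lemma norm_vec_scale: "norm (k *s x) = norm k * norm x" for x :: "('n::finite) state"
  by (simp add: norm_vec_def L2_set_def norm_mult power_mult_distrib sum_distrib_left[symmetric]
      real_sqrt_mult sum_nonneg)

lemma scaleR_vec_scale: "r *\<^sub>R x = complex_of_real r *s x" for x :: "('n::finite) state"
  unfolding vec_eq_iff vector_scaleR_component vector_smult_component by (simp add: scaleR_conv_of_real)

lemma parallelogram_vec:
  "(norm (x + y))\<^sup>2 + (norm (x - y))\<^sup>2 = 2 * (norm x)\<^sup>2 + 2 * (norm y)\<^sup>2" for x y :: "'a::real_inner"
  by (simp add: power2_norm_eq_inner inner_add_left inner_add_right inner_diff_left inner_diff_right)

lemma pm_sign_scale: "pm_sign b *s x = (if b = 0 then x else - x)" for x :: "('n::finite) state"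
  by (cases b) (auto simp: vec_eq_iff)

lemma outcome_prob_eq: "outcome_prob \<psi> M b = (norm (\<psi> + pm_sign b *s (M *v \<psi>)))\<^sup>2 / 4"
  unfolding outcome_prob_def project_eq norm_vec_scale power_mult_distrib by (simp add: power_divide)

text \<open>The operator \<open>g\<close> exchanges \<open>\<psi> + M *v \<psi>\<close> and
  \<open>\<psi> - M *v \<psi>\<close>, so their norms agree; by the parallelogram law the squares
  add up to \<open>4\<close>, hence each is \<open>2\<close>.\<close>

lemma outcome_prob_half:
  assumes "norm \<psi> = 1" "is_unitary M" "is_unitary g" "g *v \<psi> = \<psi>" "g *v (M *v \<psi>) = - (M *v \<psi>)"
  shows "outcome_prob \<psi> M b = 1 / 2"
proof -
  have "norm (\<psi> + M *v \<psi>) = norm (g *v (\<psi> + M *v \<psi>))" by (simp add: norm_unitary[OF assms(3)])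
  also have "\<dots> = norm (\<psi> - M *v \<psi>)" by (simp add: matrix_vector_right_distrib assms)
  finally have eq: "norm (\<psi> + M *v \<psi>) = norm (\<psi> - M *v \<psi>)" .
  then have "(norm (\<psi> - M *v \<psi>))\<^sup>2 = 2"
    using parallelogram_vec[of \<psi> "M *v \<psi>"] by (simp add: norm_unitary[OF assms(2)] assms(1))
  then have "(norm (\<psi> + pm_sign b *s (M *v \<psi>)))\<^sup>2 = 2"
    using eq by (simp add: pm_sign_scale)
  then show ?thesis
    by (simp add: outcome_prob_eq)
qed

text \<open>Certainty exhausts the parallelogram law, so the vector of the opposite outcome has norm
  zero.\<close>

lemma outcome_prob_one:
  assumes "norm \<psi> = 1" "is_unitary M" "outcome_prob \<psi> M b = 1"
  shows "M *v \<psi> = pm_sign b *s \<psi>"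
proof -
  have "(norm (\<psi> + pm_sign b *s (M *v \<psi>)))\<^sup>2 = 4"
    using assms(3) by (simp add: outcome_prob_eq)
  moreover have "norm (pm_sign b *s (M *v \<psi>)) = 1"
    using sign_self_mult(3)[OF pm_sign_simps(3)] by (simp add: norm_vec_scale norm_unitary[OF assms(2)] assms(1))
  ultimately have "(norm (\<psi> - pm_sign b *s (M *v \<psi>)))\<^sup>2 = 0"
    using parallelogram_vec[of \<psi> "pm_sign b *s (M *v \<psi>)"] assms(1) by simp
  then have "\<psi> = pm_sign b *s (M *v \<psi>)" by simp
  then show ?thesis by (cases "b = 0") (simp_all add: pm_sign_scale, metis minus_minus)
qed

lemma project_fixed:
  assumes "M *v \<psi> = pm_sign b *s \<psi>" shows "project M b \<psi> = \<psi>"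
  using assms by (simp add: project_eq pm_sign_scale vec_eq_iff)

section \<open>The invariant of tracked lists of generators\<close>

context exact_generators
begin

text \<open>The clause on \<open>rest\<close> allows elements of \<open>B\<close> to be recovered,
  up to sign, from the current list.\<close>

definition valid :: "'n state \<Rightarrow> 'n oper list \<Rightarrow> bool"
  where "valid \<psi> Gs \<longleftrightarrow> norm \<psi> = 1 \<and> length Gs = length F \<and> set Gs \<subseteq> trackable \<and>
    (\<forall>j\<in>rest. \<exists>s\<in>signs. Gs ! j = smul s (G ! j)) \<and> uniquely_stabilizes (set Gs) \<psi>"

text \<open>Each element of \<open>B\<close> with the sign that makes it fix the current state;
  these play for \<open>\<psi>\<close> the role of \<open>B\<close> for
  \<open>\<psi>0\<close>.\<close>

definition B_stabilizer :: "'n state \<Rightarrow> 'n oper set"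
  where "B_stabilizer \<psi> = {x \<in> signed_B. x *v \<psi> = \<psi>}"

lemma B_stabilizer_pair: "normal_pair B_centralizer (B_stabilizer \<psi>)"
  by (rule centralizer_pair)
    (auto simp: B_stabilizer_def C.A_one C.A_mult C.A_dagger mult_fix
      intro!: dagger_fix C.K_unitary signed_B_centralizer)

lemma signed_B_square: "x \<in> signed_B \<Longrightarrow> x ** x = mat 1"
  by (auto simp: signed_B_def B_square)

lemma
  assumes "valid \<psi> Gs"
  shows valid_neq_0: "\<psi> \<noteq> 0"
    and valid_fix: "g \<in> set Gs \<Longrightarrow> g *v \<psi> = \<psi>"
    and valid_unique: "(\<And>g. g \<in> set Gs \<Longrightarrow> g *v \<phi> = \<phi>) \<Longrightarrow> \<exists>k. \<phi> = k *s \<psi>"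
    and valid_trackable: "g \<in> set Gs \<Longrightarrow> g \<in> trackable"
    and valid_stabilizer: "g \<in> set Gs \<Longrightarrow> g \<in> stabilizer \<psi>"
    and valid_rest: "j \<in> rest \<Longrightarrow> Gs ! j \<in> signed_B"
    and valid_length: "length Gs = length F"
proof -
  have stab: "uniquely_stabilizes (set Gs) \<psi>" and T: "set Gs \<subseteq> trackable"
    using assms by (simp_all add: valid_def)
  show "\<psi> \<noteq> 0" by (rule uniquely_stabilizesD(1)[OF stab])
  show f: "g *v \<psi> = \<psi>" if "g \<in> set Gs" for g by (rule uniquely_stabilizesD(2)[OF stab that])
  show "\<exists>k. \<phi> = k *s \<psi>" if "\<And>g. g \<in> set Gs \<Longrightarrow> g *v \<phi> = \<phi>"
    by (rule uniquely_stabilizesD(3)[OF stab that])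
  show t: "g \<in> trackable" if "g \<in> set Gs" for g using T that by blast
  show "g \<in> stabilizer \<psi>" if "g \<in> set Gs" using f t that by (simp add: stabilizer_def)
  show "Gs ! j \<in> signed_B" if j: "j \<in> rest"
  proof -
    obtain s where "s \<in> signs" "Gs ! j = smul s (G ! j)" using assms j unfolding valid_def by blast
    then show ?thesis using signed_B_smul B_in_signed G_rest_B[OF j] by simp
  qed
  show "length Gs = length F" using assms by (simp add: valid_def)
qed

text \<open>Since \<open>x\<close> commutes with all current generators, \<open>x *v \<psi>\<close>
  is stabilized by them and is a multiple of \<open>\<psi>\<close>; as \<open>x\<close> is an
  involution, the multiple is a sign.\<close>

lemma signed_B_eigen:
  assumes valid: "valid \<psi> Gs" and x: "x \<in> signed_B"
  shows "\<exists>s\<in>signs. smul s x \<in> B_stabilizer \<psi>"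
proof -
  have "g *v (x *v \<psi>) = x *v \<psi>" if "g \<in> set Gs" for g
  proof -
    have "g ** x = x ** g"
      using centralizer_commute trackable_centralizer valid_trackable[OF valid that] x by blast
    then have "g *v (x *v \<psi>) = x *v (g *v \<psi>)" by (simp add: matrix_vector_mul_assoc)
    then show ?thesis by (simp add: valid_fix[OF valid that])
  qed
  then obtain k where k: "x *v \<psi> = k *s \<psi>" using valid_unique[OF valid] by blast
  have "\<psi> = x *v (x *v \<psi>)" by (simp add: matrix_vector_mul_assoc signed_B_square[OF x])
  also have "\<dots> = (k * k) *s \<psi>" by (simp add: k vec_scale)
  finally have "1 *s \<psi> = (k * k) *s \<psi>" by simp
  then have kk: "k * k = 1" using valid_neq_0[OF valid] by (metis vec.scale_cancel_right)
  then have "k \<in> signs" by (auto simp: signs_def square_eq_1_iff)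
  moreover have "smul k x \<in> B_stabilizer \<psi>"
    using signed_B_smul[OF \<open>k \<in> signs\<close> x] kk by (simp add: B_stabilizer_def smul_vec k)
  ultimately show ?thesis by blast
qed

text \<open>Both orders of the product fix \<open>\<psi>\<close>, hence so does the element of
  \<open>signed_B\<close> that relates them.\<close>

lemma stabilizer_swap:
  assumes "g \<in> stabilizer \<psi>" "h \<in> stabilizer \<psi>"
  shows "eqv (B_stabilizer \<psi>) (g ** h) (h ** g)"
proof -
  obtain x where x: "x \<in> signed_B" "g ** h = x ** (h ** g)"
    using trackable_swap assms unfolding stabilizer_def eqv_def by blast
  have "(g ** h) *v \<psi> = \<psi>" "(h ** g) *v \<psi> = \<psi>" using assms by (auto simp: stabilizer_def intro: mult_fix)
  then have "x *v \<psi> = \<psi>" unfolding x(2) by (metis matrix_vector_mul_assoc)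
  with x show ?thesis by (auto simp: eqv_def B_stabilizer_def)
qed

lemma stabilizer_square:
  assumes valid: "valid \<psi> Gs" and g: "g \<in> stabilizer \<psi>"
  shows "g ** g \<in> B_stabilizer \<psi>"
proof -
  obtain k x where k: "x \<in> signed_B" "g ** g = smul k x"
    using trackable_square g unfolding stabilizer_def by blast
  obtain s where s: "s \<in> signs" "smul s x \<in> B_stabilizer \<psi>" using signed_B_eigen[OF valid k(1)] by blast
  have "smul s x *v \<psi> = \<psi>" using s(2) by (simp add: B_stabilizer_def)
  have g2: "g ** g = smul (k * s) (smul s x)" using k(2) s(1) by (simp add: mult.assoc)
  have "(g ** g) *v \<psi> = \<psi>" using g by (simp add: stabilizer_def mult_fix)
  then have "(k * s) *s \<psi> = \<psi>"
    unfolding g2 smul_vec[of "k * s"] \<open>smul s x *v \<psi> = \<psi>\<close> .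
  then have "k * s = 1" using valid_neq_0[OF valid] by (metis vec.scale_cancel_right vector_smult_lid)
  then show ?thesis using s(2) g2 by simp
qed

text \<open>The index set found for the original generators also serves the current ones, which
  differ from them by signs; fixing a nonzero vector forces the overall signs to agree.\<close>

lemma B_stabilizer_product_of_rest:
  assumes valid: "valid \<psi> Gs" and x: "x \<in> B_stabilizer \<psi>"
  shows "\<exists>X\<subseteq>rest. x = gen_power Gs (indicator_bit X)"
proof -
  obtain s b where s: "s \<in> signs" "b \<in> B" "x = smul s b" using x by (auto simp: B_stabilizer_def signed_B_def)
  obtain X where X: "X \<subseteq> rest" "b = gen_power G (indicator_bit X)" using B_product_of_rest[OF s(2)] by blast
  have "\<exists>s\<in>signs. gen_power Gs (indicator_bit X) = smul s (gen_power G (indicator_bit X))"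
    unfolding gen_power_def valid_length[OF valid] length_G
  proof (rule op_prod_signs)
    fix j
    show "\<exists>s\<in>signs. (if indicator_bit X j = 1 then Gs ! j else mat 1) =
      smul s (if indicator_bit X j = 1 then G ! j else mat 1)"
      using valid X(1) unfolding valid_def by (cases "j \<in> X") (auto intro: bexI[of _ 1])
  qed
  then obtain s' where s': "s' \<in> signs" "gen_power Gs (indicator_bit X) = smul s' b" using X(2) by blast
  have "gen_power Gs (indicator_bit X) *v \<psi> = \<psi>"
    by (rule gen_power_fix) (auto intro: valid_fix[OF valid])
  then have 1: "s' *s (b *v \<psi>) = \<psi>" by (simp add: s' smul_vec)
  have 2: "s *s (b *v \<psi>) = \<psi>" using x by (simp add: s B_stabilizer_def smul_vec)
  have "b *v \<psi> \<noteq> 0" using 1 valid_neq_0[OF valid] by auto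
  then have "s = s'" using 1 2 by (metis vec.scale_cancel_right)
  then show ?thesis using X(1) s(3) s'(2) by auto
qed

lemma valid_generate: "valid \<psi> Gs \<Longrightarrow> generate unitary_group (set Gs) = stabilizer \<psi>"
  by (rule generate_stabilizer) (auto simp: valid_def)

text \<open>Words in the current generators reduce to ordered products modulo
  \<open>B_stabilizer \<psi>\<close>. The remaining correction is a product of non-primary current
  generators and is absorbed by adding exponents.\<close>

lemma valid_gen_power:
  assumes valid: "valid \<psi> Gs" and t: "t \<in> stabilizer \<psi>"
  shows "\<exists>m. t = gen_power Gs m"
proof -
  interpret S: normal_pair B_centralizer "B_stabilizer \<psi>" by (rule B_stabilizer_pair)
  have st: "Gs ! i \<in> stabilizer \<psi>" if "i < length Gs" for i using valid_stabilizer[OF valid] that by simp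
  have GsK: "set Gs \<subseteq> B_centralizer" using valid_trackable[OF valid] trackable_centralizer by blast
  have mult: "eqv (B_stabilizer \<psi>) (gen_power Gs m ** gen_power Gs m') (gen_power Gs (\<lambda>i. m i + m' i))" for m m'
    using GsK by (rule S.gen_power_mult) (auto intro!: stabilizer_swap stabilizer_square[OF valid] st)
  have K: "gen_power Gs m \<in> B_centralizer" for m
    unfolding gen_power_def using GsK nth_mem[of _ Gs] by (intro S.op_prod_K) (auto simp: S.K_one)
  have "\<exists>m. eqv (B_stabilizer \<psi>) t (gen_power Gs m)"
    if "t \<in> generate unitary_group (set Gs)" "\<And>g. g \<in> set Gs \<Longrightarrow> is_unitary g" for t
    using that
  proof (rule generate_induct_unitary)
    show "\<exists>m. eqv (B_stabilizer \<psi>) (mat 1) (gen_power Gs m)"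
      by (rule exI[of _ "\<lambda>_. 0"]) (simp add: S.eqv_refl)
    show "\<exists>m. eqv (B_stabilizer \<psi>) s (gen_power Gs m)" if s: "s \<in> set Gs" for s
    proof -
      obtain i where i: "i < length Gs" "s = Gs ! i" using s by (auto simp: in_set_conv_nth)
      show ?thesis
        by (rule exI[of _ "indicator_bit {i}"]) (simp only: gen_power_single[OF i(1)] i(2) S.eqv_refl)
    qed
    show "\<exists>m. eqv (B_stabilizer \<psi>) (x ** y) (gen_power Gs m)"
      if "\<exists>m. eqv (B_stabilizer \<psi>) x (gen_power Gs m)" "\<exists>m. eqv (B_stabilizer \<psi>) y (gen_power Gs m)" for x y
      using that S.eqv_trans[OF S.eqv_mult[OF _ _ K] mult] by blast
    show "\<exists>m. eqv (B_stabilizer \<psi>) (dagger s) (gen_power Gs m)"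
      if s: "s \<in> set Gs" "\<exists>m. eqv (B_stabilizer \<psi>) s (gen_power Gs m)" for s
    proof -
      note u = unitary_cancel[OF trackable_unitary[OF valid_trackable[OF valid s(1)]]]
      have "dagger s = dagger (s ** s) ** s" by (simp add: mult_assoc_right u)
      then have "eqv (B_stabilizer \<psi>) (dagger s) s"
        unfolding eqv_def using S.A_dagger[OF stabilizer_square[OF valid valid_stabilizer[OF valid s(1)]]] by blast
      then show ?thesis using s(2) S.eqv_trans by blast
    qed
  qed
  then obtain m where "eqv (B_stabilizer \<psi>) t (gen_power Gs m)"
    using t valid_generate[OF valid] trackable_unitary valid_trackable[OF valid] by blast
  then obtain x where x: "x \<in> B_stabilizer \<psi>" "t = x ** gen_power Gs m" by (auto simp: eqv_def)
  obtain X where X: "X \<subseteq> rest" "x = gen_power Gs (indicator_bit X)"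
    using B_stabilizer_product_of_rest[OF valid x(1)] by blast
  have "t = gen_power Gs m ** gen_power Gs (indicator_bit X)"
    using x centralizer_commute[OF K] X(2) by (simp add: B_stabilizer_def)
  also have "\<dots> = gen_power Gs (\<lambda>i. m i + indicator_bit X i)"
    using X(1) valid_rest[OF valid] valid_length[OF valid] valid_trackable[OF valid]
    by (intro gen_power_mult_rest) (auto split: if_splits)
  finally show ?thesis by blast
qed

subsection \<open>Effective commutation\<close>

text \<open>The group commutator lies in \<open>signed_B\<close>; normalizing it to
  \<open>y\<close>, which fixes \<open>\<psi>\<close>, leaves exactly the effective commutation sign
  \<open>s\<close>.\<close>

lemma effective_sign:
  assumes valid: "valid \<psi> Gs" and M: "M \<in> trackable" and g: "g \<in> stabilizer \<psi>"
  obtains s y where "s \<in> signs" "y \<in> B_stabilizer \<psi>" "M ** g = smul s (y ** (g ** M))"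
    "commutator M g = smul s y" "commutator M g *v \<psi> = s *s \<psi>" "g *v (M *v \<psi>) = s *s (M *v \<psi>)"
proof -
  have gt: "g \<in> trackable" using g by (simp add: stabilizer_def)
  obtain x where x: "x \<in> signed_B" "M ** g = x ** (g ** M)"
    using trackable_swap[OF M gt] by (auto simp: eqv_def)
  obtain s where s: "s \<in> signs" "smul s x \<in> B_stabilizer \<psi>" using signed_B_eigen[OF valid x(1)] by blast
  define y where "y = smul s x"
  have y: "y *v \<psi> = \<psi>" "y \<in> signed_B" using s by (simp_all add: y_def B_stabilizer_def)
  have 1: "M ** g = smul s (y ** (g ** M))" using s x by (simp add: y_def)
  have 2: "commutator M g = smul s y"
    unfolding commutator_def 1
    by (simp add: matrix_mul_assoc unitary_cancel[OF trackable_unitary[OF M]] unitary_cancel[OF trackable_unitary[OF gt]])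
  have gM: "g ** M = smul s (y ** (M ** g))"
    unfolding 1 using s(1) signed_B_square[OF y(2)] by (simp add: matrix_mul_assoc)
  have yMg: "y ** (M ** g) = M ** g ** y"
    using centralizer_commute[OF C.K_mult y(2)] trackable_centralizer M gt by metis
  have "g *v (M *v \<psi>) = (g ** M) *v \<psi>" by (simp add: matrix_vector_mul_assoc)
  also have "\<dots> = s *s ((M ** g ** y) *v \<psi>)" unfolding gM yMg smul_vec ..
  also have "(M ** g ** y) *v \<psi> = M *v (g *v (y *v \<psi>))" by (simp add: matrix_vector_mul_assoc matrix_mul_assoc)
  also have "\<dots> = M *v \<psi>" using g by (simp add: y stabilizer_def)
  finally show ?thesis using that[OF s(1) s(2)[folded y_def] 1 2] 2 by (simp add: smul_vec y)
qed

text \<open>The fourth claim extends anticommutation from \<open>\<psi>\<close> to every vector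
  fixed by \<open>B_stabilizer \<psi>\<close>; the uniqueness argument applies it to vectors about
  which little else is known.\<close>

lemma effective_cases:
  assumes "valid \<psi> Gs" "M \<in> trackable" "g \<in> stabilizer \<psi>"
  shows "eff_commute \<psi> M g \<or> eff_anticommute \<psi> M g"
    "eff_commute \<psi> M g \<Longrightarrow> g *v (M *v \<psi>) = M *v \<psi>"
    "eff_anticommute \<psi> M g \<Longrightarrow> g *v (M *v \<psi>) = - (M *v \<psi>)"
    "eff_anticommute \<psi> M g \<Longrightarrow> (\<And>x. x \<in> B_stabilizer \<psi> \<Longrightarrow> x *v \<phi> = \<phi>) \<Longrightarrow> M *v (g *v \<phi>) = - (g *v (M *v \<phi>))"
    "\<not> (eff_commute \<psi> M g \<and> eff_anticommute \<psi> M g)"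
proof -
  obtain s y where s: "s \<in> signs" "y \<in> B_stabilizer \<psi>" "M ** g = smul s (y ** (g ** M))"
    "commutator M g = smul s y" "commutator M g *v \<psi> = s *s \<psi>" "g *v (M *v \<psi>) = s *s (M *v \<psi>)"
    using effective_sign[OF assms] .
  have neq: "\<psi> \<noteq> - \<psi>" using valid_neq_0[OF assms(1)] by (simp add: eq_neg_iff_add_eq_0 scaleR_2[symmetric])
  have minus: "(- 1) *s \<phi> = - \<phi>" for \<phi> :: "'n state" by (simp add: vec_eq_iff)
  show "eff_commute \<psi> M g \<or> eff_anticommute \<psi> M g"
    using s(1,5) by (auto simp: signs_def eff_commute_def eff_anticommute_def minus)
  have c: "eff_commute \<psi> M g \<longleftrightarrow> s = 1" and a: "eff_anticommute \<psi> M g \<longleftrightarrow> s = - 1"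
    using s(1,5) neq by (auto simp: signs_def eff_commute_def eff_anticommute_def minus)
  show "eff_commute \<psi> M g \<Longrightarrow> g *v (M *v \<psi>) = M *v \<psi>" using s(6) c by simp
  show "eff_anticommute \<psi> M g \<Longrightarrow> g *v (M *v \<psi>) = - (M *v \<psi>)" using s(6) a by (simp add: minus)
  show "\<not> (eff_commute \<psi> M g \<and> eff_anticommute \<psi> M g)" using c a by auto
  assume "eff_anticommute \<psi> M g" and \<phi>: "\<And>x. x \<in> B_stabilizer \<psi> \<Longrightarrow> x *v \<phi> = \<phi>"
  then have "M ** g = smul (- 1) (y ** (g ** M))" using a s(3) by simp
  moreover have "y ** (g ** M) = (g ** M) ** y"
    using centralizer_commute[OF C.K_mult, of g M y] trackable_centralizer assms(2,3) s(2)
    by (auto simp: stabilizer_def B_stabilizer_def)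
  ultimately have "M *v (g *v \<phi>) = - ((g ** M) *v (y *v \<phi>))"
    by (simp add: matrix_vector_mul_assoc smul_vec minus)
  then show "M *v (g *v \<phi>) = - (g *v (M *v \<phi>))" by (simp add: \<phi> s(2) matrix_vector_mul_assoc)
qed

text \<open>Non-primary entries are central for trackable operators, so they are neither chosen as
  pivot nor multiplied by it.\<close>

lemma rest_not_anticommute:
  assumes valid: "valid \<psi> Gs" and M: "M \<in> trackable" and j: "j \<in> rest"
  shows "\<not> eff_anticommute \<psi> M (Gs ! j)"
proof -
  have jl: "Gs ! j \<in> set Gs" using j valid_length[OF valid] by (simp add: rest_def)
  note gt = valid_trackable[OF valid jl]
  have "M ** Gs ! j = Gs ! j ** M"
    by (rule centralizer_commute[OF trackable_centralizer[OF M] valid_rest[OF valid j]])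
  then have "commutator M (Gs ! j) = mat 1"
    unfolding commutator_def
    by (simp add: unitary_cancel[OF trackable_unitary[OF M]] unitary_cancel[OF trackable_unitary[OF gt]])
  then have "eff_commute \<psi> M (Gs ! j)" by (simp add: eff_commute_def)
  then show ?thesis using effective_cases(5)[OF valid M valid_stabilizer[OF valid jl]] by blast
qed

subsection \<open>The update rules\<close>

lemma valid_data_error:
  assumes valid: "valid \<psi> Gs" and E: "E \<in> axis_preserving"
  shows "valid (E *v \<psi>) (map (\<lambda>g. E ** g ** dagger E) Gs)"
proof -
  let ?c = "\<lambda>g. E ** g ** dagger E"
  note u = axis_preservingD(1)[OF E]
  have EE: "dagger E *v (E *v \<phi>) = \<phi>" "E *v (dagger E *v \<phi>) = \<phi>" for \<phi>
    by (simp_all add: matrix_vector_mul_assoc unitary_cancel[OF u])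
  have c: "?c g *v \<phi> = E *v (g *v (dagger E *v \<phi>))" for g \<phi> by (simp add: matrix_vector_mul_assoc matrix_mul_assoc)
  have "uniquely_stabilizes (set (map ?c Gs)) (E *v \<psi>)"
  proof (rule uniquely_stabilizesI)
    show "E *v \<psi> \<noteq> 0" using valid_neq_0[OF valid] EE(1)[of \<psi>] by auto
    show "s *v (E *v \<psi>) = E *v \<psi>" if "s \<in> set (map ?c Gs)" for s
      using that valid_fix[OF valid] by (auto simp: c EE)
    show "\<exists>k. \<phi> = k *s (E *v \<psi>)" if \<phi>: "\<And>s. s \<in> set (map ?c Gs) \<Longrightarrow> s *v \<phi> = \<phi>" for \<phi>
    proof -
      have "g *v (dagger E *v \<phi>) = dagger E *v \<phi>" if g: "g \<in> set Gs" for g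
      proof -
        have "E *v (g *v (dagger E *v \<phi>)) = \<phi>" using \<phi>[of "?c g"] g by (simp only: c) simp
        then have "dagger E *v (E *v (g *v (dagger E *v \<phi>))) = dagger E *v \<phi>" by simp
        then show ?thesis by (simp only: EE)
      qed
      then obtain k where "dagger E *v \<phi> = k *s \<psi>" using valid_unique[OF valid] by blast
      then have "\<phi> = k *s (E *v \<psi>)" using EE(2)[of \<phi>] by (simp add: vec_scale)
      then show ?thesis ..
    qed
  qed
  moreover have "\<exists>s\<in>signs. map ?c Gs ! j = smul s (G ! j)" if j: "j \<in> rest" for j
  \<comment> \<open>Conjugation affects an element of \<open>B\<close> by a sign only, so the sign
    on each non-primary entry is multiplied by \<open>t\<close>.\<close>
  proof -
    obtain s where s: "s \<in> signs" "Gs ! j = smul s (G ! j)" using valid j unfolding valid_def by blast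
    obtain t where t: "t \<in> signs" "E ** G ! j = smul t (G ! j ** E)"
      using axis_preservingD(3)[OF E G_rest_B[OF j]] by (auto simp: sign_commute_def)
    have "map ?c Gs ! j = smul (s * t) (G ! j)"
      using j valid_length[OF valid] by (simp add: rest_def s t unitary_cancel[OF u])
    then show ?thesis using signs_mult[OF s(1) t(1)] by blast
  qed
  ultimately show ?thesis
    using valid trackable_conj[OF _ E] by (auto simp: valid_def norm_unitary[OF u])
qed

text \<open>An entry multiplied by the pivot fixes \<open>M *v \<psi>\<close> because two sign
  changes cancel. For uniqueness, a vector fixed by the new list is sent into the old eigenspace by
  adding its pivot image, and is recovered from there by projecting with \<open>M\<close>.\<close>

lemma valid_random:
  assumes valid: "valid \<psi> Gs" and M: "M \<in> trackable" "M ** M = mat 1"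
    and p: "p < length Gs" "eff_anticommute \<psi> M (Gs ! p)"
  shows "valid ((1 / norm (project M b \<psi>)) *\<^sub>R project M b \<psi>)
    ((map (\<lambda>g. if eff_anticommute \<psi> M g then g ** Gs ! p else g) Gs)[p := mat (pm_sign b) ** M])"
proof -
  let ?\<sigma> = "pm_sign b" and ?gp = "Gs ! p"
  define \<psi>' where "\<psi>' = (1 / norm (project M b \<psi>)) *\<^sub>R project M b \<psi>"
  define Gs' where "Gs' = (map (\<lambda>g. if eff_anticommute \<psi> M g then g ** ?gp else g) Gs)[p := smul ?\<sigma> M]"
  have gp: "?gp \<in> set Gs" using p by simp
  note gps = valid_stabilizer[OF valid gp]
  have nrm: "norm (project M b \<psi>) \<noteq> 0"
    using outcome_prob_half[of \<psi> M ?gp b] valid M p valid_fix[OF valid gp] effective_cases(3)[OF valid M(1) gps]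
      trackable_unitary valid_trackable[OF valid gp]
    by (auto simp: outcome_prob_def valid_def)
  obtain k where k: "k \<noteq> 0" "\<psi>' = k *s (\<psi> + ?\<sigma> *s (M *v \<psi>))"
  proof
    show "complex_of_real (1 / norm (project M b \<psi>)) * (1 / 2) \<noteq> 0" using nrm by simp
    show "\<psi>' = (complex_of_real (1 / norm (project M b \<psi>)) * (1 / 2)) *s (\<psi> + ?\<sigma> *s (M *v \<psi>))"
      unfolding \<psi>'_def scaleR_vec_scale by (subst (2) project_eq) (simp add: vector_smult_assoc)
  qed
  have fix': "g *v \<psi>' = \<psi>'" if "g *v \<psi> = \<psi>" "g *v (M *v \<psi>) = M *v \<psi>" for g
    by (simp add: k vec_scale matrix_vector_right_distrib that)
  have \<sigma>: "?\<sigma> * ?\<sigma> = 1" "norm ?\<sigma> = 1" by simp_all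
  have nth: "Gs' ! j = (if j = p then smul ?\<sigma> M else if eff_anticommute \<psi> M (Gs ! j) then Gs ! j ** ?gp else Gs ! j)"
    if "j < length Gs" for j using that p by (simp add: Gs'_def nth_list_update)
  have len': "length Gs' = length Gs" by (simp add: Gs'_def)
  have fixed: "g *v \<psi>' = \<psi>'" if g: "g \<in> set Gs'" for g
  proof -
    obtain j where j: "j < length Gs" "g = Gs' ! j" using g len' by (auto simp: in_set_conv_nth)
    then have js: "Gs ! j \<in> set Gs" by simp
    note e = effective_cases[OF valid M(1) valid_stabilizer[OF valid js]]
    consider "j = p" | "j \<noteq> p" "eff_anticommute \<psi> M (Gs ! j)" | "j \<noteq> p" "\<not> eff_anticommute \<psi> M (Gs ! j)" by blast
    then show ?thesis
    proof cases
      case 1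
      then have "g = smul ?\<sigma> M" using nth j by simp
      then show ?thesis
        by (simp add: k vec_scale smul_vec matrix_vector_right_distrib matrix_vector_mul_assoc M(2)
            vector_add_ldistrib vector_smult_assoc \<sigma> mult.commute)
    next
      case 2
      then have "g = Gs ! j ** ?gp" using nth j by simp
      moreover have "(Gs ! j ** ?gp) *v (M *v \<psi>) = M *v \<psi>"
        using e(3)[OF 2(2)] effective_cases(3)[OF valid M(1) gps p(2)]
        by (simp add: matrix_vector_mul_assoc[symmetric] vec_minus)
      ultimately show ?thesis using valid_fix[OF valid] js gp by (intro fix') (auto intro: mult_fix)
    next
      case 3
      then show ?thesis using nth j e(1,2) valid_fix[OF valid js] by (intro fix') auto
    qed
  qed
  have unique: "\<exists>l. \<phi> = l *s \<psi>'" if \<phi>: "\<And>g. g \<in> set Gs' \<Longrightarrow> g *v \<phi> = \<phi>" for \<phi>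
  proof -
    have \<phi>j: "Gs' ! j *v \<phi> = \<phi>" if "j < length Gs" for j using \<phi> len' that by simp
    have rest: "Gs ! j *v \<phi> = \<phi>" if "j \<in> rest" for j
    proof -
      have "j < length Gs" using that valid_length[OF valid] by (simp add: rest_def)
      moreover have "Gs' ! j = Gs ! j"
        using nth[OF \<open>j < length Gs\<close>] rest_not_anticommute[OF valid M(1) that] p(2) by auto
      ultimately show ?thesis using \<phi>j by metis
    qed
    \<comment> \<open>The old and new lists agree at non-primary positions, and these entries
      produce all of \<open>B_stabilizer \<psi>\<close>.\<close>
    have B\<phi>: "x *v \<phi> = \<phi>" if x: "x \<in> B_stabilizer \<psi>" for x
    proof -
      obtain X where "X \<subseteq> rest" "x = gen_power Gs (indicator_bit X)"
        using B_stabilizer_product_of_rest[OF valid x] by blast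
      then show ?thesis using rest by (auto intro!: gen_power_fix split: if_splits)
    qed
    \<comment> \<open>As operators these commute only modulo \<open>B_stabilizer \<psi>\<close>, but
      on \<open>\<phi>\<close> that correction is trivial.\<close>
    have swap: "g *v (h *v \<phi>) = h *v (g *v \<phi>)" if gh: "g \<in> stabilizer \<psi>" "h \<in> stabilizer \<psi>" for g h
    proof -
      obtain x where x: "x \<in> B_stabilizer \<psi>" "g ** h = x ** (h ** g)"
        using stabilizer_swap[OF gh] by (auto simp: eqv_def)
      moreover have "x ** (h ** g) = h ** g ** x"
        using centralizer_commute[OF C.K_mult, of h g x] trackable_centralizer gh x(1)
        by (auto simp: stabilizer_def B_stabilizer_def)
      ultimately have "(g ** h) *v \<phi> = (h ** g) *v (x *v \<phi>)" by (simp add: matrix_vector_mul_assoc)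
      then show ?thesis by (simp add: B\<phi>[OF x(1)] matrix_vector_mul_assoc)
    qed
    have sq: "?gp *v (?gp *v \<phi>) = \<phi>"
      using B\<phi>[OF stabilizer_square[OF valid gps]] by (simp add: matrix_vector_mul_assoc)
    \<comment> \<open>Up to a factor of two this projects \<open>\<phi>\<close> onto the
      \<open>+1\<close> eigenspace of the pivot.\<close>
    define \<xi> where "\<xi> = \<phi> + ?gp *v \<phi>"
    have "g *v \<xi> = \<xi>" if g: "g \<in> set Gs" for g
    proof -
      obtain j where j: "j < length Gs" "g = Gs ! j" using g by (auto simp: in_set_conv_nth)
      note gs = valid_stabilizer[OF valid g]
      consider "j = p" | "j \<noteq> p" "eff_anticommute \<psi> M g" | "j \<noteq> p" "\<not> eff_anticommute \<psi> M g" by blast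
      then show ?thesis
      proof cases
        case 1
        then show ?thesis using j by (simp add: \<xi>_def matrix_vector_right_distrib sq add.commute)
      next
        case 2
        \<comment> \<open>Since \<open>g ** ?gp\<close> fixes \<open>\<phi>\<close> and
          \<open>?gp\<close> is an involution on it, \<open>g\<close> and \<open>?gp\<close> agree
          on \<open>\<phi>\<close>; thus \<open>g\<close> merely exchanges the two summands of
          \<open>\<xi>\<close>.\<close>
        then have "g *v (?gp *v \<phi>) = \<phi>" using \<phi>j[OF j(1)] nth[OF j(1)] j(2) by (simp add: matrix_vector_mul_assoc)
        moreover from this have "?gp *v (g *v \<phi>) = ?gp *v (?gp *v \<phi>)"
          by (simp only: swap[OF gs gps] sq)
        then have "dagger ?gp *v (?gp *v (g *v \<phi>)) = dagger ?gp *v (?gp *v (?gp *v \<phi>))" by (rule arg_cong)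
        then have "g *v \<phi> = ?gp *v \<phi>"
          unfolding matrix_vector_mul_assoc unitary_cancel(2)[OF trackable_unitary[OF valid_trackable[OF valid gp]]]
          by (simp add: matrix_vector_mul_assoc unitary_cancel[OF trackable_unitary[OF valid_trackable[OF valid gp]]])
        ultimately show ?thesis by (simp add: \<xi>_def matrix_vector_right_distrib add.commute)
      next
        case 3
        then have "g *v \<phi> = \<phi>" using \<phi>j[OF j(1)] nth[OF j(1)] j(2) by simp
        then show ?thesis using swap[OF gs gps] by (simp add: \<xi>_def matrix_vector_right_distrib)
      qed
    qed
    then obtain l where l: "\<xi> = l *s \<psi>" using valid_unique[OF valid] by blast
    have M\<phi>: "?\<sigma> *s (M *v \<phi>) = \<phi>" using \<phi>j[OF p(1)] nth[OF p(1)] by (simp add: smul_vec)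
    have "?\<sigma> *s (M *v (?gp *v \<phi>)) = - (?gp *v (?\<sigma> *s (M *v \<phi>)))"
      using effective_cases(4)[OF valid M(1) gps p(2) B\<phi>] by (simp add: vec_scale vec_eq_iff)
    then have "?\<sigma> *s (M *v (?gp *v \<phi>)) = - (?gp *v \<phi>)" by (simp add: M\<phi>)
    \<comment> \<open>The measurement projection keeps the summand \<open>\<phi>\<close> and
      annihilates \<open>?gp *v \<phi>\<close>, which lies in the opposite eigenspace of
      \<open>M\<close>.\<close>
    then have "\<xi> + ?\<sigma> *s (M *v \<xi>) = \<phi> + \<phi>"
      by (simp add: \<xi>_def matrix_vector_right_distrib vector_add_ldistrib M\<phi>)
    then have "\<phi> + \<phi> = l *s (\<psi> + ?\<sigma> *s (M *v \<psi>))"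
      by (simp add: l vec_scale vector_add_ldistrib vector_smult_assoc mult.commute)
    also have "\<dots> = (l / k) *s \<psi>'" using k by (simp add: vector_smult_assoc)
    finally have "(1 / 2) *s (\<phi> + \<phi>) = (1 / 2 * (l / k)) *s \<psi>'" by (simp only: vector_smult_assoc)
    moreover have "(1 / 2) *s (\<phi> + \<phi>) = \<phi>" by (simp add: vec_eq_iff)
    ultimately have "\<phi> = (1 / 2 * (l / k)) *s \<psi>'" by simp
    then show ?thesis ..
  qed
  have track': "set Gs' \<subseteq> trackable"
    unfolding Gs'_def using valid_trackable[OF valid] trackable_mult trackable_smul[OF M(1) \<sigma>(2)] gp
    by (auto dest!: subsetD[OF set_update_subset_insert])
  have "\<exists>s\<in>signs. Gs' ! j = smul s (G ! j)" if j: "j \<in> rest" for j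
  proof -
    have "j < length Gs" using j valid_length[OF valid] by (simp add: rest_def)
    moreover have "Gs' ! j = Gs ! j"
      using nth[OF \<open>j < length Gs\<close>] rest_not_anticommute[OF valid M(1) j] p(2) by auto
    ultimately show ?thesis using valid j by (simp add: valid_def)
  qed
  moreover have "norm \<psi>' = 1" using nrm by (simp add: \<psi>'_def)
  moreover from this have "uniquely_stabilizes (set Gs') \<psi>'"
    using fixed unique by (intro uniquely_stabilizesI) auto
  ultimately have "valid \<psi>' Gs'" using track' len' valid_length[OF valid] by (simp add: valid_def)
  then show ?thesis by (simp add: \<psi>'_def Gs'_def smul_def)
qed

end

section \<open>Clifford membership and the invariant along a run\<close>

lemma clifford_mult:
  assumes "U \<in> clifford_group" "V \<in> clifford_group" shows "U ** V \<in> clifford_group"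
proof -
  have "U ** V ** P ** dagger (U ** V) \<in> pauli_group" if "P \<in> pauli_group" for P
  proof -
    have "U ** (V ** P ** dagger V) ** dagger U \<in> pauli_group" using assms that by (simp add: clifford_group_def)
    then show ?thesis by (simp add: matrix_mul_assoc)
  qed
  then show ?thesis using assms by (simp add: clifford_group_def is_unitary_mult)
qed

text \<open>The phase cancels in the conjugation, so the arbitrary phases of
  \<open>axis_group\<close> do not leave the Clifford group.\<close>

lemma clifford_smul: "norm k = 1 \<Longrightarrow> U \<in> clifford_group \<Longrightarrow> smul k U \<in> clifford_group"
  by (auto simp: clifford_group_def is_unitary_smul unit_cnj)

lemma pauli_group_clifford:
  assumes A: "A \<in> pauli_group" shows "A \<in> clifford_group"
proof -
  have "A ** P ** dagger A \<in> pauli_group" if P: "P \<in> pauli_group" for P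
  proof -
    obtain s where "s \<in> signs" "A ** P = smul s (P ** A)" using pauli_group_commute[OF A P] by blast
    then show ?thesis
      using P by (simp add: unitary_cancel[OF pauli_group_unitary[OF A]] pauli_group_smul signs_phases)
  qed
  then show ?thesis using pauli_group_unitary[OF A] by (simp add: clifford_group_def)
qed

lemma op_prod_clifford: "set As \<subseteq> clifford_group \<Longrightarrow> op_prod As \<in> clifford_group"
proof (induction As)
  case Nil
  show ?case using pauli_group_clifford[OF pauli_op_in_group[of "\<lambda>_. PI"]] by (simp add: pauli_op_PI)
qed (simp add: clifford_mult)

context exact_generators
begin

lemma G_clifford: "set G \<subseteq> clifford_group"
proof -
  have "U \<in> clifford_group" if U: "Us \<in> set F" "U \<in> set Us" for U Us
  proof -
    consider k P where "k \<in> phases" "P \<in> single_paulis" "U = smul k P" | "U \<in> clifford_group"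
      using factors[OF U] by (auto simp: pauli_factor_def smul_def clifford_factor_def)
    then show ?thesis
      by cases (auto intro: pauli_group_clifford pauli_group_smul single_pauli_simps)
  qed
  then show ?thesis by (auto simp: generators_def intro!: op_prod_clifford)
qed

lemma trackable_clifford:
  assumes "t \<in> trackable" shows "t \<in> clifford_group"
proof -
  obtain a m where a: "a \<in> axis_group" "t = a ** gen_power G m" using assms by (rule trackableE)
  obtain k c where k: "a = smul k (ax c)" "norm k = 1" using a(1) by (rule axis_groupE)
  have "op_prod [] \<in> clifford_group" by (rule op_prod_clifford) simp
  then have "gen_power G m \<in> clifford_group"
    unfolding gen_power_def using G_clifford nth_mem[of _ G] by (intro op_prod_clifford) auto
  then show ?thesis
    unfolding a(2) k(1)
    by (rule clifford_mult[OF clifford_smul[OF k(2) pauli_group_clifford[OF axis_pauli_simps(1)]]])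
qed

lemma effective_involution:
  assumes "i < length F" "M \<in> effective_ops F (F ! i)" "is_hermitian M"
  shows "M ** M = mat 1"
  by (rule hermitian_unitary_square[OF trackable_unitary[OF trackable_effective[OF assms(1,2)]] assms(3)])

lemma valid_initial: "valid \<psi>0 G"
  using norm0 stab0 G_trackable unfolding valid_def by (auto intro: bexI[of _ 1])

text \<open>Finiteness is not visible from the generators; it comes from identifying the group with
  \<open>stabilizer \<psi>\<close>.\<close>

lemma valid_group:
  assumes valid: "valid \<psi> Gs"
  shows "clifford_stabilizer_group (generate unitary_group (set Gs))"
proof -
  let ?H = "generate unitary_group (set Gs)"
  have unit: "is_unitary g" if "g \<in> set Gs" for g using trackable_unitary valid_trackable[OF valid that] by blast
  have "subgroup ?H unitary_group"
    by (rule group.generate_is_subgroup[OF group_unitary]) (auto simp: unit)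
  moreover have "finite ?H" "?H \<subseteq> clifford_group"
    using valid_generate[OF valid] stabilizer_finite[OF valid_neq_0[OF valid]] trackable_clifford
    by (auto simp: stabilizer_def)
  moreover have "\<psi> \<in> common_eigenspace ?H"
    using generate_fix[OF unit valid_fix[OF valid]] by (auto simp: common_eigenspace_def)
  ultimately show ?thesis
    using valid_neq_0[OF valid] by (auto simp: clifford_stabilizer_group_def)
qed

lemma anticommute_half:
  assumes valid: "valid \<psi> Gs" and M: "M \<in> trackable" and g: "g \<in> set Gs" "eff_anticommute \<psi> M g"
  shows "outcome_prob \<psi> M b = 1 / 2"
  using valid trackable_unitary M valid_trackable[OF valid g(1)] valid_fix[OF valid g(1)]
    effective_cases(3)[OF valid M valid_stabilizer[OF valid g(1)] g(2)]
  by (intro outcome_prob_half[of _ _ g]) (auto simp: valid_def)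

text \<open>Without an anticommuting generator, \<open>M *v \<psi>\<close> is stabilized and equals
  plus or minus \<open>\<psi>\<close>, so an outcome that can occur is certain. Hence some update
  rule always applies.\<close>

lemma commute_deterministic:
  assumes valid: "valid \<psi> Gs" and M: "M \<in> trackable" "M ** M = mat 1"
    and comm: "\<And>g. g \<in> set Gs \<Longrightarrow> \<not> eff_anticommute \<psi> M g" and nz: "outcome_prob \<psi> M b \<noteq> 0"
  shows "outcome_prob \<psi> M b = 1"
proof -
  have "g *v (M *v \<psi>) = M *v \<psi>" if "g \<in> set Gs" for g
    using effective_cases(1,2)[OF valid M(1) valid_stabilizer[OF valid that]] comm[OF that] by blast
  then obtain k where k: "M *v \<psi> = k *s \<psi>" using valid_unique[OF valid] by blast
  have "\<psi> = M *v (M *v \<psi>)" by (simp add: matrix_vector_mul_assoc M)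
  also have "\<dots> = (k * k) *s \<psi>" by (simp add: k vec_scale)
  finally have "1 *s \<psi> = (k * k) *s \<psi>" by simp
  then have "k * k = 1" using valid_neq_0[OF valid] by (metis vec.scale_cancel_right)
  then have "k = 1 \<or> k = - 1" by (simp add: square_eq_1_iff)
  moreover have "\<psi> + pm_sign b *s (k *s \<psi>) = (1 + pm_sign b * k) *s \<psi>"
    by (simp add: vec_eq_iff algebra_simps)
  then have "outcome_prob \<psi> M b = (norm (1 + pm_sign b * k))\<^sup>2 / 4"
    using valid by (simp only: outcome_prob_eq k norm_vec_scale valid_def mult_1_right)
  ultimately show ?thesis using nz by (cases b) (auto simp: pm_sign_def)
qed

lemma deterministic_product:
  assumes valid: "valid \<psi> Gs" and M: "M \<in> trackable" and p: "outcome_prob \<psi> M b = 1"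
  shows "\<exists>m. gen_power Gs m = smul (pm_sign b) M"
proof -
  have "M *v \<psi> = pm_sign b *s \<psi>"
    using valid by (intro outcome_prob_one[OF _ trackable_unitary[OF M] p]) (simp add: valid_def)
  then have "smul (pm_sign b) M \<in> stabilizer \<psi>"
    using trackable_smul[OF M] by (simp add: stabilizer_def smul_vec)
  then show ?thesis using valid_gen_power[OF valid] by metis
qed

text \<open>State step and update are given independently, which covers every choice of pivot. The
  deterministic rule requires probability one, and then the state does not move.\<close>

lemma valid_step:
  assumes valid: "valid \<psi> Gs" and step: "state_step F \<psi> ev \<psi>'" and upd: "gen_update \<psi> ev Gs Gs'"
    and hermM: "\<And>i M. i < length F \<Longrightarrow> M \<in> effective_ops F (F ! i) \<Longrightarrow> is_hermitian M"
  shows "valid \<psi>' Gs'"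
  using step
proof cases
  case (data_error E)
  then have "Gs' = map (\<lambda>g. E ** g ** dagger E) Gs" using upd by (auto elim: gen_update.cases)
  then show ?thesis
    using valid_data_error[OF valid data_errors_preserving] data_error by simp
next
  case (measurement i M b r)
  note M = trackable_effective[OF measurement(3,4)] effective_involution[OF measurement(3,4) hermM[OF measurement(3,4)]]
  from upd show ?thesis unfolding measurement(1)
  proof cases
    case (random p)
    then show ?thesis unfolding measurement(2) by (simp only:) (rule valid_random[OF valid M])
  next
    case deterministic
    have "M *v \<psi> = pm_sign b *s \<psi>"
      using valid by (intro outcome_prob_one[OF _ trackable_unitary[OF M(1)] deterministic(2)]) (simp add: valid_def)
    then have "project M b \<psi> = \<psi>" by (rule project_fixed)
    then have "\<psi>' = \<psi>" using valid by (simp add: measurement(2) valid_def)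
    then show ?thesis using valid deterministic(1) by simp
  qed
qed

end

theorem theorem1:
  fixes F :: "('n::finite) oper list list" and \<psi>0 :: "'n state"
  assumes "clifford_stabilizer_group (generate unitary_group (set (generators F)))"
    and "uniquely_stabilizes (generate unitary_group (set (generators F))) \<psi>0"
    and "norm \<psi>0 = 1"
    and "admissible F"
    and "tracked F \<psi>0 \<psi> Gs"
  shows
    "length Gs = CARD('n) \<and>
     clifford_stabilizer_group (generate unitary_group (set Gs)) \<and>
     uniquely_stabilizes (set Gs) \<psi> \<and>
     (\<forall>ev \<psi>'. state_step F \<psi> ev \<psi>' \<longrightarrow> (\<exists>Gs'. gen_update \<psi> ev Gs Gs')) \<and>
     (\<forall>i<CARD('n). \<forall>M\<in>effective_ops F (F ! i).
        (\<forall>g\<in>set Gs. eff_commute \<psi> M g \<or> eff_anticommute \<psi> M g) \<and>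
        ((\<exists>g\<in>set Gs. eff_anticommute \<psi> M g) \<longrightarrow> (\<forall>b. outcome_prob \<psi> M b = 1 / 2)) \<and>
        (\<forall>b. outcome_prob \<psi> M b = 1 \<longrightarrow>
           (\<forall>r Gs'. gen_update \<psi> (Measurement i M b r) Gs Gs' \<longrightarrow>
              generate unitary_group (set Gs') = generate unitary_group (set Gs)) \<and>
           (\<exists>m. gen_power Gs m = mat (pm_sign b) ** M)))"
proof -
  have adm: "length F = CARD('n)"
    "\<And>Us U. Us \<in> set F \<Longrightarrow> U \<in> set Us \<Longrightarrow> pauli_factor U \<or> clifford_factor U"
    "\<And>Us. Us \<in> set F \<Longrightarrow> is_hermitian (op_prod Us)"
    "\<And>Us M. Us \<in> set F \<Longrightarrow> M \<in> effective_ops F Us \<Longrightarrow> is_hermitian M"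
    using assms(4) unfolding admissible_def by blast+
  have "primary_support_exact F" using assms(4) by (simp add: admissible_def)
  then obtain B J Q v where pse: "init_paulis F B" "primary_indices F B J" "dressing_axes F Q"
    "\<forall>j<length F. anticommutation_support Q (generators F ! j) (v j)"
    "\<forall>m :: nat \<Rightarrow> bit. (\<Sum>j<length F. m j *s v j) = 0 \<longleftrightarrow> zero_primary Q (gen_power (generators F) m)"
    unfolding primary_support_exact_def by blast
  \<comment> \<open>The hypotheses concern the generated group; unitarity of the generators is
    extracted first so that uniqueness can be transferred to the list.\<close>
  have "generate unitary_group (set (generators F)) \<subseteq> carrier unitary_group"
    using assms(1) subgroup.subset unfolding clifford_stabilizer_group_def by blast
  then have unit: "is_unitary g" if "g \<in> set (generators F)" for g
    using generate.incl[OF that, of unitary_group] by auto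
  have "uniquely_stabilizes (set (generators F)) \<psi>0"
    using assms(2) common_eigenspace_generate[OF unit] by (simp add: uniquely_stabilizes_def)
  then interpret exact_generators F B J Q v \<psi>0
    using pse adm assms(3) by unfold_locales auto
  have hermM: "is_hermitian M" if "i < length F" "M \<in> effective_ops F (F ! i)" for i M
    using adm(4)[of "F ! i"] that by simp
  have valid: "valid \<psi> Gs"
    using assms(5) by induction (auto intro: valid_initial valid_step hermM)
  have upd: "\<exists>Gs'. gen_update \<psi> ev Gs Gs'" if "state_step F \<psi> ev \<psi>'" for ev \<psi>'
    using that
  proof cases
    case (data_error E)
    then show ?thesis using gen_update.data_error by blast
  next
    case (measurement i M b r)
    note M = trackable_effective[OF measurement(3,4)] effective_involution[OF measurement(3,4) hermM[OF measurement(3,4)]]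
    show ?thesis
    proof (cases "\<exists>g\<in>set Gs. eff_anticommute \<psi> M g")
      case True
      then obtain p where "p < length Gs" "eff_anticommute \<psi> M (Gs ! p)" by (auto simp: in_set_conv_nth)
      then show ?thesis unfolding measurement(1) using gen_update.random by blast
    next
      case False
      then have "outcome_prob \<psi> M b = 1" using commute_deterministic[OF valid M] measurement(5) by blast
      then show ?thesis unfolding measurement(1) using gen_update.deterministic by blast
    qed
  qed
  have meas: "(\<forall>g\<in>set Gs. eff_commute \<psi> M g \<or> eff_anticommute \<psi> M g) \<and>
        ((\<exists>g\<in>set Gs. eff_anticommute \<psi> M g) \<longrightarrow> (\<forall>b. outcome_prob \<psi> M b = 1 / 2)) \<and>
        (\<forall>b. outcome_prob \<psi> M b = 1 \<longrightarrow>
           (\<forall>r Gs'. gen_update \<psi> (Measurement i M b r) Gs Gs' \<longrightarrow>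
              generate unitary_group (set Gs') = generate unitary_group (set Gs)) \<and>
           (\<exists>m. gen_power Gs m = mat (pm_sign b) ** M))"
    if i: "i < CARD('n)" and eff: "M \<in> effective_ops F (F ! i)" for i M
  proof -
    have M: "M \<in> trackable" using i eff len by (intro trackable_effective) simp_all
    have half: "outcome_prob \<psi> M b = 1 / 2" if "g \<in> set Gs" "eff_anticommute \<psi> M g" for g b
      by (rule anticommute_half[OF valid M that])
    \<comment> \<open>A pivot would make the probability one half, so certainty leaves only the rule
      that keeps the list.\<close>
    have same: "Gs' = Gs" if p: "outcome_prob \<psi> M b = 1" and u: "gen_update \<psi> (Measurement i M b r) Gs Gs'" for b r Gs'
      using u
    proof cases
      case (random p)
      then show ?thesis using half[of "Gs ! p" b] p by simp
    qed
    have "\<exists>m. gen_power Gs m = mat (pm_sign b) ** M" if "outcome_prob \<psi> M b = 1" for b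
      using deterministic_product[OF valid M that] by (simp add: smul_def)
    then show ?thesis
      using effective_cases(1)[OF valid M valid_stabilizer[OF valid]] half same by blast
  qed
  show ?thesis
  proof (intro conjI allI ballI)
    show "length Gs = CARD('n)" "uniquely_stabilizes (set Gs) \<psi>" using valid len by (simp_all add: valid_def)
  qed (use valid_group[OF valid] upd meas in blast)+
qed

end
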